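(* Let $\Theta_B,\Theta_U>0$ be constants, let $p,e,s$ satisfy (C1)--(C3) and let $\mu,\eta,\kappa$ satisfy (C4) with $\beta>6$ (see context), and let $M>0$. Let $\mathcal{V}$ be a stationary statistical solution of the Rayleigh--Bénard problem for the Navier--Stokes--Fourier system and $(\varrho,S,\mathbf{m})$ the associated stationary process, i.e. the canonical process $(\varrho,S,\mathbf{m})\times\tau\mapsto(\varrho,S,\mathbf{m})(\tau,\cdot)\in H$ on the probability space $(\mathcal{T},\mathfrak{B}[\mathcal{T}],\mathcal{V})$. Let $F:H\to\mathbb{R}$ be a Borel measurable function such that $$\int_{\mathcal{T}}|F(\varrho(0,\cdot),S(0,\cdot),\mathbf{m}(0,\cdot))|\,d\mathcal{V}<\infty .$$ Then there exists a measurable function $\overline F:(\mathcal{T},\mathcal{V})\to\mathbb{R}$ such that $$\frac1T\int_0^TF(\varrho(t,\cdot),S(t,\cdot),\mathbf{m}(t,\cdot))\,dt\to\overline F\quad\text{as }T\to\infty$$ $\mathcal{V}$-a.s. and in $L^1(\mathcal{T},\mathcal{V})$.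
   Context: **Setting.** $\Omega=\mathbb{T}^2\times(0,1)$, where $\mathbb{T}^2$ is the flat two-dimensional torus, $x=(x_1,x_2,x_3)$. Unknowns: density $\varrho\ge 0$, absolute temperature $\vartheta>0$ (a.e.), velocity $\mathbf{u}$ with values in $\mathbb{R}^3$. The Navier--Stokes--Fourier system is $$\partial_t\varrho+\mathrm{div}_x(\varrho\mathbf{u})=0,\quad \partial_t(\varrho\mathbf{u})+\mathrm{div}_x(\varrho\mathbf{u}\otimes\mathbf{u})+\nabla_x p=\mathrm{div}_x\mathbb{S}+\varrho\nabla_x G,$$ $$\partial_t(\varrho e)+\mathrm{div}_x(\varrho e\mathbf{u})+\mathrm{div}_x\mathbf{q}=\mathbb{S}:\mathbb{D}_x\mathbf{u}-p\,\mathrm{div}_x\mathbf{u},$$ with $G=-g x_3$ ($g$ a fixed gravitational constant), $\mathbb{D}_x\mathbf{u}=\frac12(\nabla_x\mathbf{u}+\nabla_x^t\mathbf{u})$, $\mathbb{S}=\mu(\vartheta)\left(\nabla_x\mathbf{u}+\nabla_x^t\mathbf{u}-\frac23\mathrm{div}_x\mathbf{u}\,\mathbb{I}\right)+\eta(\vartheta)\mathrm{div}_x\mathbf{u}\,\mathbb{I}$, $\mathbf{q}=-\kappa(\vartheta)\nabla_x\vartheta$, and Rayleigh--Bénard boundary conditions $\mathbf{u}|_{x_3=0}=\mathbf{u}|_{x_3=1}=0$, $\vartheta|_{x_3=0}=\Theta_B$, $\vartheta|_{x_3=1}=\Theta_U$. The total energy density is $E(\varrho,\vartheta,\mathbf{u})=\frac12\varrho|\mathbf{u}|^2+\varrho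 e(\varrho,\vartheta)$. **Constitutive hypotheses.** (C1) $p(\varrho,\vartheta)=\vartheta^{5/2}P(\varrho\vartheta^{-3/2})+\frac a3\vartheta^4$, $\ e(\varrho,\vartheta)=\frac32\frac{\vartheta^{5/2}}{\varrho}P(\varrho\vartheta^{-3/2})+\frac a\varrho\vartheta^4$, with $a>0$, $P\in C^1[0,\infty)$. (C2) $P(0)=0$, $P'(Z)>0$ for $Z\ge0$, $0<\frac{\frac53P(Z)-P'(Z)Z}{Z}\le c$ for $Z>0$, and $\lim_{Z\to\infty}P(Z)Z^{-5/3}=p_\infty>0$. (C3) $s(\varrho,\vartheta)=\mathcal{S}(\varrho\vartheta^{-3/2})+\frac{4a}{3}\frac{\vartheta^3}{\varrho}$, with $\mathcal{S}'(Z)=-\frac32\frac{\frac53P(Z)-P'(Z)Z}{Z^2}$ and $\lim_{Z\to\infty}\mathcal{S}(Z)=0$. (C4) $\mu,\eta,\kappa$ are continuously differentiable and $0<\underline\mu(1+\vartheta)\le\mu(\vartheta)$, $|\mu'(\vartheta)|\le\overline\mu$, $0\le\eta(\vartheta)\le\overline\eta(1+\vartheta)$, $0<\underline\kappa(1+\vartheta^\beta)\le\kappa(\vartheta)\le\overline\kappa(1+\vartheta^\beta)$, with positive constants $\underline\mu,\overline\mu,\overline\eta,\underline\kappa,\overline\kappa$. The products $\varrho e,\varrho s$ are extended continuously to $\varrho=0$. **Entire weak solution** (on $t\in\mathbb{R}$). $(\varrho,\vartheta,\mathbf{u})$ such that all integrals below make sense and: (1) $\varrho\in L^\infty_{loc}(\mathbb{R};L^\gamma(\Omega))$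 for some $\gamma>1$; $\mathbf{u}\in L^2_{loc}(\mathbb{R};W^{1,2}_0(\Omega;\mathbb{R}^3))$; $\vartheta^{\beta/2},\log\vartheta\in L^2_{loc}(\mathbb{R};W^{1,2}(\Omega))$ for some $\beta\ge2$; $\vartheta-\vartheta_B\in L^2_{loc}(\mathbb{R};W^{1,2}_0(\Omega))$, where $\vartheta_B(x)=\Theta_B+x_3(\Theta_U-\Theta_B)$. (2) $\int_{\mathbb{R}}\int_\Omega[\varrho\partial_t\varphi+\varrho\mathbf{u}\cdot\nabla_x\varphi]\,dx\,dt=0$ and $\int_{\mathbb{R}}\int_\Omega[b(\varrho)\partial_t\varphi+b(\varrho)\mathbf{u}\cdot\nabla_x\varphi+(b(\varrho)-b'(\varrho)\varrho)\mathrm{div}_x\mathbf{u}\,\varphi]\,dx\,dt=0$ for all $\varphi\in C^1_c(\mathbb{R}\times\overline\Omega)$ and all $b\in C^1(\mathbb{R})$ with $b'\in C_c(\mathbb{R})$. (3) $\int_{\mathbb{R}}\int_\Omega[\varrho\mathbf{u}\cdot\partial_t\boldsymbol\varphi+\varrho\mathbf{u}\otimes\mathbf{u}:\nabla_x\boldsymbol\varphi+p\,\mathrm{div}_x\boldsymbol\varphi]\,dx\,dt=\int_{\mathbb{R}}\int_\Omega[\mathbb{S}:\nabla_x\boldsymbol\varphi-\varrho\nabla_xG\cdot\boldsymbol\varphi]\,dx\,dt$ for all $\boldsymbol\varphi\in C^1_c(\mathbb{R}\times\Omega;\mathbb{R}^3)$. (4) $-\int_{\mathbb{R}}\int_\Omega[\varrho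 s\partial_t\varphi+\varrho s\mathbf{u}\cdot\nabla_x\varphi+\frac{\mathbf{q}}\vartheta\cdot\nabla_x\varphi]\,dx\,dt\ge\int_{\mathbb{R}}\int_\Omega\frac\varphi\vartheta\left[\mathbb{S}:\mathbb{D}_x\mathbf{u}-\frac{\mathbf{q}\cdot\nabla_x\vartheta}{\vartheta}\right]dx\,dt$ for all $\varphi\in C^1_c(\mathbb{R}\times\Omega)$, $\varphi\ge0$. (5) $-\int_{\mathbb{R}}\partial_t\psi\int_\Omega[\frac12\varrho|\mathbf{u}|^2+\varrho e-\tilde\vartheta\varrho s]\,dx\,dt+\int_{\mathbb{R}}\psi\int_\Omega\frac{\tilde\vartheta}{\vartheta}\left[\mathbb{S}:\mathbb{D}_x\mathbf{u}-\frac{\mathbf{q}\cdot\nabla_x\vartheta}\vartheta\right]dx\,dt\le\int_{\mathbb{R}}\psi\int_\Omega\left[\varrho\mathbf{u}\cdot\nabla_xG-\varrho s\,\partial_t\tilde\vartheta-\varrho s\mathbf{u}\cdot\nabla_x\tilde\vartheta-\frac{\mathbf{q}}{\vartheta}\cdot\nabla_x\tilde\vartheta\right]dx\,dt$ for all $\psi\in C^1_c(\mathbb{R})$, $\psi\ge0$, and all $\tilde\vartheta\in C^1(\mathbb{R}\times\overline\Omega)$ with $\tilde\vartheta>0$, $\tilde\vartheta|_{x_3=0}=\Theta_B$, $\tilde\vartheta|_{x_3=1}=\Theta_U$. The total mass $\int_\Omega\varrho(t,\cdot)\,dx$ is independent of $t$. The functions $P,\mathcal{S},\mu,\eta,\kappa$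 and the constants $a,g$ are fixed. **Conservative entropy variables.** $\mathbf{m}=\varrho\mathbf{u}$, $S=\varrho s(\varrho,\vartheta)$. For a weak solution, $\varrho$ and $\mathbf{m}$ are weakly continuous in time (tested against $C^1_c(\Omega)$ functions), and $S$ has one-sided weak limits at every time; instantaneous values of $S$ are the left limits $\langle S(\tau-,\cdot);\phi\rangle=\lim_{\delta\to0+}\frac1\delta\int_{\tau-\delta}^\tau\int_\Omega\varrho s\,\phi\,dx\,dt$, so $\tau\mapsto\langle S;\phi\rangle$ is càglàd. **Trajectory space.** Fix $k>\frac32$, so that $W^{k,2}_0(\Omega)\hookrightarrow C(\overline\Omega)$, an orthonormal basis $\{\phi_n\}_{n\ge1}$ of $W^{k,2}_0(\Omega)$ and an orthonormal basis $\{\boldsymbol\varphi_n\}_{n\ge1}$ of $W^{k,2}_0(\Omega;\mathbb{R}^3)$, both made of smooth functions; $W^{-k,2}$ is the dual space. For $L\in\mathbb{N}$, $\mathcal{T}_L$ is the set of triples $(\varrho,S,\mathbf{m})$ of functions of $t\in\mathbb{R}$ with $\varrho,S\in L^\infty(\mathbb{R};W^{-k,2}(\Omega))$, $\mathbf{m}\in L^\infty(\mathbb{R};W^{-k,2}(\Omega;\mathbb{R}^3))$, such that for all $n$ the functions $\langle\varrho;\phi_n\rangle$, $\langle\mathbf{m};\boldsymbol\varphi_n\rangle$ are continuous on $\mathbb{R}$, $\langle S;\phi_n\rangle$ is càglàd on $\mathbb{R}$, and $\sup_{t\in\mathbb{R}}$ of each of the three $W^{-k,2}$-norms is $\le L$.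 $\mathcal{T}=\bigcup_{L=1}^\infty\mathcal{T}_L$. With $\Phi(Z)=\frac{Z}{1+Z}$, $$d_{\mathcal{T}}[(\varrho^1,S^1,\mathbf{m}^1);(\varrho^2,S^2,\mathbf{m}^2)]=\sum_{n=1}^\infty\frac1{2^n}\int_{-\infty}^\infty e^{-t^2}\Big[\Phi\big(\|\langle\varrho^1-\varrho^2;\phi_n\rangle\|_{C[-|t|,|t|]}\big)+\Phi\big(\|\langle\mathbf{m}^1-\mathbf{m}^2;\boldsymbol\varphi_n\rangle\|_{C[-|t|,|t|]}\big)+\Phi\big([\langle S^1;\phi_n\rangle;\langle S^2;\phi_n\rangle]_{D[-|t|,|t|]}\big)\Big]dt,$$ where $D[-t,t]$ is the Skorokhod space of real càglàd functions on $[-t,t]$ and $[\cdot;\cdot]_{D[-t,t]}$ its complete metric inducing the Skorokhod $M_1$ topology (cf. Whitt, *Stochastic-Process Limits*, Ch. 12; for monotone functions, convergence is equivalent to pointwise convergence on a dense set including the end points). $\mathcal{T}$ carries the inductive topology: convergence means all terms lie in one $\mathcal{T}_L$ and $d_{\mathcal{T}}$-distance tends to $0$. $\mathfrak{B}[\mathcal{T}]$ is the family of Borel sets of $\mathcal{T}$. **The set $\mathcal{A}$.** For fixed $M>0$, $\mathcal{A}$ is the set of all $(\varrho,S,\mathbf{m})=(\varrho,\varrho s(\varrho,\vartheta),\varrho\mathbf{u})$ such that $(\varrho,\vartheta,\mathbf{u})$ is an entire weak solution with $\int_\Omega\varrho\,dx=M$ and total energy $\int_\Omega E(t,\cdot)\,dx$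 uniformly bounded for $t\in\mathbb{R}$. It is contained in some $\mathcal{T}_L$. **Stationary statistical solution.** A Borel probability measure $\mathcal{V}\in\mathfrak{P}(\mathcal{A})$ (viewed as a Borel probability measure on $\mathcal{T}$) such that $\mathcal{V}[\mathfrak{B}(\cdot+T)]=\mathcal{V}[\mathfrak{B}]$ for every Borel set $\mathfrak{B}\subset\mathcal{T}$ and $T\in\mathbb{R}$, where $\mathfrak{B}(\cdot+T)$ is the set of $T$-shifts of elements of $\mathfrak{B}$. **State space.** $H=W^{-k,2}(\Omega)\times W^{-k,2}(\Omega)\times W^{-k,2}(\Omega;\mathbb{R}^3)$. *)

theory Defs
  imports "HOL-Probability.Probability"
begin

section \<open>The domain and Sobolev spaces on it\<close>

text \<open>
  The domain is the product of the flat torus (the plane modulo the integer lattice) with the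
  interval from 0 to 1.  Functions on it are written as functions on \<^typ>\<open>real^3\<close>:
  integrals are taken over the fundamental domain \<open>cell\<close>, and functions for which
  differentiability or continuity matters are required to be periodic in the first two variables.
  Since test functions are periodic, a weak derivative sees no boundary at the vertical faces of
  \<open>cell\<close>.
\<close>

type_synonym sfield = "real^3 \<Rightarrow> real"
type_synonym vfield = "real^3 \<Rightarrow> real^3"

definition cell :: "(real^3) set" where
  "cell = {x. 0 \<le> x$1 \<and> x$1 < 1 \<and> 0 \<le> x$2 \<and> x$2 < 1 \<and> 0 < x$3 \<and> x$3 < 1}"

definition slab :: "(real^3) set" where
  "slab = {x. 0 < x$3 \<and> x$3 < 1}"

definition closed_slab :: "(real^3) set" where
  "closed_slab = {x. 0 \<le> x$3 \<and> x$3 \<le> 1}"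

definition periodic :: "(real^3 \<Rightarrow> 'b) \<Rightarrow> bool" where
  "periodic f \<longleftrightarrow> (\<forall>x. f (x + axis 1 1) = f x \<and> f (x + axis 2 1) = f x)"

definition pdx :: "3 \<Rightarrow> sfield \<Rightarrow> sfield" where
  "pdx j f x = frechet_derivative f (at x) (axis j 1)"

definition smooth_on :: "(real^3) set \<Rightarrow> sfield \<Rightarrow> bool" where
  "smooth_on U f \<longleftrightarrow> (\<forall>js. \<forall>x\<in>U. foldr pdx js f differentiable (at x))"

type_synonym multi_index = "3 \<Rightarrow> nat"

definition mi_order :: "multi_index \<Rightarrow> nat" where
  "mi_order \<alpha> = (\<Sum>j\<in>UNIV. \<alpha> j)"

definition mderiv :: "multi_index \<Rightarrow> sfield \<Rightarrow> sfield" where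
  "mderiv \<alpha> f = (pdx 1 ^^ \<alpha> 1) ((pdx 2 ^^ \<alpha> 2) ((pdx 3 ^^ \<alpha> 3) f))"

definition Cc_infty :: "sfield set" where
  "Cc_infty = {\<phi>. smooth_on UNIV \<phi> \<and> periodic \<phi> \<and>
     (\<exists>\<delta>>0. \<forall>x. \<phi> x \<noteq> 0 \<longrightarrow> \<delta> \<le> x$3 \<and> x$3 \<le> 1 - \<delta>)}"

definition L2 :: "sfield set" where
  "L2 = {f. f \<in> borel_measurable (lebesgue_on cell) \<and>
            integrable (lebesgue_on cell) (\<lambda>x. (f x)\<^sup>2)}"

definition weak_deriv :: "multi_index \<Rightarrow> sfield \<Rightarrow> sfield \<Rightarrow> bool" where
  "weak_deriv \<alpha> f g \<longleftrightarrow> (\<forall>\<phi>\<in>Cc_infty.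
     (LINT x|lebesgue_on cell. f x * mderiv \<alpha> \<phi> x) =
     (-1) ^ mi_order \<alpha> * (LINT x|lebesgue_on cell. g x * \<phi> x))"

definition wderiv :: "multi_index \<Rightarrow> sfield \<Rightarrow> sfield" where
  "wderiv \<alpha> f = (SOME g. g \<in> L2 \<and> weak_deriv \<alpha> f g)"

text \<open>
  Sobolev spaces of real order \<open>k \<ge> 0\<close>.  For integral \<open>k\<close> they carry the usual inner product;
  for non-integral \<open>k\<close> the Sobolev--Slobodeckij form of order \<open>frac k\<close> of the top-order
  derivatives is added.  The distance in it is that of the torus times the interval.
  Elements are functions, not classes modulo null sets: the inner product is
  therefore degenerate, which is harmless since only bounded functionals act on these spaces.
\<close>

definition torus_dist :: "real^3 \<Rightarrow> real^3 \<Rightarrow> real" where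
  "torus_dist x y = (INF (i, j)\<in>(UNIV :: (int \<times> int) set).
     norm (x - y + of_int i *\<^sub>R axis 1 1 + of_int j *\<^sub>R axis 2 1))"

definition slob_integrand :: "real \<Rightarrow> sfield \<Rightarrow> sfield \<Rightarrow> (real^3) \<times> (real^3) \<Rightarrow> real" where
  "slob_integrand \<sigma> g h = (\<lambda>(x, y).
     (g x - g y) * (h x - h y) / torus_dist x y powr (3 + 2 * \<sigma>))"

definition W2 :: "real \<Rightarrow> sfield set" where
  "W2 k = {f \<in> L2.
     (\<forall>\<alpha>. real (mi_order \<alpha>) \<le> k \<longrightarrow> (\<exists>g\<in>L2. weak_deriv \<alpha> f g)) \<and>
     (frac k > 0 \<longrightarrow> (\<forall>\<alpha>. int (mi_order \<alpha>) = \<lfloor>k\<rfloor> \<longrightarrow>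
        integrable (lebesgue_on (cell \<times> cell))
          (slob_integrand (frac k) (wderiv \<alpha> f) (wderiv \<alpha> f))))}"

definition W2_inner :: "real \<Rightarrow> sfield \<Rightarrow> sfield \<Rightarrow> real" where
  "W2_inner k f g =
     (\<Sum>\<alpha> | real (mi_order \<alpha>) \<le> k. LINT x|lebesgue_on cell. wderiv \<alpha> f x * wderiv \<alpha> g x) +
     (if frac k > 0 then
        (\<Sum>\<alpha> | int (mi_order \<alpha>) = \<lfloor>k\<rfloor>.
           LINT z|lebesgue_on (cell \<times> cell). slob_integrand (frac k) (wderiv \<alpha> f) (wderiv \<alpha> g) z)
      else 0)"

definition W20 :: "real \<Rightarrow> sfield set" where
  "W20 k = {f \<in> W2 k. \<forall>\<epsilon>>0. \<exists>\<phi>\<in>Cc_infty.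
     sqrt (W2_inner k (\<lambda>x. f x - \<phi> x) (\<lambda>x. f x - \<phi> x)) < \<epsilon>}"

definition W20v :: "real \<Rightarrow> vfield set" where
  "W20v k = {f. \<forall>i. (\<lambda>x. f x $ i) \<in> W20 k}"

definition W2v_inner :: "real \<Rightarrow> vfield \<Rightarrow> vfield \<Rightarrow> real" where
  "W2v_inner k f g = (\<Sum>i\<in>UNIV. W2_inner k (\<lambda>x. f x $ i) (\<lambda>x. g x $ i))"

definition smooth_field :: "sfield \<Rightarrow> bool" where
  "smooth_field f \<longleftrightarrow> periodic f \<and> smooth_on slab f"

definition orthonormal_basis ::
  "('a \<Rightarrow> 'b::real_vector) set \<Rightarrow> (('a \<Rightarrow> 'b) \<Rightarrow> ('a \<Rightarrow> 'b) \<Rightarrow> real) \<Rightarrow> (nat \<Rightarrow> 'a \<Rightarrow> 'b) \<Rightarrow> bool"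
  where
  "orthonormal_basis W ip \<phi> \<longleftrightarrow>
     (\<forall>n. \<phi> n \<in> W) \<and> (\<forall>m n. ip (\<phi> m) (\<phi> n) = (if m = n then 1 else 0)) \<and>
     (\<forall>f\<in>W. \<forall>\<epsilon>>0. \<exists>N c. let r = (\<lambda>x. f x - (\<Sum>n<N. c n *\<^sub>R \<phi> n x)) in sqrt (ip r r) < \<epsilon>)"

section \<open>Dual spaces and the state space\<close>

text \<open>
  Bounded linear functionals on \<open>W\<close>, extended by 0 outside \<open>W\<close> so that equality of functionals is
  equality of functions.
\<close>

definition dual_space ::
  "('a \<Rightarrow> 'b::real_vector) set \<Rightarrow> (('a \<Rightarrow> 'b) \<Rightarrow> ('a \<Rightarrow> 'b) \<Rightarrow> real) \<Rightarrow> (('a \<Rightarrow> 'b) \<Rightarrow> real) set"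
  where
  "dual_space W ip = {l.
     (\<forall>f\<in>W. \<forall>g\<in>W. l (\<lambda>x. f x + g x) = l f + l g) \<and>
     (\<forall>c. \<forall>f\<in>W. l (\<lambda>x. c *\<^sub>R f x) = c * l f) \<and>
     (\<exists>C. \<forall>f\<in>W. \<bar>l f\<bar> \<le> C * sqrt (ip f f)) \<and>
     (\<forall>f. f \<notin> W \<longrightarrow> l f = 0)}"

definition dual_norm ::
  "('a \<Rightarrow> 'b) set \<Rightarrow> (('a \<Rightarrow> 'b) \<Rightarrow> ('a \<Rightarrow> 'b) \<Rightarrow> real) \<Rightarrow> (('a \<Rightarrow> 'b) \<Rightarrow> real) \<Rightarrow> real"
  where
  "dual_norm W ip l = (SUP f\<in>{f\<in>W. sqrt (ip f f) \<le> 1}. \<bar>l f\<bar>)"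

text \<open>
  The library's \<open>mtopology\<close>, but with a definition that does not presuppose the laws of a metric (the
  library asks for symmetry and nonnegativity on the whole type, that is, also outside \<open>M\<close>).
\<close>

definition metric_topology :: "'a set \<Rightarrow> ('a \<Rightarrow> 'a \<Rightarrow> real) \<Rightarrow> 'a topology" where
  "metric_topology M d =
     topology (\<lambda>U. U \<subseteq> M \<and> (\<forall>x\<in>U. \<exists>r>0. \<forall>y\<in>M. d x y < r \<longrightarrow> y \<in> U))"

lemma metric_topology_eq_mtopology:
  assumes "Metric_space M d"
  shows "metric_topology M d = Metric_space.mtopology M d"
proof -
  interpret Metric_space M d by fact
  have "(\<forall>y\<in>M. d x y < r \<longrightarrow> y \<in> U) \<longleftrightarrow> mball x r \<subseteq> U" if "x \<in> M" for U x r
    using that by auto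
  then have "(U \<subseteq> M \<and> (\<forall>x\<in>U. \<exists>r>0. \<forall>y\<in>M. d x y < r \<longrightarrow> y \<in> U)) \<longleftrightarrow>
        (U \<subseteq> M \<and> (\<forall>x. x \<in> U \<longrightarrow> (\<exists>r>0. mball x r \<subseteq> U)))" for U
    by (meson subset_eq)
  then show ?thesis
    unfolding metric_topology_def mtopology_def mopen_def[abs_def] by simp
qed

definition dual_topology ::
  "('a \<Rightarrow> 'b::real_vector) set \<Rightarrow> (('a \<Rightarrow> 'b) \<Rightarrow> ('a \<Rightarrow> 'b) \<Rightarrow> real) \<Rightarrow> (('a \<Rightarrow> 'b) \<Rightarrow> real) topology"
  where
  "dual_topology W ip =
     metric_topology (dual_space W ip) (\<lambda>l l'. dual_norm W ip (\<lambda>f. l f - l' f))"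

definition borel_on :: "'a topology \<Rightarrow> 'a measure" where
  "borel_on X = sigma (topspace X) {U. openin X U}"

definition Wneg :: "real \<Rightarrow> (sfield \<Rightarrow> real) set" where
  "Wneg k = dual_space (W20 k) (W2_inner k)"

definition Wneg_norm :: "real \<Rightarrow> (sfield \<Rightarrow> real) \<Rightarrow> real" where
  "Wneg_norm k = dual_norm (W20 k) (W2_inner k)"

definition Wneg_top :: "real \<Rightarrow> (sfield \<Rightarrow> real) topology" where
  "Wneg_top k = dual_topology (W20 k) (W2_inner k)"

definition Wnegv :: "real \<Rightarrow> (vfield \<Rightarrow> real) set" where
  "Wnegv k = dual_space (W20v k) (W2v_inner k)"

definition Wnegv_norm :: "real \<Rightarrow> (vfield \<Rightarrow> real) \<Rightarrow> real" where
  "Wnegv_norm k = dual_norm (W20v k) (W2v_inner k)"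

definition Wnegv_top :: "real \<Rightarrow> (vfield \<Rightarrow> real) topology" where
  "Wnegv_top k = dual_topology (W20v k) (W2v_inner k)"

type_synonym state = "(sfield \<Rightarrow> real) \<times> (sfield \<Rightarrow> real) \<times> (vfield \<Rightarrow> real)"

definition state_space :: "real \<Rightarrow> state topology" where
  "state_space k = prod_topology (Wneg_top k) (prod_topology (Wneg_top k) (Wnegv_top k))"

section \<open>The Skorokhod \<open>M\<^sub>1\<close> topology\<close>

definition caglad :: "(real \<Rightarrow> real) \<Rightarrow> bool" where
  "caglad x \<longleftrightarrow> (\<forall>t. (x \<longlongrightarrow> x t) (at_left t) \<and> (\<exists>l. (x \<longlongrightarrow> l) (at_right t)))"

definition caglad_space :: "real \<Rightarrow> real \<Rightarrow> (real \<Rightarrow> real) set" where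
  "caglad_space a b = {x \<in> extensional {a..b}.
     (\<forall>t. a < t \<and> t \<le> b \<longrightarrow> (x \<longlongrightarrow> x t) (at_left t)) \<and>
     (\<forall>t. a \<le> t \<and> t < b \<longrightarrow> (\<exists>l. (x \<longlongrightarrow> l) (at_right t)))}"

text \<open>
  Completed graphs and parametric representations as in Whitt, Chapter 12, mirrored in time:
  at a jump a caglad function takes the value on the left, so the vertical segment at \<open>t\<close> runs from
  \<open>x t\<close> to the right limit.
\<close>

definition completed_graph :: "real \<Rightarrow> real \<Rightarrow> (real \<Rightarrow> real) \<Rightarrow> (real \<times> real) set" where
  "completed_graph a b x = {(z, t). a \<le> t \<and> t \<le> b \<and>
     z \<in> closed_segment (x t) (if t < b then Lim (at_right t) x else x t)}"

definition graph_le :: "(real \<Rightarrow> real) \<Rightarrow> real \<times> real \<Rightarrow> real \<times> real \<Rightarrow> bool" where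
  "graph_le x = (\<lambda>(z1, t1) (z2, t2). t1 < t2 \<or> (t1 = t2 \<and> \<bar>x t1 - z1\<bar> \<le> \<bar>x t1 - z2\<bar>))"

definition parametric_rep ::
  "real \<Rightarrow> real \<Rightarrow> (real \<Rightarrow> real) \<Rightarrow> (real \<Rightarrow> real) \<Rightarrow> (real \<Rightarrow> real) \<Rightarrow> bool" where
  "parametric_rep a b x u r \<longleftrightarrow>
     continuous_on {0..1} u \<and> continuous_on {0..1} r \<and>
     (\<lambda>s. (u s, r s)) ` {0..1} = completed_graph a b x \<and>
     (\<forall>s1\<in>{0..1}. \<forall>s2\<in>{0..1}. s1 \<le> s2 \<longrightarrow> graph_le x (u s1, r s1) (u s2, r s2))"

definition M1_dist :: "real \<Rightarrow> real \<Rightarrow> (real \<Rightarrow> real) \<Rightarrow> (real \<Rightarrow> real) \<Rightarrow> ennreal" where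
  "M1_dist a b x y = Inf {ennreal (max (SUP s\<in>{0..1}. \<bar>u s - v s\<bar>) (SUP s\<in>{0..1}. \<bar>r s - q s\<bar>)) |
     u r v q. parametric_rep a b x u r \<and> parametric_rep a b y v q}"

text \<open>
  \<open>M1_dist\<close> is Whitt's standard metric; it induces the \<open>M\<^sub>1\<close> topology but is not complete.
  A family of complete metrics for the \<open>M\<^sub>1\<close> topologies on the windows \<open>[-t, t]\<close>:
  being metrics, they induce that topology iff they have the same convergent sequences with the
  same limits as \<open>M1_dist\<close>.  Measurability in the size of the window is what gives a meaning to the
  integral in the metric on trajectories below.
\<close>

definition M1_complete_metrics :: "(real \<Rightarrow> (real \<Rightarrow> real) \<Rightarrow> (real \<Rightarrow> real) \<Rightarrow> real) \<Rightarrow> bool" where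
  "M1_complete_metrics dM \<longleftrightarrow>
     (\<forall>t>0. Metric_space (caglad_space (-t) t) (dM t) \<and>
        Metric_space.mcomplete (caglad_space (-t) t) (dM t) \<and>
        (\<forall>X x. range X \<subseteq> caglad_space (-t) t \<and> x \<in> caglad_space (-t) t \<longrightarrow>
           (\<lambda>j::nat. dM t (X j) x) \<longlonglongrightarrow> 0 \<longleftrightarrow> (\<lambda>j. M1_dist (-t) t (X j) x) \<longlonglongrightarrow> 0)) \<and>
     (\<forall>x y. caglad x \<and> caglad y \<longrightarrow>
        (\<lambda>t. dM \<bar>t\<bar> (restrict x {-\<bar>t\<bar>..\<bar>t\<bar>}) (restrict y {-\<bar>t\<bar>..\<bar>t\<bar>})) \<in> borel_measurable borel)"

section \<open>The trajectory space\<close>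

type_synonym trajectory =
  "(real \<Rightarrow> sfield \<Rightarrow> real) \<times> (real \<Rightarrow> sfield \<Rightarrow> real) \<times> (real \<Rightarrow> vfield \<Rightarrow> real)"

definition traj_level ::
  "real \<Rightarrow> (nat \<Rightarrow> sfield) \<Rightarrow> (nat \<Rightarrow> vfield) \<Rightarrow> nat \<Rightarrow> trajectory set" where
  "traj_level k \<phi> \<psi> L = {(\<rho>, S, m).
     \<rho> \<in> lebesgue \<rightarrow>\<^sub>M borel_on (Wneg_top k) \<and>
     S \<in> lebesgue \<rightarrow>\<^sub>M borel_on (Wneg_top k) \<and>
     m \<in> lebesgue \<rightarrow>\<^sub>M borel_on (Wnegv_top k) \<and>
     (\<forall>t. \<rho> t \<in> Wneg k \<and> S t \<in> Wneg k \<and> m t \<in> Wnegv k) \<and>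
     (\<forall>n. continuous_on UNIV (\<lambda>t. \<rho> t (\<phi> n)) \<and> continuous_on UNIV (\<lambda>t. m t (\<psi> n)) \<and>
          caglad (\<lambda>t. S t (\<phi> n))) \<and>
     (\<forall>t. Wneg_norm k (\<rho> t) \<le> real L \<and> Wneg_norm k (S t) \<le> real L \<and> Wnegv_norm k (m t) \<le> real L)}"

definition traj_set :: "real \<Rightarrow> (nat \<Rightarrow> sfield) \<Rightarrow> (nat \<Rightarrow> vfield) \<Rightarrow> trajectory set" where
  "traj_set k \<phi> \<psi> = (\<Union>L\<in>{1..}. traj_level k \<phi> \<psi> L)"

definition Phi :: "real \<Rightarrow> real" where
  "Phi Z = Z / (1 + Z)"

definition C_dist :: "real \<Rightarrow> (real \<Rightarrow> real) \<Rightarrow> (real \<Rightarrow> real) \<Rightarrow> real" where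
  "C_dist r x y = (SUP s\<in>{-r..r}. \<bar>x s - y s\<bar>)"

text \<open>The bases are enumerated from 0, hence the weights \<open>1 / 2 ^ Suc n\<close>.\<close>

definition traj_dist ::
  "(nat \<Rightarrow> sfield) \<Rightarrow> (nat \<Rightarrow> vfield) \<Rightarrow> (real \<Rightarrow> (real \<Rightarrow> real) \<Rightarrow> (real \<Rightarrow> real) \<Rightarrow> real) \<Rightarrow>
   trajectory \<Rightarrow> trajectory \<Rightarrow> real" where
  "traj_dist \<phi> \<psi> dM = (\<lambda>(\<rho>1, S1, m1) (\<rho>2, S2, m2).
     (\<Sum>n. 1 / 2 ^ Suc n * (LINT t|lborel. exp (- t\<^sup>2) *
        (Phi (C_dist \<bar>t\<bar> (\<lambda>s. \<rho>1 s (\<phi> n)) (\<lambda>s. \<rho>2 s (\<phi> n))) +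
         Phi (C_dist \<bar>t\<bar> (\<lambda>s. m1 s (\<psi> n)) (\<lambda>s. m2 s (\<psi> n))) +
         Phi (dM \<bar>t\<bar> (restrict (\<lambda>s. S1 s (\<phi> n)) {-\<bar>t\<bar>..\<bar>t\<bar>})
                     (restrict (\<lambda>s. S2 s (\<phi> n)) {-\<bar>t\<bar>..\<bar>t\<bar>}))))))"

text \<open>
  The inductive topology: a set is open iff its trace on each level is open for the metric there.
\<close>

definition traj_top ::
  "real \<Rightarrow> (nat \<Rightarrow> sfield) \<Rightarrow> (nat \<Rightarrow> vfield) \<Rightarrow> (real \<Rightarrow> (real \<Rightarrow> real) \<Rightarrow> (real \<Rightarrow> real) \<Rightarrow> real) \<Rightarrow>
   trajectory topology" where
  "traj_top k \<phi> \<psi> dM = topology (\<lambda>U. U \<subseteq> traj_set k \<phi> \<psi> \<and>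
     (\<forall>L\<ge>1. openin (metric_topology (traj_level k \<phi> \<psi> L) (traj_dist \<phi> \<psi> dM))
               (U \<inter> traj_level k \<phi> \<psi> L)))"

definition at_time :: "trajectory \<Rightarrow> real \<Rightarrow> state" where
  "at_time = (\<lambda>(\<rho>, S, m) \<tau>. (\<rho> \<tau>, S \<tau>, m \<tau>))"

definition shift :: "real \<Rightarrow> trajectory \<Rightarrow> trajectory" where
  "shift T = (\<lambda>(\<rho>, S, m). (\<lambda>t. \<rho> (t + T), \<lambda>t. S (t + T), \<lambda>t. m (t + T)))"

section \<open>The Rayleigh--B\'enard problem\<close>

record nsf =
  Pf :: "real \<Rightarrow> real"
  Sf :: "real \<Rightarrow> real"
  mu :: "real \<Rightarrow> real"
  eta :: "real \<Rightarrow> real"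
  kappa :: "real \<Rightarrow> real"
  rad :: real
  grav :: real
  Theta_B :: real
  Theta_U :: real

definition pressure :: "nsf \<Rightarrow> real \<Rightarrow> real \<Rightarrow> real" where
  "pressure D \<rho> \<theta> = \<theta> powr (5/2) * Pf D (\<rho> * \<theta> powr (-3/2)) + rad D / 3 * \<theta> ^ 4"

definition energy :: "nsf \<Rightarrow> real \<Rightarrow> real \<Rightarrow> real" where
  "energy D \<rho> \<theta> =
     3/2 * (\<theta> powr (5/2) / \<rho>) * Pf D (\<rho> * \<theta> powr (-3/2)) + rad D / \<rho> * \<theta> ^ 4"

definition entropy :: "nsf \<Rightarrow> real \<Rightarrow> real \<Rightarrow> real" where
  "entropy D \<rho> \<theta> = Sf D (\<rho> * \<theta> powr (-3/2)) + 4 * rad D / 3 * (\<theta> ^ 3 / \<rho>)"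

text \<open>
  The products with the density, extended continuously to vacuum: \<open>Pf D 0 = 0\<close>, and
  \<open>Z * Sf D Z\<close> tends to 0 as \<open>Z\<close> tends to 0.
\<close>

definition rho_e :: "nsf \<Rightarrow> real \<Rightarrow> real \<Rightarrow> real" where
  "rho_e D \<rho> \<theta> = (if \<rho> = 0 then rad D * \<theta> ^ 4 else \<rho> * energy D \<rho> \<theta>)"

definition rho_s :: "nsf \<Rightarrow> real \<Rightarrow> real \<Rightarrow> real" where
  "rho_s D \<rho> \<theta> = (if \<rho> = 0 then 4 * rad D / 3 * \<theta> ^ 3 else \<rho> * entropy D \<rho> \<theta>)"

definition constitutive :: "nsf \<Rightarrow> bool" where
  "constitutive D \<longleftrightarrow> rad D > 0 \<and>
     (\<exists>P'. (\<forall>Z\<ge>0. (Pf D has_real_derivative P' Z) (at Z within {0..})) \<and>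
        continuous_on {0..} P' \<and>
        Pf D 0 = 0 \<and> (\<forall>Z\<ge>0. P' Z > 0) \<and>
        (\<exists>c. \<forall>Z>0. 0 < (5/3 * Pf D Z - P' Z * Z) / Z \<and> (5/3 * Pf D Z - P' Z * Z) / Z \<le> c) \<and>
        (\<exists>p_inf>0. ((\<lambda>Z. Pf D Z * Z powr (-5/3)) \<longlongrightarrow> p_inf) at_top) \<and>
        (\<forall>Z>0. (Sf D has_real_derivative - 3/2 * ((5/3 * Pf D Z - P' Z * Z) / Z\<^sup>2)) (at Z))) \<and>
     (Sf D \<longlongrightarrow> 0) at_top"

definition transport :: "nsf \<Rightarrow> real \<Rightarrow> bool" where
  "transport D \<beta> \<longleftrightarrow>
     (\<forall>f\<in>{mu D, eta D, kappa D}. (\<forall>\<theta>>0. f differentiable (at \<theta>)) \<and> continuous_on {0<..} (deriv f)) \<and>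
     (\<exists>mu_lo>0. \<forall>\<theta>>0. mu_lo * (1 + \<theta>) \<le> mu D \<theta>) \<and>
     (\<exists>mu_hi>0. \<forall>\<theta>>0. \<bar>deriv (mu D) \<theta>\<bar> \<le> mu_hi) \<and>
     (\<exists>eta_hi>0. \<forall>\<theta>>0. 0 \<le> eta D \<theta> \<and> eta D \<theta> \<le> eta_hi * (1 + \<theta>)) \<and>
     (\<exists>ka_lo>0. \<forall>\<theta>>0. ka_lo * (1 + \<theta> powr \<beta>) \<le> kappa D \<theta>) \<and>
     (\<exists>ka_hi>0. \<forall>\<theta>>0. kappa D \<theta> \<le> ka_hi * (1 + \<theta> powr \<beta>))"

definition grad_G :: "nsf \<Rightarrow> real^3" where
  "grad_G D = - grav D *\<^sub>R axis 3 1"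

text \<open>
  Below \<open>A\<close> stands for the velocity gradient, \<open>A $ i $ j\<close> being the derivative of component \<open>i\<close> in
  direction \<open>j\<close>, and \<open>h\<close> for the temperature gradient.  The inner product of matrices is the
  Frobenius product.
\<close>

definition sym_grad :: "real^3^3 \<Rightarrow> real^3^3" where
  "sym_grad A = (1/2) *\<^sub>R (A + transpose A)"

definition stress :: "nsf \<Rightarrow> real \<Rightarrow> real^3^3 \<Rightarrow> real^3^3" where
  "stress D \<theta> A = mu D \<theta> *\<^sub>R (A + transpose A - (2/3 * trace A) *\<^sub>R mat 1)
                + (eta D \<theta> * trace A) *\<^sub>R mat 1"

definition heat_flux :: "nsf \<Rightarrow> real \<Rightarrow> real^3 \<Rightarrow> real^3" where
  "heat_flux D \<theta> h = - kappa D \<theta> *\<^sub>R h"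

definition dissipation :: "nsf \<Rightarrow> real \<Rightarrow> real^3 \<Rightarrow> real^3^3 \<Rightarrow> real" where
  "dissipation D \<theta> h A = stress D \<theta> A \<bullet> sym_grad A - (heat_flux D \<theta> h \<bullet> h) / \<theta>"

definition outer :: "real^3 \<Rightarrow> real^3 \<Rightarrow> real^3^3" where
  "outer v w = (\<chi> i j. v$i * w$j)"

definition total_energy :: "nsf \<Rightarrow> real \<Rightarrow> real \<Rightarrow> real^3 \<Rightarrow> real" where
  "total_energy D \<rho> \<theta> v = 1/2 * \<rho> * (norm v)\<^sup>2 + rho_e D \<rho> \<theta>"

subsection \<open>Test functions\<close>

definition C1_map :: "('a::real_normed_vector \<Rightarrow> 'b::real_normed_vector) \<Rightarrow> bool" where
  "C1_map f \<longleftrightarrow> (\<exists>f' :: 'a \<Rightarrow> 'a \<Rightarrow>\<^sub>L 'b.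
     (\<forall>z. (f has_derivative blinfun_apply (f' z)) (at z)) \<and> continuous_on UNIV f')"

definition dt :: "(real \<times> (real^3) \<Rightarrow> 'b::real_normed_vector) \<Rightarrow> real \<Rightarrow> real^3 \<Rightarrow> 'b" where
  "dt f t x = frechet_derivative f (at (t, x)) (1, 0)"

definition grad :: "(real \<times> (real^3) \<Rightarrow> real) \<Rightarrow> real \<Rightarrow> real^3 \<Rightarrow> real^3" where
  "grad f t x = (\<chi> j. frechet_derivative f (at (t, x)) (0, axis j 1))"

definition jac :: "(real \<times> (real^3) \<Rightarrow> real^3) \<Rightarrow> real \<Rightarrow> real^3 \<Rightarrow> real^3^3" where
  "jac f t x = (\<chi> i j. frechet_derivative f (at (t, x)) (0, axis j 1) $ i)"

text \<open>
  Functions of class \<open>C\<^sup>1\<close> up to the boundary \<open>x$3 = 0\<close>, \<open>x$3 = 1\<close> are represented by \<open>C\<^sup>1\<close>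
  extensions to the whole space; only their values on the closed slab enter.
\<close>

definition C1_closed :: "(real \<times> (real^3) \<Rightarrow> 'b::real_normed_vector) set" where
  "C1_closed = {f. C1_map f \<and> (\<forall>t. periodic (\<lambda>x. f (t, x)))}"

definition C1c_closed :: "(real \<times> (real^3) \<Rightarrow> 'b::real_normed_vector) set" where
  "C1c_closed = {f \<in> C1_closed. \<exists>T. \<forall>t. \<forall>x\<in>closed_slab. \<bar>t\<bar> > T \<longrightarrow> f (t, x) = 0}"

definition C1c_open :: "(real \<times> (real^3) \<Rightarrow> 'b::real_normed_vector) set" where
  "C1c_open = {f \<in> C1_closed. \<exists>T. \<exists>\<delta>>0. \<forall>t x.
     f (t, x) \<noteq> 0 \<longrightarrow> \<bar>t\<bar> \<le> T \<and> \<delta> \<le> x$3 \<and> x$3 \<le> 1 - \<delta>}"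

subsection \<open>Space-time function spaces and entire weak solutions\<close>

abbreviation ST :: "(real \<times> (real^3)) measure" where
  "ST \<equiv> lebesgue_on (UNIV \<times> cell)"

definition st_integrable :: "(real \<Rightarrow> real^3 \<Rightarrow> real) \<Rightarrow> bool" where
  "st_integrable f \<longleftrightarrow> integrable ST (\<lambda>(t, x). f t x)"

definition st_int :: "(real \<Rightarrow> real^3 \<Rightarrow> real) \<Rightarrow> real" where
  "st_int f = (LINT z|ST. (case z of (t, x) \<Rightarrow> f t x))"

definition is_weak_grad :: "sfield \<Rightarrow> vfield \<Rightarrow> bool" where
  "is_weak_grad f h \<longleftrightarrow> (\<forall>j. (\<lambda>x. h x $ j) \<in> L2 \<and>
     weak_deriv (\<lambda>i. if i = j then 1 else 0) f (\<lambda>x. h x $ j))"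

text \<open>
  \<open>f\<close> is locally square integrable in time with values in the Sobolev space of order 1, with
  spatial gradient \<open>h\<close>.  The gradient is carried along as a jointly measurable function, because
  choosing one separately at every time need not give a measurable function.
\<close>

definition L2loc_W12 :: "(real \<Rightarrow> real^3 \<Rightarrow> real) \<Rightarrow> (real \<Rightarrow> real^3 \<Rightarrow> real^3) \<Rightarrow> bool" where
  "L2loc_W12 f h \<longleftrightarrow>
     (\<lambda>(t, x). f t x) \<in> borel_measurable ST \<and> (\<lambda>(t, x). h t x) \<in> borel_measurable ST \<and>
     (AE t in lebesgue. f t \<in> L2 \<and> is_weak_grad (f t) (h t)) \<and>
     (\<forall>T>0. integrable (lebesgue_on ({-T..T} \<times> cell)) (\<lambda>(t, x). (f t x)\<^sup>2 + (norm (h t x))\<^sup>2))"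

definition L2loc_W120 :: "(real \<Rightarrow> real^3 \<Rightarrow> real) \<Rightarrow> (real \<Rightarrow> real^3 \<Rightarrow> real^3) \<Rightarrow> bool" where
  "L2loc_W120 f h \<longleftrightarrow> L2loc_W12 f h \<and> (AE t in lebesgue. f t \<in> W20 1)"

definition Linfloc_Lp :: "real \<Rightarrow> (real \<Rightarrow> real^3 \<Rightarrow> real) \<Rightarrow> bool" where
  "Linfloc_Lp \<gamma> f \<longleftrightarrow> (\<lambda>(t, x). f t x) \<in> borel_measurable ST \<and>
     (\<forall>T>0. \<exists>C. AE t in lebesgue. \<bar>t\<bar> \<le> T \<longrightarrow>
        integrable (lebesgue_on cell) (\<lambda>x. \<bar>f t x\<bar> powr \<gamma>) \<and>
        (LINT x|lebesgue_on cell. \<bar>f t x\<bar> powr \<gamma>) \<le> C)"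

definition theta_B :: "nsf \<Rightarrow> real^3 \<Rightarrow> real" where
  "theta_B D x = Theta_B D + x$3 * (Theta_U D - Theta_B D)"

definition regularity ::
  "nsf \<Rightarrow> (real \<Rightarrow> real^3 \<Rightarrow> real) \<Rightarrow> (real \<Rightarrow> real^3 \<Rightarrow> real) \<Rightarrow> (real \<Rightarrow> real^3 \<Rightarrow> real^3) \<Rightarrow>
   (real \<Rightarrow> real^3 \<Rightarrow> real^3) \<Rightarrow> (real \<Rightarrow> real^3 \<Rightarrow> real^3^3) \<Rightarrow> bool" where
  "regularity D \<rho> \<theta> u h A \<longleftrightarrow>
     (AE (t, x) in ST. \<rho> t x \<ge> 0 \<and> \<theta> t x > 0) \<and>
     (\<exists>\<gamma>>1. Linfloc_Lp \<gamma> \<rho>) \<and>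
     (\<forall>i. L2loc_W120 (\<lambda>t x. u t x $ i) (\<lambda>t x. A t x $ i)) \<and>
     (\<exists>\<beta>\<ge>2. \<exists>h'. L2loc_W12 (\<lambda>t x. \<theta> t x powr (\<beta>/2)) h') \<and>
     (\<exists>h'. L2loc_W12 (\<lambda>t x. ln (\<theta> t x)) h') \<and>
     L2loc_W12 \<theta> h \<and>
     (\<exists>h'. L2loc_W120 (\<lambda>t x. \<theta> t x - theta_B D x) h')"

definition continuity_eq ::
  "(real \<Rightarrow> real^3 \<Rightarrow> real) \<Rightarrow> (real \<Rightarrow> real^3 \<Rightarrow> real^3) \<Rightarrow> (real \<Rightarrow> real^3 \<Rightarrow> real^3^3) \<Rightarrow> bool" where
  "continuity_eq \<rho> u A \<longleftrightarrow>
     (\<forall>f \<in> C1c_closed.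
        (let I = (\<lambda>t x. \<rho> t x * dt f t x + \<rho> t x * (u t x \<bullet> grad f t x))
         in st_integrable I \<and> st_int I = 0)) \<and>
     (\<forall>f \<in> C1c_closed. \<forall>b. C1_map b \<and> (\<exists>K. \<forall>z. \<bar>z\<bar> > K \<longrightarrow> deriv b z = 0) \<longrightarrow>
        (let I = (\<lambda>t x. b (\<rho> t x) * dt f t x + b (\<rho> t x) * (u t x \<bullet> grad f t x)
                     + (b (\<rho> t x) - deriv b (\<rho> t x) * \<rho> t x) * trace (A t x) * f (t, x))
         in st_integrable I \<and> st_int I = 0))"

definition momentum_eq ::
  "nsf \<Rightarrow> (real \<Rightarrow> real^3 \<Rightarrow> real) \<Rightarrow> (real \<Rightarrow> real^3 \<Rightarrow> real) \<Rightarrow> (real \<Rightarrow> real^3 \<Rightarrow> real^3) \<Rightarrow>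
   (real \<Rightarrow> real^3 \<Rightarrow> real^3^3) \<Rightarrow> bool" where
  "momentum_eq D \<rho> \<theta> u A \<longleftrightarrow>
     (\<forall>f \<in> C1c_open.
        (let I = (\<lambda>t x. \<rho> t x * (u t x \<bullet> dt f t x)
                     + \<rho> t x * (outer (u t x) (u t x) \<bullet> jac f t x)
                     + pressure D (\<rho> t x) (\<theta> t x) * trace (jac f t x));
             J = (\<lambda>t x. stress D (\<theta> t x) (A t x) \<bullet> jac f t x - \<rho> t x * (grad_G D \<bullet> f (t, x)))
         in st_integrable I \<and> st_integrable J \<and> st_int I = st_int J))"

definition entropy_ineq ::
  "nsf \<Rightarrow> (real \<Rightarrow> real^3 \<Rightarrow> real) \<Rightarrow> (real \<Rightarrow> real^3 \<Rightarrow> real) \<Rightarrow> (real \<Rightarrow> real^3 \<Rightarrow> real^3) \<Rightarrow>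
   (real \<Rightarrow> real^3 \<Rightarrow> real^3) \<Rightarrow> (real \<Rightarrow> real^3 \<Rightarrow> real^3^3) \<Rightarrow> bool" where
  "entropy_ineq D \<rho> \<theta> u h A \<longleftrightarrow>
     (\<forall>f \<in> C1c_open. (\<forall>z. f z \<ge> 0) \<longrightarrow>
        (let I = (\<lambda>t x. rho_s D (\<rho> t x) (\<theta> t x) * dt f t x
                     + rho_s D (\<rho> t x) (\<theta> t x) * (u t x \<bullet> grad f t x)
                     + ((1 / \<theta> t x) *\<^sub>R heat_flux D (\<theta> t x) (h t x)) \<bullet> grad f t x);
             J = (\<lambda>t x. f (t, x) / \<theta> t x * dissipation D (\<theta> t x) (h t x) (A t x))
         in st_integrable I \<and> st_integrable J \<and> - st_int I \<ge> st_int J))"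

definition ballistic_energy_ineq ::
  "nsf \<Rightarrow> (real \<Rightarrow> real^3 \<Rightarrow> real) \<Rightarrow> (real \<Rightarrow> real^3 \<Rightarrow> real) \<Rightarrow> (real \<Rightarrow> real^3 \<Rightarrow> real^3) \<Rightarrow>
   (real \<Rightarrow> real^3 \<Rightarrow> real^3) \<Rightarrow> (real \<Rightarrow> real^3 \<Rightarrow> real^3^3) \<Rightarrow> bool" where
  "ballistic_energy_ineq D \<rho> \<theta> u h A \<longleftrightarrow>
     (\<forall>\<psi> :: real \<Rightarrow> real. \<forall>\<Theta> \<in> C1_closed.
        C1_map \<psi> \<and> (\<exists>T. \<forall>t. \<bar>t\<bar> > T \<longrightarrow> \<psi> t = 0) \<and> (\<forall>t. \<psi> t \<ge> 0) \<and>
        (\<forall>t. \<forall>x\<in>closed_slab. \<Theta> (t, x) > 0) \<and>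
        (\<forall>t x. x$3 = 0 \<longrightarrow> \<Theta> (t, x) = Theta_B D) \<and>
        (\<forall>t x. x$3 = 1 \<longrightarrow> \<Theta> (t, x) = Theta_U D) \<longrightarrow>
        (let I = (\<lambda>t x. deriv \<psi> t *
                     (total_energy D (\<rho> t x) (\<theta> t x) (u t x) - \<Theta> (t, x) * rho_s D (\<rho> t x) (\<theta> t x)));
             J = (\<lambda>t x. \<psi> t * (\<Theta> (t, x) / \<theta> t x * dissipation D (\<theta> t x) (h t x) (A t x)));
             K = (\<lambda>t x. \<psi> t * (\<rho> t x * (u t x \<bullet> grad_G D)
                     - rho_s D (\<rho> t x) (\<theta> t x) * dt \<Theta> t x
                     - rho_s D (\<rho> t x) (\<theta> t x) * (u t x \<bullet> grad \<Theta> t x)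
                     - ((1 / \<theta> t x) *\<^sub>R heat_flux D (\<theta> t x) (h t x)) \<bullet> grad \<Theta> t x))
         in st_integrable I \<and> st_integrable J \<and> st_integrable K \<and>
            - st_int I + st_int J \<le> st_int K))"

text \<open>Here \<open>h\<close> and \<open>A\<close> are the weak gradients of the temperature and of the velocity.\<close>

definition entire_weak_solution ::
  "nsf \<Rightarrow> (real \<Rightarrow> real^3 \<Rightarrow> real) \<Rightarrow> (real \<Rightarrow> real^3 \<Rightarrow> real) \<Rightarrow> (real \<Rightarrow> real^3 \<Rightarrow> real^3) \<Rightarrow> bool"
  where
  "entire_weak_solution D \<rho> \<theta> u \<longleftrightarrow> (\<exists>h A.
     regularity D \<rho> \<theta> u h A \<and> continuity_eq \<rho> u A \<and> momentum_eq D \<rho> \<theta> u A \<and>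
     entropy_ineq D \<rho> \<theta> u h A \<and> ballistic_energy_ineq D \<rho> \<theta> u h A)"

section \<open>The set of entire solutions and stationary statistical solutions\<close>

text \<open>
  The conservative entropy variables of a weak solution as functions of time with values in the
  state space: the weakly continuous representatives of density and momentum, and the left limits of
  the total entropy.
\<close>

definition conservative_entropy_vars ::
  "nsf \<Rightarrow> real \<Rightarrow> (real \<Rightarrow> real^3 \<Rightarrow> real) \<Rightarrow> (real \<Rightarrow> real^3 \<Rightarrow> real) \<Rightarrow> (real \<Rightarrow> real^3 \<Rightarrow> real^3) \<Rightarrow>
   trajectory \<Rightarrow> bool" where
  "conservative_entropy_vars D k \<rho> \<theta> u = (\<lambda>(R, S, m).
     (\<forall>t. R t \<in> Wneg k \<and> S t \<in> Wneg k \<and> m t \<in> Wnegv k) \<and>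
     (\<forall>f\<in>W20 k. continuous_on UNIV (\<lambda>t. R t f)) \<and>
     (AE t in lebesgue. \<forall>f\<in>W20 k. R t f = (LINT x|lebesgue_on cell. \<rho> t x * f x)) \<and>
     (\<forall>f\<in>W20v k. continuous_on UNIV (\<lambda>t. m t f)) \<and>
     (AE t in lebesgue. \<forall>f\<in>W20v k. m t f = (LINT x|lebesgue_on cell. \<rho> t x * (u t x \<bullet> f x))) \<and>
     (\<forall>\<tau>. \<forall>f\<in>W20 k. ((\<lambda>\<delta>. 1 / \<delta> *
        (LINT z|lebesgue_on ({\<tau> - \<delta>..\<tau>} \<times> cell).
           (case z of (t, x) \<Rightarrow> rho_s D (\<rho> t x) (\<theta> t x) * f x))) \<longlongrightarrow> S \<tau> f) (at_right 0)))"

definition entire_solution_set :: "nsf \<Rightarrow> real \<Rightarrow> real \<Rightarrow> trajectory set" where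
  "entire_solution_set D M k = {\<omega>. \<exists>\<rho> \<theta> u.
     entire_weak_solution D \<rho> \<theta> u \<and>
     (AE t in lebesgue. integrable (lebesgue_on cell) (\<rho> t) \<and>
        (LINT x|lebesgue_on cell. \<rho> t x) = M) \<and>
     (\<exists>C. AE t in lebesgue.
        integrable (lebesgue_on cell) (\<lambda>x. total_energy D (\<rho> t x) (\<theta> t x) (u t x)) \<and>
        \<bar>LINT x|lebesgue_on cell. total_energy D (\<rho> t x) (\<theta> t x) (u t x)\<bar> \<le> C) \<and>
     conservative_entropy_vars D k \<rho> \<theta> u \<omega>}"

definition stationary_statistical_solution ::
  "nsf \<Rightarrow> real \<Rightarrow> real \<Rightarrow> (nat \<Rightarrow> sfield) \<Rightarrow> (nat \<Rightarrow> vfield) \<Rightarrow>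
   (real \<Rightarrow> (real \<Rightarrow> real) \<Rightarrow> (real \<Rightarrow> real) \<Rightarrow> real) \<Rightarrow> trajectory measure \<Rightarrow> bool" where
  "stationary_statistical_solution D M k \<phi> \<psi> dM V \<longleftrightarrow>
     (\<exists>V0. prob_space V0 \<and>
        sets V0 = sets (borel_on (subtopology (traj_top k \<phi> \<psi> dM) (entire_solution_set D M k))) \<and>
        V = distr V0 (borel_on (traj_top k \<phi> \<psi> dM)) (\<lambda>\<omega>. \<omega>)) \<and>
     (\<forall>B \<in> sets (borel_on (traj_top k \<phi> \<psi> dM)). \<forall>T. emeasure V (shift T ` B) = emeasure V B)"

definition time_average :: "(state \<Rightarrow> real) \<Rightarrow> real \<Rightarrow> trajectory \<Rightarrow> real" where
  "time_average F T \<omega> = 1 / T * (LINT t:{0..T}|lborel. F (at_time \<omega> t))"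

end

(*
  The invariance of V under all shifts makes the time-1 shift a measure preserving map, and F along
  the canonical process is a stationary process; so the claim is the continuous-time Birkhoff theorem
  once that process is jointly measurable.  The discrete theorem is proved with conditional
  expectations on the invariant sigma-algebra; splitting F into its positive and negative part, the
  time averages over [0, T] are squeezed between Birkhoff sums, and Scheffe's lemma gives convergence
  in the mean.  Joint measurability comes from the coordinates against the orthonormal bases: they are
  left continuous in time, and the event that a coordinate exceeds a level somewhere in an open time
  interval is open in the trajectory space, also for the M1 topology.  The Borel sets of the state
  space are generated by the coordinates because functionals embed isometrically into l2; this needs
  that the Sobolev spaces are genuine semi-inner product spaces, hence uniqueness of weak derivatives
  and finiteness of the Slobodeckij seminorm on test functions.
*)
theory Submission
  imports Defs "HOL-Real_Asymp.Real_Asymp"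
begin

section \<open>The ergodic theorem\<close>

text \<open>Three obstacles shape what follows. The Borel sets of the trajectory space are
  accessible only through the inductive topology: openness is checked with sequences, and since the
  distance averages over window sizes, smallness of it gives closeness on a window only along a
  subsequence and for almost every size. Stationarity is an identity between the measures of
  \<open>B\<close> and of its shifted image, so that measurability of the shifts has to be extracted
  from it. Finally \<open>wderiv\<close> is a choice among weak derivatives, so that even additivity
  of the Sobolev inner product rests on their uniqueness almost everywhere. In the ergodic theorem,
  nonnegative functions are treated separately because all their time averages have the same finite
  mean, and this is what upgrades almost sure convergence to convergence in the mean. For the state
  space the decisive inequality is that the dual norm is at most the l2 norm of the coordinates: it
  makes norm-open sets open with respect to the coordinates.\<close>

locale measure_preserving_map = finite_measure M for M :: "'a measure" +
  fixes T :: "'a \<Rightarrow> 'a"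
  assumes T_measurable [measurable]: "T \<in> M \<rightarrow>\<^sub>M M"
    and distr_T: "distr M M T = M"
begin

text \<open>Invariance is exact rather than up to null sets. Functions measurable for this
  sigma-algebra are then constant along every single orbit, so that no exceptional sets accumulate
  when an orbit is followed. The generating family is already a sigma-algebra.\<close>

definition invariant_sets :: "'a measure" where
  "invariant_sets = sigma (space M) {A \<in> sets M. T -` A \<inter> space M = A}"

lemma sets_invariant_sets: "sets invariant_sets = {A \<in> sets M. T -` A \<inter> space M = A}"
proof -
  have "sigma_algebra (space M) {A \<in> sets M. T -` A \<inter> space M = A}"
    unfolding sigma_algebra_iff2
  proof (intro conjI ballI allI impI)
    show "{A \<in> sets M. T -` A \<inter> space M = A} \<subseteq> Pow (space M)"
      using sets.sets_into_space by auto
    show "{} \<in> {A \<in> sets M. T -` A \<inter> space M = A}" by auto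
    fix A assume A: "A \<in> {A \<in> sets M. T -` A \<inter> space M = A}"
    have "T -` (space M - A) \<inter> space M = space M - (T -` A \<inter> space M)"
      using measurable_space[OF T_measurable] by auto
    then show "space M - A \<in> {A \<in> sets M. T -` A \<inter> space M = A}"
      using A by auto
  next
    fix A :: "nat \<Rightarrow> 'a set" assume A: "range A \<subseteq> {A \<in> sets M. T -` A \<inter> space M = A}"
    then have "T -` (A i) \<inter> space M = A i" for i by auto
    then have "T -` (\<Union>i. A i) \<inter> space M = (\<Union>i. A i)" by auto
    moreover have "(\<Union>i. A i) \<in> sets M" using A by (intro sets.countable_UN) auto
    ultimately show "(\<Union>i. A i) \<in> {A \<in> sets M. T -` A \<inter> space M = A}" by simp
  qed
  then show ?thesis
    by (simp add: invariant_sets_def sigma_algebra.sigma_sets_eq sets_measure_of_conv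
      sigma_algebra_iff2)
qed

lemma space_invariant_sets: "space invariant_sets = space M"
  by (simp add: invariant_sets_def space_measure_of_conv)

sublocale finite_measure_subalgebra M invariant_sets
  by unfold_locales (auto simp: subalgebra_def space_invariant_sets sets_invariant_sets)

text \<open>The fibre of \<open>g\<close> through \<open>x\<close> is an invariant set containing
  \<open>x\<close>, so it contains \<open>T x\<close> as well.\<close>

lemma invariant_measurable_T:
  fixes g :: "'a \<Rightarrow> real"
  assumes "g \<in> borel_measurable invariant_sets" "x \<in> space M"
  shows "g (T x) = g x"
proof -
  have "g -` {g x} \<inter> space M \<in> sets invariant_sets"
    using measurable_sets[OF assms(1), of "{g x}"] by (simp add: space_invariant_sets)
  then have "T -` (g -` {g x} \<inter> space M) \<inter> space M = g -` {g x} \<inter> space M"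
    by (simp add: sets_invariant_sets)
  with assms(2) show ?thesis by auto
qed

lemma integral_comp_T:
  fixes f :: "'a \<Rightarrow> real"
  assumes "integrable M f"
  shows "integrable M (\<lambda>x. f (T x))" "(\<integral>x. f (T x) \<partial>M) = (\<integral>x. f x \<partial>M)"
proof -
  show "integrable M (\<lambda>x. f (T x))"
    by (rule integrable_distr[OF T_measurable]) (simp add: distr_T assms)
  show "(\<integral>x. f (T x) \<partial>M) = (\<integral>x. f x \<partial>M)"
    using integral_distr[OF T_measurable, of f] assms by (simp add: distr_T)
qed

section \<open>Birkhoff sums along an orbit and the maximal inequality\<close>

definition birkhoff_sum :: "('a \<Rightarrow> real) \<Rightarrow> nat \<Rightarrow> 'a \<Rightarrow> real" where
  "birkhoff_sum f n x = (\<Sum>i<n. f ((T ^^ i) x))"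

lemma birkhoff_sum_Suc: "birkhoff_sum f (Suc n) x = f x + birkhoff_sum f n (T x)"
  unfolding birkhoff_sum_def by (subst sum.lessThan_Suc_shift) (simp add: funpow_swap1)

lemma T_pow_measurable [measurable]: "T ^^ n \<in> M \<rightarrow>\<^sub>M M"
  by (induction n) auto

lemma birkhoff_sum_measurable [measurable]:
  assumes [measurable]: "f \<in> borel_measurable M"
  shows "birkhoff_sum f n \<in> borel_measurable M"
  unfolding birkhoff_sum_def[abs_def] by measurable

text \<open>This is the maximum of \<open>birkhoff_sum f m\<close> over \<open>m\<close> from 1 to
  \<open>n + 1\<close>. The recursion splits off the first summand \<open>f x\<close> and yields the
  identity behind the maximal inequality:
  \<open>birkhoff_max f (Suc n) x - birkhoff_max f n (T x)\<close> equals
  \<open>f x + max (- birkhoff_max f n (T x)) 0\<close>.\<close>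

primrec birkhoff_max :: "('a \<Rightarrow> real) \<Rightarrow> nat \<Rightarrow> 'a \<Rightarrow> real" where
  "birkhoff_max f 0 = f"
| "birkhoff_max f (Suc n) = (\<lambda>x. f x + max 0 (birkhoff_max f n (T x)))"

lemma birkhoff_max_Suc_ge: "birkhoff_max f n x \<le> birkhoff_max f (Suc n) x"
proof (induction n arbitrary: x)
  case (Suc n)
  from Suc[of "T x"] show ?case by simp
qed simp

lemma birkhoff_max_mono: "m \<le> n \<Longrightarrow> birkhoff_max f m x \<le> birkhoff_max f n x"
  by (rule lift_Suc_mono_le[of "\<lambda>n. birkhoff_max f n x"]) (rule birkhoff_max_Suc_ge)

lemma birkhoff_sum_le_max: "birkhoff_sum f (Suc n) x \<le> birkhoff_max f n x"
proof (induction n arbitrary: x)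
  case 0 then show ?case by (simp add: birkhoff_sum_def)
next
  case (Suc n)
  have "birkhoff_sum f (Suc (Suc n)) x = f x + birkhoff_sum f (Suc n) (T x)"
    by (rule birkhoff_sum_Suc)
  also have "\<dots> \<le> birkhoff_max f (Suc n) x" using Suc[of "T x"] by simp
  finally show ?case .
qed

lemma birkhoff_max_integrable:
  assumes "integrable M f"
  shows "integrable M (birkhoff_max f n)"
proof (induction n)
  case (Suc n)
  then show ?case using assms integral_comp_T(1)[OF Suc] by simp
qed (use assms in simp)

text \<open>
  The integral of \<open>birkhoff_max f (Suc n) - birkhoff_max f n \<circ> T\<close> over the invariant set where the sums
  are unbounded is nonnegative and tends to the integral of \<open>f\<close> over that set, which is negative unless
  the set is null.
\<close>

lemma birkhoff_sum_bounded_above: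
  assumes f [measurable]: "integrable M f"
    and neg: "AE x in M. real_cond_exp M invariant_sets f x < 0"
  shows "AE x in M. \<exists>C. \<forall>n. birkhoff_sum f n x \<le> C"
proof -
  define A where "A = {x \<in> space M. \<forall>c::nat. \<exists>n. birkhoff_sum f n x > real c}"
  have [measurable]: "A \<in> sets M" unfolding A_def by measurable
  have bdd: "(\<exists>c::nat. \<forall>n. birkhoff_sum f n x \<le> real c) \<longleftrightarrow> (\<exists>C. \<forall>n. birkhoff_sum f n x \<le> C)" for x
    by (meson dual_order.trans real_arch_simple)
  have bdd_T: "(\<exists>C. \<forall>n. birkhoff_sum f n (T x) \<le> C) \<longleftrightarrow> (\<exists>C. \<forall>n. birkhoff_sum f n x \<le> C)" for x
  proof (intro iffI; elim exE)
    fix C assume C: "\<forall>n. birkhoff_sum f n (T x) \<le> C"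
    \<comment> \<open>The 0 accounts for the empty sum.\<close>
    have "birkhoff_sum f n x \<le> max 0 (f x + C)" for n
    proof (cases n)
      case 0 then show ?thesis by (simp add: birkhoff_sum_def)
    next
      case (Suc m)
      then show ?thesis using C by (auto simp: birkhoff_sum_Suc intro: max.coboundedI2)
    qed
    then show "\<exists>C. \<forall>n. birkhoff_sum f n x \<le> C" by blast
  next
    fix C assume C: "\<forall>n. birkhoff_sum f n x \<le> C"
    have "birkhoff_sum f n (T x) \<le> C - f x" for n
      using C[rule_format, of "Suc n"] by (simp add: birkhoff_sum_Suc)
    then show "\<exists>C. \<forall>n. birkhoff_sum f n (T x) \<le> C" by blast
  qed
  have A_iff: "x \<in> A \<longleftrightarrow> x \<in> space M \<and> \<not> (\<exists>C. \<forall>n. birkhoff_sum f n x \<le> C)" for x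
    unfolding A_def bdd[symmetric] by (auto simp: not_le)
  have inv: "T x \<in> A \<longleftrightarrow> x \<in> A" if "x \<in> space M" for x
    unfolding A_iff bdd_T using that measurable_space[OF T_measurable that] by simp
  have AI: "A \<in> sets invariant_sets"
    unfolding sets_invariant_sets using inv sets.sets_into_space[OF \<open>A \<in> sets M\<close>] by auto
  define h where "h n x = max (- birkhoff_max f n (T x)) 0" for n x
  have int_max [measurable]: "integrable M (birkhoff_max f n)" for n by (rule birkhoff_max_integrable[OF f])
  have h_int: "integrable M (h n)" for n
    unfolding h_def[abs_def] using integral_comp_T(1)[OF int_max[of n]] by auto
  have step: "(\<integral>x. indicator A x * (f x + h n x) \<partial>M) \<ge> 0" for n
  proof -
    have i1: "integrable M (\<lambda>x. indicator A x * g x)" if "integrable M g" for g :: "'a \<Rightarrow> real"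
      using integrable_mult_indicator[OF \<open>A \<in> sets M\<close> that] by simp
    have "0 \<le> (\<integral>x. indicator A x * (birkhoff_max f (Suc n) x - birkhoff_max f n x) \<partial>M)"
      by (rule integral_nonneg_AE) (use birkhoff_max_Suc_ge in \<open>auto simp del: birkhoff_max.simps\<close>)
    also have "\<dots> = (\<integral>x. indicator A x * birkhoff_max f (Suc n) x \<partial>M) - (\<integral>x. indicator A x * birkhoff_max f n x \<partial>M)"
      unfolding right_diff_distrib
      by (rule Bochner_Integration.integral_diff; intro i1 birkhoff_max_integrable f)
    \<comment> \<open>Preservation of the measure replaces the integrand by its composition with
      \<open>T\<close>; invariance of \<open>A\<close> then removes \<open>T\<close> from the
      indicator.\<close>
    also have "(\<integral>x. indicator A x * birkhoff_max f n x \<partial>M) = (\<integral>x. indicator A (T x) * birkhoff_max f n (T x) \<partial>M)"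
      by (rule integral_comp_T(2)[symmetric]) (intro i1 int_max)
    also have "\<dots> = (\<integral>x. indicator A x * birkhoff_max f n (T x) \<partial>M)"
      by (rule Bochner_Integration.integral_cong) (auto simp: inv indicator_def)
    also have "(\<integral>x. indicator A x * birkhoff_max f (Suc n) x \<partial>M) - \<dots> =
        (\<integral>x. indicator A x * birkhoff_max f (Suc n) x - indicator A x * birkhoff_max f n (T x) \<partial>M)"
      by (rule Bochner_Integration.integral_diff[symmetric])
        (intro i1 birkhoff_max_integrable f integral_comp_T(1))+
    also have "\<dots> = (\<integral>x. indicator A x * (f x + h n x) \<partial>M)"
      by (rule Bochner_Integration.integral_cong) (auto simp: h_def indicator_def max_def)
    finally show ?thesis .
  qed
  \<comment> \<open>On \<open>A\<close> some Birkhoff sum at \<open>T x\<close> is positive, so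
    \<open>h n x\<close> is eventually 0. The domination comes from
    \<open>birkhoff_max f n \<ge> f\<close>, which bounds \<open>h n x\<close> by the modulus of
    \<open>f (T x)\<close>.\<close>
  have lim: "(\<lambda>n. \<integral>x. indicator A x * (f x + h n x) \<partial>M) \<longlonglongrightarrow> (\<integral>x. indicator A x * (f x + 0) \<partial>M)"
  proof (rule integral_dominated_convergence[where w = "\<lambda>x. \<bar>f x\<bar> + \<bar>f (T x)\<bar>"])
    show "(\<lambda>x. indicator A x * (f x + 0)) \<in> borel_measurable M" by measurable
    show "(\<lambda>x. indicator A x * (f x + h n x)) \<in> borel_measurable M" for n
      using borel_measurable_integrable[OF h_int[of n]] by measurable
    show "integrable M (\<lambda>x. \<bar>f x\<bar> + \<bar>f (T x)\<bar>)" using f integral_comp_T(1)[OF f] by auto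
    show "AE x in M. norm (indicator A x * (f x + h n x)) \<le> \<bar>f x\<bar> + \<bar>f (T x)\<bar>" for n
    proof (rule AE_I2)
      fix x
      have "f (T x) \<le> birkhoff_max f n (T x)" using birkhoff_max_mono[of 0 n f "T x"] by simp
      then show "norm (indicator A x * (f x + h n x)) \<le> \<bar>f x\<bar> + \<bar>f (T x)\<bar>"
        by (auto simp: h_def indicator_def)
    qed
    show "AE x in M. (\<lambda>n. indicator A x * (f x + h n x)) \<longlonglongrightarrow> indicator A x * (f x + 0)"
    proof (rule AE_I2)
      fix x assume x: "x \<in> space M"
      show "(\<lambda>n. indicator A x * (f x + h n x)) \<longlonglongrightarrow> indicator A x * (f x + 0)"
      proof (cases "x \<in> A")
        case True
        then have "T x \<in> A" using inv x by simp
        then obtain n where n: "birkhoff_sum f n (T x) > real 0" unfolding A_def by blast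
        then obtain m where m: "n = Suc m" by (cases n) (auto simp: birkhoff_sum_def)
        have "h k x = 0" if "k \<ge> m" for k
          using n birkhoff_sum_le_max[of f m "T x"] birkhoff_max_mono[OF that, of f "T x"]
          unfolding m h_def by simp
        then have "eventually (\<lambda>k. h k x = 0) sequentially"
          by (rule eventually_sequentiallyI)
        then have "(\<lambda>n. h n x) \<longlonglongrightarrow> 0" by (simp add: tendsto_eventually)
        then show ?thesis by (intro tendsto_intros)
      qed simp
    qed
  qed
  have "0 \<le> (\<integral>x. indicator A x * f x \<partial>M)"
    using LIMSEQ_le_const[OF lim] step by auto
  \<comment> \<open>As \<open>A\<close> is an invariant set, \<open>f\<close> may be exchanged for
    its conditional expectation, whose sign is known.\<close>
  also have "\<dots> = (\<integral>x. indicator A x * real_cond_exp M invariant_sets f x \<partial>M)"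
    using real_cond_exp_intA[OF f AI] by (simp add: set_lebesgue_integral_def)
  finally have ge: "0 \<le> (\<integral>x. indicator A x * real_cond_exp M invariant_sets f x \<partial>M)" .
  have ci: "integrable M (\<lambda>x. - (indicator A x * real_cond_exp M invariant_sets f x))"
    using integrable_mult_indicator[OF \<open>A \<in> sets M\<close> real_cond_exp_int(1)[OF f]] by simp
  have nn: "AE x in M. 0 \<le> - (indicator A x * real_cond_exp M invariant_sets f x)"
    using neg by eventually_elim (auto simp: indicator_def)
  have "(\<integral>x. - (indicator A x * real_cond_exp M invariant_sets f x) \<partial>M) = 0"
    using integral_nonneg_AE[OF nn] ge by simp
  then have "AE x in M. - (indicator A x * real_cond_exp M invariant_sets f x) = 0"
    using integral_nonneg_eq_0_iff_AE[OF ci nn] by simp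
  with neg have "AE x in M. x \<notin> A"
    by eventually_elim (auto simp: indicator_def)
  then show ?thesis
    using AE_space
  proof eventually_elim
    case (elim x)
    then show ?case using A_iff[of x] by blast
  qed
qed

text \<open>Let \<open>E\<close> be the conditional expectation of \<open>f\<close>. For
  \<open>c > 0\<close> the function \<open>f - (E + c)\<close> has conditional expectation
  \<open>- c\<close>, so its Birkhoff sums are bounded above. As \<open>E\<close> is constant along
  orbits, these sums are \<open>birkhoff_sum f n x - n * (E x + c)\<close>; division by
  \<open>n\<close> makes the bound vanish in the limit.\<close>

lemma birkhoff_average_upper:
  assumes f [measurable]: "integrable M f"
  shows "AE x in M. \<forall>e>0. eventually (\<lambda>n. birkhoff_sum f n x / n < real_cond_exp M invariant_sets f x + e) sequentially"
proof -
  let ?E = "real_cond_exp M invariant_sets f"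
  have *: "AE x in M. \<exists>C. \<forall>n. birkhoff_sum (\<lambda>x. f x - (?E x + c)) n x \<le> C" if "c > 0" for c
  proof (rule birkhoff_sum_bounded_above)
    have i: "integrable M (\<lambda>x. ?E x + c)" using real_cond_exp_int(1)[OF f] by simp
    show "integrable M (\<lambda>x. f x - (?E x + c))" using f i by simp
    have 1: "AE x in M. real_cond_exp M invariant_sets (\<lambda>x. f x - (?E x + c)) x
        = ?E x - real_cond_exp M invariant_sets (\<lambda>x. ?E x + c) x"
      by (rule real_cond_exp_diff[OF f i])
    have 2: "AE x in M. real_cond_exp M invariant_sets (\<lambda>x. ?E x + c) x = ?E x + c"
      by (rule real_cond_exp_F_meas[OF i]) simp
    show "AE x in M. real_cond_exp M invariant_sets (\<lambda>x. f x - (?E x + c)) x < 0"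
      using 1 2 by eventually_elim (use that in simp)
  qed
  \<comment> \<open>Countably many slacks, so that one null set serves every
    \<open>e\<close>.\<close>
  have "AE x in M. \<forall>k::nat. \<exists>C. \<forall>n. birkhoff_sum (\<lambda>x. f x - (?E x + 1 / Suc k)) n x \<le> C"
    unfolding AE_all_countable by (auto intro!: *)
  then show ?thesis using AE_space
  proof eventually_elim
    case (elim x)
    have Tn: "?E ((T ^^ n) x) = ?E x \<and> (T ^^ n) x \<in> space M" for n
      by (induction n)
        (use elim(2) invariant_measurable_T[of ?E] measurable_space[OF T_measurable] in auto)
    show ?case
    proof (intro allI impI)
      fix e :: real assume "e > 0"
      obtain k :: nat where k: "inverse (real (Suc k)) < e / 2"
        using reals_Archimedean[of "e/2"] \<open>e > 0\<close> by auto
      obtain C where C: "\<forall>n. birkhoff_sum (\<lambda>x. f x - (?E x + 1 / Suc k)) n x \<le> C"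
        using elim(1) by blast
      have eq: "birkhoff_sum (\<lambda>x. f x - (?E x + 1 / Suc k)) n x = birkhoff_sum f n x - n * (?E x + 1 / Suc k)" for n
        unfolding birkhoff_sum_def using Tn by (simp add: sum_subtractf)
      have "(\<lambda>n. C / real n) \<longlonglongrightarrow> 0" by (rule lim_const_over_n)
      then have "eventually (\<lambda>n. C / real n < e / 2) sequentially"
        using \<open>e > 0\<close> by (intro order_tendstoD(2)) auto
      then show "eventually (\<lambda>n. birkhoff_sum f n x / n < ?E x + e) sequentially"
        using eventually_gt_at_top[of 0]
      proof eventually_elim
        case (elim n)
        have "birkhoff_sum f n x \<le> C + n * (?E x + 1 / Suc k)" using C[rule_format, of n] eq[of n] by linarith
        then have "birkhoff_sum f n x / n \<le> C / n + (?E x + 1 / Suc k)"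
          using divide_right_mono[of "birkhoff_sum f n x" "C + n * (?E x + 1 / Suc k)" "real n"] elim(2)
          by (simp add: add_divide_distrib)
        with elim(1) k show ?case unfolding inverse_eq_divide by linarith
      qed
    qed
  qed
qed

text \<open>The one-sided bound is applied to \<open>f\<close> and to \<open>- f\<close>, whose
  conditional expectations differ by the sign.\<close>

theorem birkhoff_AE:
  assumes f [measurable]: "integrable M f"
  shows "AE x in M. (\<lambda>n. birkhoff_sum f n x / n) \<longlonglongrightarrow> real_cond_exp M invariant_sets f x"
proof -
  let ?E = "real_cond_exp M invariant_sets f"
  have neg: "AE x in M. real_cond_exp M invariant_sets (\<lambda>x. - f x) x = - ?E x"
    using real_cond_exp_cmult[OF f, of "-1"] by simp
  have m: "integrable M (\<lambda>x. - f x)" using f by simp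
  show ?thesis
    using birkhoff_average_upper[OF f] birkhoff_average_upper[OF m] neg
  proof eventually_elim
    case (elim x)
    have s: "birkhoff_sum (\<lambda>x. - f x) n x = - birkhoff_sum f n x" for n
      by (simp add: birkhoff_sum_def sum_negf)
    show ?case
    proof (rule order_tendstoI)
      fix a assume "a < ?E x"
      then have "\<forall>\<^sub>F n in sequentially. birkhoff_sum (\<lambda>x. - f x) n x / n < - ?E x + (?E x - a)"
        using elim(2)[rule_format, of "?E x - a"] elim(3) by simp
      then show "\<forall>\<^sub>F n in sequentially. a < birkhoff_sum f n x / n"
        by eventually_elim (simp add: s)
    next
      fix a assume "?E x < a"
      then show "\<forall>\<^sub>F n in sequentially. birkhoff_sum f n x / n < a"
        using elim(1)[rule_format, of "a - ?E x"] by simp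
    qed
  qed
qed

text \<open>Nonnegativity makes the integral over \<open>{0..T}\<close> increasing in
  \<open>T\<close>, so its values at integers control those in between; at integers it is a Birkhoff
  sum of the integral over the unit interval, by the cocycle identity. Stationarity and Tonelli give
  every average the mean \<open>c\<close>, and conditional expectation preserves this mean, so the
  norms of the averages converge to the norm of the limit.\<close>

theorem ergodic_flow_nonneg:
  fixes G :: "'a \<Rightarrow> real \<Rightarrow> real"
  assumes G_meas [measurable]: "(\<lambda>(x, t). G x t) \<in> borel_measurable (M \<Otimes>\<^sub>M lborel)"
    and nonneg: "\<And>x t. G x t \<ge> 0"
    and cocycle: "\<And>x t. x \<in> space M \<Longrightarrow> G x (t + 1) = G (T x) t"
    and stationary: "\<And>t. (\<integral>\<^sup>+x. ennreal (G x t) \<partial>M) = c" and fin: "c < \<infinity>"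
  shows "AE x in M. \<forall>T>0. set_integrable lborel {0..T} (G x)"
    and "\<exists>g\<in>borel_measurable M.
       (AE x in M. ((\<lambda>T. 1 / T * (LINT t:{0..T}|lborel. G x t)) \<longlongrightarrow> g x) at_top) \<and>
       integrable M g \<and>
       (\<forall>T>0. integrable M (\<lambda>x. 1 / T * (LINT t:{0..T}|lborel. G x t))) \<and>
       ((\<lambda>T. \<integral>x. \<bar>1 / T * (LINT t:{0..T}|lborel. G x t) - g x\<bar> \<partial>M) \<longlongrightarrow> 0) at_top"
proof -
  interpret L: pair_sigma_finite M lborel ..
  have Gx [measurable]: "G x \<in> borel_measurable borel" if "x \<in> space M" for x
    using measurable_compose[OF measurable_Pair1'[OF that] G_meas] by simp
  have Gt [measurable]: "(\<lambda>x. G x t) \<in> borel_measurable M" for t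
    using measurable_compose[OF measurable_Pair2'[of t lborel M] G_meas] by simp
  have nn: "(\<integral>\<^sup>+x. (\<integral>\<^sup>+t. ennreal (indicator I t * G x t) \<partial>lborel) \<partial>M) = c * emeasure lborel I"
    if [measurable]: "I \<in> sets borel" for I :: "real set"
  proof -
    have "(\<integral>\<^sup>+x. (\<integral>\<^sup>+t. ennreal (indicator I t * G x t) \<partial>lborel) \<partial>M)
        = (\<integral>\<^sup>+t. (\<integral>\<^sup>+x. ennreal (indicator I t * G x t) \<partial>M) \<partial>lborel)"
      by (rule L.Fubini'[symmetric]) measurable
    also have "\<dots> = (\<integral>\<^sup>+t. c * indicator I t \<partial>lborel)"
      by (rule nn_integral_cong) (auto simp: indicator_def stationary)
    also have "\<dots> = c * emeasure lborel I" by (simp add: nn_integral_cmult)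
    finally show ?thesis .
  qed
  have int_pair: "integrable (M \<Otimes>\<^sub>M lborel) (\<lambda>(x, t). indicator I t * G x t)"
    if [measurable]: "I \<in> sets borel" and I: "emeasure lborel I < \<infinity>" for I :: "real set"
  proof (rule integrableI_nonneg)
    show "(\<lambda>(x, t). indicator I t * G x t) \<in> borel_measurable (M \<Otimes>\<^sub>M lborel)" by measurable
    show "AE z in M \<Otimes>\<^sub>M lborel. 0 \<le> (case z of (x, t) \<Rightarrow> indicator I t * G x t)"
      by (auto simp: nonneg)
    have "(\<integral>\<^sup>+z. ennreal (case z of (x, t) \<Rightarrow> indicator I t * G x t) \<partial>(M \<Otimes>\<^sub>M lborel))
        = (\<integral>\<^sup>+x. (\<integral>\<^sup>+t. ennreal (indicator I t * G x t) \<partial>lborel) \<partial>M)"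
      using lborel.nn_integral_fst[of "\<lambda>z. ennreal (case z of (x, t) \<Rightarrow> indicator I t * G x t)" M] by simp
    also have "\<dots> < \<infinity>" unfolding nn[OF that(1)] using fin I by (simp add: ennreal_mult_less_top)
    finally show "(\<integral>\<^sup>+z. ennreal (case z of (x, t) \<Rightarrow> indicator I t * G x t) \<partial>(M \<Otimes>\<^sub>M lborel)) < \<infinity>" .
  qed
  define H where "H I x = (LINT t:I|lborel. G x t)" for I x
  have AE_int: "AE x in M. set_integrable lborel I (G x)"
    if "I \<in> sets borel" "emeasure lborel I < \<infinity>" for I :: "real set"
    using L.AE_integrable_fst'[OF int_pair[OF that]] by (simp add: set_integrable_def)
  have H_int [measurable]: "integrable M (H I)"
    if "I \<in> sets borel" "emeasure lborel I < \<infinity>" for I :: "real set"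
    using L.integrable_fst'[OF int_pair[OF that]] by (simp add: H_def[abs_def] set_lebesgue_integral_def)
  have H_integral: "(\<integral>x. H I x \<partial>M) = enn2real c * measure lborel I"
    if I [measurable]: "I \<in> sets borel" "emeasure lborel I < \<infinity>" for I :: "real set"
  proof -
    have "(\<integral>x. H I x \<partial>M) = (\<integral>z. (case z of (x, t) \<Rightarrow> indicator I t * G x t) \<partial>(M \<Otimes>\<^sub>M lborel))"
      using L.integral_fst'[OF int_pair[OF that]] by (simp add: H_def set_lebesgue_integral_def)
    also have "\<dots> = enn2real (\<integral>\<^sup>+z. ennreal (case z of (x, t) \<Rightarrow> indicator I t * G x t) \<partial>(M \<Otimes>\<^sub>M lborel))"
      by (rule integral_eq_nn_integral) (use nonneg in auto)
    also have "\<dots> = enn2real (\<integral>\<^sup>+x. (\<integral>\<^sup>+t. ennreal (indicator I t * G x t) \<partial>lborel) \<partial>M)"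
      using lborel.nn_integral_fst[of "\<lambda>z. ennreal (case z of (x, t) \<Rightarrow> indicator I t * G x t)" M] by simp
    also have "\<dots> = enn2real c * measure lborel I"
      unfolding nn[OF I(1)] by (simp add: enn2real_mult measure_def)
    finally show ?thesis .
  qed
  have loc: "AE x in M. \<forall>n::nat. set_integrable lborel {0..real n} (G x)"
    unfolding AE_all_countable by (intro allI AE_int) auto
  show "AE x in M. \<forall>T>0. set_integrable lborel {0..T} (G x)"
    using loc
  proof eventually_elim
    case (elim x)
    show ?case
    proof (intro allI impI)
      fix T :: real
      obtain n :: nat where "T \<le> n" using real_arch_simple by blast
      then show "set_integrable lborel {0..T} (G x)"
        by (intro set_integrable_subset[OF elim[rule_format, of n]]) auto
    qed
  qed
  define f where "f = H {0..1}"
  have f: "integrable M f" unfolding f_def by (rule H_int) auto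
  define g where "g = real_cond_exp M invariant_sets f"
  have g: "integrable M g" unfolding g_def by (rule real_cond_exp_int(1)[OF f])
  have Tn: "(T ^^ n) x \<in> space M" if "x \<in> space M" for n x
    by (rule measurable_space[OF T_pow_measurable that])
  have cocycle_n: "G x (t + real n) = G ((T ^^ n) x) t" if "x \<in> space M" for n x t
  proof (induction n arbitrary: t)
    case (Suc n)
    have "G x (t + real (Suc n)) = G x ((t + 1) + real n)" by (simp add: algebra_simps)
    then show ?case using Suc[of "t + 1"] cocycle[OF Tn[OF that]] by simp
  qed simp
  have sum_eq: "H {0..real n} x = birkhoff_sum f n x"
    if x: "x \<in> space M" and i: "\<forall>n::nat. set_integrable lborel {0..real n} (G x)" for x n
  proof (induction n)
    case 0
    have "AE t in lborel. indicator {0..0} t *\<^sub>R G x t = 0"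
      using AE_lborel_singleton[of 0] by eventually_elim simp
    then have "H {0..0} x = 0"
      unfolding H_def set_lebesgue_integral_def by (rule integral_eq_zero_AE)
    then show ?case by (simp add: birkhoff_sum_def)
  next
    case (Suc n)
    \<comment> \<open>The half-open piece keeps the union disjoint.\<close>
    have un: "{0..real (Suc n)} = {0..real n} \<union> {real n<..real (Suc n)}" by auto
    have i1: "set_integrable lborel {0..real n} (G x)" using i by auto
    have i2: "set_integrable lborel {real n<..real (Suc n)} (G x)"
      by (rule set_integrable_subset[OF i[rule_format, of "Suc n"]]) auto
    have "H {0..real (Suc n)} x = H {0..real n} x + (LINT t:{real n<..real (Suc n)}|lborel. G x t)"
      unfolding H_def un by (rule set_integral_Un[OF _ i1 i2]) auto
    also have "(LINT t:{real n<..real (Suc n)}|lborel. G x t) =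
        (\<integral>t. indicator {real n<..real (Suc n)} (real n + 1 * t) *\<^sub>R G x (real n + 1 * t) \<partial>lborel)"
      unfolding set_lebesgue_integral_def
      using lborel_integral_real_affine[of 1 "\<lambda>t. indicator {real n<..real (Suc n)} t *\<^sub>R G x t" "real n"]
      by simp
    also have "\<dots> = (\<integral>t. indicator {0..1} t *\<^sub>R G ((T ^^ n) x) t \<partial>lborel)"
    proof (rule integral_cong_AE)
      \<comment> \<open>The two indicators differ only at \<open>t = 0\<close>.\<close>
      show "AE t in lborel. indicator {real n<..real (Suc n)} (real n + 1 * t) *\<^sub>R G x (real n + 1 * t)
           = indicator {0..1} t *\<^sub>R G ((T ^^ n) x) t"
        using AE_lborel_singleton[of 0]
      proof eventually_elim
        case (elim t)
        have "G x (real n + 1 * t) = G ((T ^^ n) x) t"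
          using cocycle_n[OF x, of t n] by (simp only: add.commute mult_1)
        then show ?case using elim by (auto simp: indicator_def)
      qed
      have "G x \<in> borel_measurable borel" "G ((T ^^ n) x) \<in> borel_measurable borel"
        using Gx x Tn[OF x] by auto
      then show "(\<lambda>t. indicator {real n<..real (Suc n)} (real n + 1 * t) *\<^sub>R G x (real n + 1 * t)) \<in> borel_measurable lborel"
        "(\<lambda>t. indicator {0..1} t *\<^sub>R G ((T ^^ n) x) t) \<in> borel_measurable lborel"
        by measurable
    qed
    also have "\<dots> = f ((T ^^ n) x)" by (simp add: f_def H_def set_lebesgue_integral_def)
    finally show ?case using Suc by (simp add: birkhoff_sum_def)
  qed
  have H_mono: "H {0..a} x \<le> H {0..b} x"
    if x: "x \<in> space M" and i: "\<forall>n::nat. set_integrable lborel {0..real n} (G x)" and ab: "a \<le> b" for x a b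
  proof -
    obtain n :: nat where n: "b \<le> n" using real_arch_simple by blast
    have "set_integrable lborel {0..a} (G x)" "set_integrable lborel {0..b} (G x)"
      using set_integrable_subset[OF i[rule_format, of n]] n ab by auto
    then show ?thesis
      unfolding H_def set_lebesgue_integral_def set_integrable_def
      by (rule integral_mono) (use ab nonneg in \<open>auto simp: indicator_def\<close>)
  qed
  have lim: "AE x in M. ((\<lambda>T. 1 / T * H {0..T} x) \<longlongrightarrow> g x) at_top"
    using birkhoff_AE[OF f] loc AE_space
  proof eventually_elim
    case (elim x)
    define a where "a n = birkhoff_sum f n x / real n" for n
    \<comment> \<open>For \<open>n = 0\<close> both sides vanish, the sum being empty. The factors
      on the left tend to \<open>g x\<close> and to 1 when \<open>n\<close> is the integer part of
      \<open>T\<close> or its successor.\<close>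
    have a_mult: "a n * (real n / T) = birkhoff_sum f n x / T" for n T
      by (cases "n = 0") (auto simp: a_def birkhoff_sum_def)
    have a: "a \<longlonglongrightarrow> g x" using elim(1) by (simp add: a_def[abs_def] g_def)
    have fl: "filterlim (\<lambda>T::real. nat \<lfloor>T\<rfloor>) sequentially at_top"
      by (rule filterlim_compose[OF filterlim_nat_sequentially filterlim_floor_sequentially])
    have fl': "filterlim (\<lambda>T::real. Suc (nat \<lfloor>T\<rfloor>)) sequentially at_top"
      by (rule filterlim_compose[OF filterlim_Suc fl])
    have q: "((\<lambda>T::real. real (nat \<lfloor>T\<rfloor>) / T) \<longlongrightarrow> 1) at_top"
    proof (rule tendsto_sandwich[where f = "\<lambda>T. 1 - 1 / T" and h = "\<lambda>T. 1"])
      show "((\<lambda>T::real. 1 - 1 / T) \<longlongrightarrow> 1) at_top" by real_asymp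
      show "\<forall>\<^sub>F T::real in at_top. 1 - 1 / T \<le> real (nat \<lfloor>T\<rfloor>) / T"
        using eventually_gt_at_top[of 0]
      proof eventually_elim
        case (elim T)
        have "T - 1 \<le> real (nat \<lfloor>T\<rfloor>)" by linarith
        then have "(T - 1) / T \<le> real (nat \<lfloor>T\<rfloor>) / T" using elim by (intro divide_right_mono) auto
        then show ?case using elim by (simp add: diff_divide_distrib)
      qed
      show "\<forall>\<^sub>F T::real in at_top. real (nat \<lfloor>T\<rfloor>) / T \<le> 1"
        using eventually_gt_at_top[of 0]
        by eventually_elim (simp add: divide_le_eq_1 of_nat_floor)
    qed auto
    have "((\<lambda>T::real. real (nat \<lfloor>T\<rfloor>) / T + 1 / T) \<longlongrightarrow> 1 + 0) at_top"
      by (intro tendsto_add q) real_asymp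
    moreover have "real (Suc (nat \<lfloor>T\<rfloor>)) / T = real (nat \<lfloor>T\<rfloor>) / T + 1 / T" for T :: real
      by (simp add: add_divide_distrib)
    ultimately have q': "((\<lambda>T::real. real (Suc (nat \<lfloor>T\<rfloor>)) / T) \<longlongrightarrow> 1) at_top"
      by (simp only: add_0_right)
    show ?case
    proof (rule tendsto_sandwich)
      show "((\<lambda>T. a (nat \<lfloor>T\<rfloor>) * (real (nat \<lfloor>T\<rfloor>) / T)) \<longlongrightarrow> g x) at_top"
        using tendsto_mult[OF filterlim_compose[OF a fl] q] by simp
      show "((\<lambda>T. a (Suc (nat \<lfloor>T\<rfloor>)) * (real (Suc (nat \<lfloor>T\<rfloor>)) / T)) \<longlongrightarrow> g x) at_top"
        using tendsto_mult[OF filterlim_compose[OF a fl'] q'] by simp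
      show "\<forall>\<^sub>F T in at_top. a (nat \<lfloor>T\<rfloor>) * (real (nat \<lfloor>T\<rfloor>) / T) \<le> 1 / T * H {0..T} x"
        using eventually_ge_at_top[of 1]
      proof eventually_elim
        case (elim T)
        have "birkhoff_sum f (nat \<lfloor>T\<rfloor>) x \<le> H {0..T} x"
          using H_mono[OF \<open>x \<in> space M\<close> \<open>\<forall>n. set_integrable lborel {0..real n} (G x)\<close>, of "nat \<lfloor>T\<rfloor>" T]
            sum_eq[OF \<open>x \<in> space M\<close> \<open>\<forall>n. set_integrable lborel {0..real n} (G x)\<close>, of "nat \<lfloor>T\<rfloor>"] elim by simp
        then have "birkhoff_sum f (nat \<lfloor>T\<rfloor>) x / T \<le> H {0..T} x / T"
          using elim by (intro divide_right_mono) auto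
        then show ?case unfolding a_mult by simp
      qed
      show "\<forall>\<^sub>F T in at_top. 1 / T * H {0..T} x \<le> a (Suc (nat \<lfloor>T\<rfloor>)) * (real (Suc (nat \<lfloor>T\<rfloor>)) / T)"
        using eventually_ge_at_top[of 1]
      proof eventually_elim
        case (elim T)
        have "T \<le> real (Suc (nat \<lfloor>T\<rfloor>))" using elim by linarith
        then have "H {0..T} x \<le> birkhoff_sum f (Suc (nat \<lfloor>T\<rfloor>)) x"
          using H_mono[OF \<open>x \<in> space M\<close> \<open>\<forall>n. set_integrable lborel {0..real n} (G x)\<close>, of T "real (Suc (nat \<lfloor>T\<rfloor>))"]
            sum_eq[OF \<open>x \<in> space M\<close> \<open>\<forall>n. set_integrable lborel {0..real n} (G x)\<close>, of "Suc (nat \<lfloor>T\<rfloor>)"] by argo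
        then have "H {0..T} x / T \<le> birkhoff_sum f (Suc (nat \<lfloor>T\<rfloor>)) x / T"
          using elim by (intro divide_right_mono) auto
        then show ?case unfolding a_mult by simp
      qed
    qed
  qed
  have A_int: "integrable M (\<lambda>x. 1 / T * H {0..T} x)" for T
    by (intro integrable_mult_right H_int) (auto simp: emeasure_lborel_Icc_eq)
  have H_nonneg: "0 \<le> H I x" for I x
    unfolding H_def set_lebesgue_integral_def
    by (rule Bochner_Integration.integral_nonneg) (simp add: nonneg)
  have g_nonneg: "AE x in M. 0 \<le> g x"
    unfolding g_def using f by (intro real_cond_exp_pos) (auto simp: f_def H_nonneg)
  have g_integral: "(\<integral>x. g x \<partial>M) = enn2real c"
    using real_cond_exp_int(2)[OF f] H_integral[of "{0..1}"] by (simp add: g_def f_def)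
  have L1: "((\<lambda>T. \<integral>x. \<bar>1 / T * H {0..T} x - g x\<bar> \<partial>M) \<longlongrightarrow> 0) at_top"
  proof (rule tendsto_at_topI_sequentially)
    fix X :: "nat \<Rightarrow> real" assume X: "filterlim X at_top sequentially"
    \<comment> \<open>Scheffe's lemma wants its hypotheses for every \<open>n\<close>, whereas
      \<open>X n\<close> is positive only eventually. Truncation at 1 repairs this and is undone at
      the end.\<close>
    have "(\<lambda>n. \<integral>\<^sup>+ x. norm (1 / max 1 (X n) * H {0..max 1 (X n)} x - g x) \<partial>M) \<longlonglongrightarrow> 0"
    proof (rule Scheffe_lemma1)
      show "integrable M (\<lambda>x. 1 / max 1 (X n) * H {0..max 1 (X n)} x)" for n by (rule A_int)
      show "integrable M g" by (rule g)
      have X1: "filterlim (\<lambda>n. max 1 (X n)) at_top sequentially"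
        by (rule filterlim_at_top_mono[OF X]) auto
      show "AE x in M. (\<lambda>n. 1 / max 1 (X n) * H {0..max 1 (X n)} x) \<longlonglongrightarrow> g x"
        using lim by eventually_elim (rule filterlim_compose[OF _ X1])
      have "(\<integral>\<^sup>+ x. norm (1 / max 1 (X n) * H {0..max 1 (X n)} x) \<partial>M) = ennreal (enn2real c)" for n
      proof -
        define r where "r = max 1 (X n)"
        have r: "r \<ge> 1" by (simp add: r_def)
        then have nn: "0 \<le> 1 / r * H {0..r} x" for x
          by (intro mult_nonneg_nonneg H_nonneg) auto
        then have "(\<integral>\<^sup>+ x. norm (1 / r * H {0..r} x) \<partial>M) = (\<integral>\<^sup>+ x. ennreal (1 / r * H {0..r} x) \<partial>M)"
          by (simp only: real_norm_def abs_of_nonneg)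
        also have "\<dots> = ennreal (\<integral>x. 1 / r * H {0..r} x \<partial>M)"
          by (rule nn_integral_eq_integral[OF A_int]) (use nn in simp)
        also have "(\<integral>x. 1 / r * H {0..r} x \<partial>M) = enn2real c"
          unfolding integral_mult_right_zero using r
          by (subst H_integral) (auto simp: emeasure_lborel_Icc_eq)
        finally show ?thesis by (simp only: r_def)
      qed
      moreover have "(\<integral>\<^sup>+ x. norm (g x) \<partial>M) = ennreal (enn2real c)"
      proof -
        have "(\<integral>\<^sup>+ x. norm (g x) \<partial>M) = (\<integral>\<^sup>+ x. ennreal (g x) \<partial>M)"
          by (rule nn_integral_cong_AE) (use g_nonneg in eventually_elim, simp)
        then show ?thesis using nn_integral_eq_integral[OF g g_nonneg] g_integral by simp
      qed
      ultimately show "limsup (\<lambda>n. \<integral>\<^sup>+ x. norm (1 / max 1 (X n) * H {0..max 1 (X n)} x) \<partial>M) \<le> (\<integral>\<^sup>+ x. norm (g x) \<partial>M)"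
        by (simp add: Limsup_const)
    qed
    moreover have "(\<integral>\<^sup>+ x. norm (1 / max 1 (X n) * H {0..max 1 (X n)} x - g x) \<partial>M) =
        ennreal (\<integral>x. \<bar>1 / max 1 (X n) * H {0..max 1 (X n)} x - g x\<bar> \<partial>M)" for n
      unfolding real_norm_def
      by (rule nn_integral_eq_integral) (use A_int g in auto)
    ultimately have "(\<lambda>n. ennreal (\<integral>x. \<bar>1 / max 1 (X n) * H {0..max 1 (X n)} x - g x\<bar> \<partial>M)) \<longlonglongrightarrow> ennreal 0"
      by simp
    then have "(\<lambda>n. \<integral>x. \<bar>1 / max 1 (X n) * H {0..max 1 (X n)} x - g x\<bar> \<partial>M) \<longlonglongrightarrow> 0"
      by (subst (asm) tendsto_ennreal_iff) auto
    moreover have "\<forall>\<^sub>F n in sequentially. 1 < X n"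
      using X by (simp add: filterlim_at_top_dense)
    then have "\<forall>\<^sub>F n in sequentially. (\<integral>x. \<bar>1 / max 1 (X n) * H {0..max 1 (X n)} x - g x\<bar> \<partial>M)
        = (\<integral>x. \<bar>1 / X n * H {0..X n} x - g x\<bar> \<partial>M)"
      by eventually_elim (simp only: max_absorb2 less_imp_le)
    ultimately show "(\<lambda>n. \<integral>x. \<bar>1 / X n * H {0..X n} x - g x\<bar> \<partial>M) \<longlonglongrightarrow> 0"
      by (rule Lim_transform_eventually)
  qed
  show "\<exists>g\<in>borel_measurable M.
       (AE x in M. ((\<lambda>T. 1 / T * (LINT t:{0..T}|lborel. G x t)) \<longlongrightarrow> g x) at_top) \<and>
       integrable M g \<and>
       (\<forall>T>0. integrable M (\<lambda>x. 1 / T * (LINT t:{0..T}|lborel. G x t))) \<and>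
       ((\<lambda>T. \<integral>x. \<bar>1 / T * (LINT t:{0..T}|lborel. G x t) - g x\<bar> \<partial>M) \<longlongrightarrow> 0) at_top"
    using lim g A_int L1 borel_measurable_integrable[OF g] unfolding H_def by blast
qed

end

section \<open>Dual spaces of semi-inner product spaces\<close>

text \<open>An element of norm 0 need not be the zero function; for instance it may be supported on
  a null set of points. Hence the separate case \<open>ip g g = 0\<close> in the Cauchy-Schwarz
  inequality.\<close>

locale semi_inner_space =
  fixes W :: "('a \<Rightarrow> 'b::real_vector) set" and ip :: "('a \<Rightarrow> 'b) \<Rightarrow> ('a \<Rightarrow> 'b) \<Rightarrow> real"
  assumes zero_mem: "(\<lambda>x. 0) \<in> W"
    and add_mem: "\<And>f g. f \<in> W \<Longrightarrow> g \<in> W \<Longrightarrow> (\<lambda>x. f x + g x) \<in> W"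
    and scale_mem: "\<And>c f. f \<in> W \<Longrightarrow> (\<lambda>x. c *\<^sub>R f x) \<in> W"
    and ip_add: "\<And>f g h. f \<in> W \<Longrightarrow> g \<in> W \<Longrightarrow> h \<in> W \<Longrightarrow> ip (\<lambda>x. f x + g x) h = ip f h + ip g h"
    and ip_scale: "\<And>c f h. f \<in> W \<Longrightarrow> h \<in> W \<Longrightarrow> ip (\<lambda>x. c *\<^sub>R f x) h = c * ip f h"
    and ip_commute: "\<And>f g. ip f g = ip g f"
    and ip_nonneg: "\<And>f. 0 \<le> ip f f"
begin

lemma minus_mem: "f \<in> W \<Longrightarrow> g \<in> W \<Longrightarrow> (\<lambda>x. f x - g x) \<in> W"
  using add_mem[of f "\<lambda>x. (-1) *\<^sub>R g x"] scale_mem[of g "-1"] by simp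

lemma ip_zero: "h \<in> W \<Longrightarrow> ip (\<lambda>x. 0) h = 0"
  using ip_scale[OF zero_mem, of h 0] by simp

lemma ip_self_add:
  assumes "f \<in> W" "g \<in> W"
  shows "ip (\<lambda>x. f x + c *\<^sub>R g x) (\<lambda>x. f x + c *\<^sub>R g x) = ip f f + 2 * c * ip f g + c\<^sup>2 * ip g g"
proof -
  note m = assms scale_mem[OF assms(2), of c] add_mem[OF assms(1) scale_mem[OF assms(2), of c]]
  have r: "ip h (\<lambda>x. f x + c *\<^sub>R g x) = ip h f + c * ip h g" if "h \<in> W" for h
    using ip_add[OF m(1,3) that] ip_scale[OF assms(2) that] ip_commute by metis
  show ?thesis
    using ip_add[OF m(1,3,4)] ip_scale[OF m(2,4)] r[OF m(1)] r[OF m(2)] ip_commute[of g f]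
    by (simp add: power2_eq_square algebra_simps)
qed

lemma Cauchy_Schwarz_sq:
  assumes "f \<in> W" "g \<in> W"
  shows "(ip f g)\<^sup>2 \<le> ip f f * ip g g"
proof (cases "ip g g = 0")
  case True
  have "ip f g = 0"
  proof (rule ccontr)
    assume ne: "ip f g \<noteq> 0"
    \<comment> \<open>With \<open>ip g g = 0\<close> the square of the norm of
      \<open>f + c g\<close> is affine in \<open>c\<close>; this \<open>c\<close> would give it the
      value -1.\<close>
    define c where "c = - (ip f f + 1) / (2 * ip f g)"
    have "0 \<le> ip f f + 2 * c * ip f g + c\<^sup>2 * ip g g"
      using ip_self_add[OF assms, of c] ip_nonneg by metis
    also have "2 * c * ip f g = - (ip f f + 1)" using ne by (simp add: c_def field_simps)
    also have "ip f f + - (ip f f + 1) + c\<^sup>2 * ip g g = -1" using True by simp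
    finally show False by simp
  qed
  then show ?thesis using ip_nonneg by simp
next
  case False
  then have pos: "ip g g > 0" using ip_nonneg[of g] by simp
  \<comment> \<open>The minimizer of the quadratic polynomial in \<open>c\<close>.\<close>
  define c where "c = - ip f g / ip g g"
  have "0 \<le> ip f f + 2 * c * ip f g + c\<^sup>2 * ip g g"
    using ip_self_add[OF assms, of c] ip_nonneg by metis
  also have "\<dots> = ip f f - (ip f g)\<^sup>2 / ip g g"
    using pos by (simp add: c_def power2_eq_square field_simps)
  finally show ?thesis using pos by (simp add: field_simps)
qed

lemma Minkowski:
  assumes "f \<in> W" "g \<in> W"
  shows "sqrt (ip (\<lambda>x. f x + g x) (\<lambda>x. f x + g x)) \<le> sqrt (ip f f) + sqrt (ip g g)"
proof -
  have "ip (\<lambda>x. f x + g x) (\<lambda>x. f x + g x) = ip f f + 2 * ip f g + ip g g"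
    using ip_self_add[OF assms, of 1] by simp
  also have "ip f g \<le> sqrt (ip f f) * sqrt (ip g g)"
    using real_le_rsqrt[OF Cauchy_Schwarz_sq[OF assms]] by (simp add: real_sqrt_mult)
  finally have "ip (\<lambda>x. f x + g x) (\<lambda>x. f x + g x) \<le> (sqrt (ip f f) + sqrt (ip g g))\<^sup>2"
    using ip_nonneg by (simp add: power2_eq_square algebra_simps)
  then show ?thesis by (intro real_le_lsqrt) (auto simp: ip_nonneg)
qed

lemma sqrt_ip_scale:
  assumes "f \<in> W"
  shows "sqrt (ip (\<lambda>x. c *\<^sub>R f x) (\<lambda>x. c *\<^sub>R f x)) = \<bar>c\<bar> * sqrt (ip f f)"
proof -
  have "ip (\<lambda>x. c *\<^sub>R f x) (\<lambda>x. c *\<^sub>R f x) = c\<^sup>2 * ip f f"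
    using ip_scale[OF assms scale_mem[OF assms, of c], of c] ip_scale[OF assms assms, of c]
      ip_commute[of f "\<lambda>x. c *\<^sub>R f x"] by (simp add: power2_eq_square)
  then show ?thesis by (simp add: real_sqrt_mult)
qed

lemma sum_mem:
  fixes N :: nat
  assumes "\<And>n. \<phi> n \<in> W"
  shows "(\<lambda>x. \<Sum>n<N. c n *\<^sub>R \<phi> n x) \<in> W"
proof (induction N)
  case (Suc N)
  from add_mem[OF this scale_mem[OF assms, of "c N" N]] show ?case by simp
qed (simp add: zero_mem)

lemma ip_sum_left:
  fixes N :: nat
  assumes "\<And>n. \<phi> n \<in> W" "h \<in> W"
  shows "ip (\<lambda>x. \<Sum>n<N. c n *\<^sub>R \<phi> n x) h = (\<Sum>n<N. c n * ip (\<phi> n) h)"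
proof (induction N)
  case (Suc N)
  then show ?case
    using ip_add[OF sum_mem[where N=N and c=c, OF assms(1)] scale_mem[where c="c N", OF assms(1)[of N]] assms(2)]
      ip_scale[OF assms(1,2)] by simp
qed (simp add: ip_zero assms)

lemma ip_orthonormal_sum:
  fixes N :: nat
  assumes "\<And>n. \<phi> n \<in> W" "\<And>m n. ip (\<phi> m) (\<phi> n) = (if m = n then 1 else 0)"
  shows "ip (\<lambda>x. \<Sum>n<N. c n *\<^sub>R \<phi> n x) (\<lambda>x. \<Sum>n<N. c n *\<^sub>R \<phi> n x) = (\<Sum>n<N. (c n)\<^sup>2)"
proof -
  let ?s = "\<lambda>x. \<Sum>n<N. c n *\<^sub>R \<phi> n x"
  have "ip (\<phi> n) ?s = c n" if "n < N" for n
    using ip_sum_left[where \<phi>=\<phi> and N=N and c=c, OF assms(1) assms(1)[of n]] that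
    by (simp add: ip_commute[of "\<phi> n"] assms(2) if_distrib cong: if_cong)
  then show ?thesis
    using ip_sum_left[where \<phi>=\<phi> and N=N and c=c and h="?s", OF assms(1) sum_mem[where \<phi>=\<phi>, OF assms(1)]]
    by (simp add: power2_eq_square)
qed

section \<open>Bounded functionals and their coordinates in an orthonormal basis\<close>

lemma dual_add: "l \<in> dual_space W ip \<Longrightarrow> f \<in> W \<Longrightarrow> g \<in> W \<Longrightarrow> l (\<lambda>x. f x + g x) = l f + l g"
  and dual_scale: "l \<in> dual_space W ip \<Longrightarrow> f \<in> W \<Longrightarrow> l (\<lambda>x. c *\<^sub>R f x) = c * l f"
  and dual_bounded: "l \<in> dual_space W ip \<Longrightarrow> \<exists>C. \<forall>f\<in>W. \<bar>l f\<bar> \<le> C * sqrt (ip f f)"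
  by (auto simp: dual_space_def)

lemma dual_sum:
  fixes N :: nat
  assumes "l \<in> dual_space W ip" "\<And>n. \<phi> n \<in> W"
  shows "l (\<lambda>x. \<Sum>n<N. c n *\<^sub>R \<phi> n x) = (\<Sum>n<N. c n * l (\<phi> n))"
proof (induction N)
  case 0
  show ?case using dual_scale[OF assms(1) zero_mem, of 0] by simp
next
  case (Suc N)
  then show ?case
    using dual_add[OF assms(1) sum_mem[where \<phi>=\<phi> and N=N and c=c, OF assms(2)] scale_mem[where c="c N", OF assms(2)[of N]]]
      dual_scale[OF assms(1,2)] by simp
qed

lemma dual_space_diff:
  assumes "l \<in> dual_space W ip" "l' \<in> dual_space W ip"
  shows "(\<lambda>f. l f - l' f) \<in> dual_space W ip"
proof -
  obtain C C' where C: "\<And>f. f \<in> W \<Longrightarrow> \<bar>l f\<bar> \<le> C * sqrt (ip f f)" "\<And>f. f \<in> W \<Longrightarrow> \<bar>l' f\<bar> \<le> C' * sqrt (ip f f)"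
    using dual_bounded assms by meson
  have "\<bar>l f - l' f\<bar> \<le> (C + C') * sqrt (ip f f)" if "f \<in> W" for f
    using C[OF that] by (simp add: distrib_right)
  then have "\<exists>C. \<forall>f\<in>W. \<bar>l f - l' f\<bar> \<le> C * sqrt (ip f f)" by blast
  then show ?thesis using assms unfolding dual_space_def by (simp add: right_diff_distrib)
qed

text \<open>The functional is tested on the combination of the first \<open>N\<close> basis elements
  whose coefficients are its own coordinates. The value there is the partial sum \<open>s\<close>
  while the norm is only \<open>sqrt s\<close>, so boundedness with constant \<open>C\<close> forces
  \<open>sqrt s \<le> C\<close> unless \<open>s = 0\<close>.\<close>

lemma dual_coordinates_summable:
  assumes l: "l \<in> dual_space W ip" and \<phi>: "\<And>n. \<phi> n \<in> W"
    and on: "\<And>m n. ip (\<phi> m) (\<phi> n) = (if m = n then 1 else 0)"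
  shows "summable (\<lambda>n. (l (\<phi> n))\<^sup>2)"
proof -
  obtain C where C: "\<And>f. f \<in> W \<Longrightarrow> \<bar>l f\<bar> \<le> C * sqrt (ip f f)" using dual_bounded[OF l] by blast
  show ?thesis
  proof (rule summableI_nonneg_bounded)
    fix N
    define s where "s = (\<Sum>n<N. (l (\<phi> n))\<^sup>2)"
    have s0: "s \<ge> 0" unfolding s_def by (simp add: sum_nonneg)
    have "l (\<lambda>x. \<Sum>n<N. l (\<phi> n) *\<^sub>R \<phi> n x) = s"
      unfolding dual_sum[where \<phi>=\<phi>, OF l \<phi>] s_def by (simp add: power2_eq_square)
    then have "\<bar>s\<bar> \<le> C * sqrt s"
      using C[OF sum_mem[where \<phi>=\<phi> and N=N and c="\<lambda>n. l (\<phi> n)", OF \<phi>]]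
      unfolding ip_orthonormal_sum[where \<phi>=\<phi>, OF \<phi> on] s_def by simp
    moreover have "\<bar>s\<bar> = sqrt s * sqrt s" using s0 by simp
    ultimately have le: "sqrt s * sqrt s \<le> C * sqrt s" by linarith
    show "s \<le> C\<^sup>2"
    proof (cases "s = 0")
      case False
      then have "sqrt s > 0" using s0 by simp
      then have "sqrt s \<le> C" using mult_right_le_imp_le[OF le] by simp
      then have "(sqrt s)\<^sup>2 \<le> C\<^sup>2" using \<open>sqrt s > 0\<close> by (intro power_mono) auto
      then show ?thesis using s0 by simp
    qed simp
  qed auto
qed

text \<open>An element of the unit ball is replaced by a finite combination of basis elements, to
  which the finite Cauchy-Schwarz inequality applies. The combination may leave the unit ball, but
  its norm is at most \<open>1 + \<epsilon>\<close>; boundedness of \<open>l\<close> takes care of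
  the remainder.\<close>

lemma dual_norm_le:
  assumes l: "l \<in> dual_space W ip" and b: "orthonormal_basis W ip \<phi>"
  shows "dual_norm W ip l \<le> sqrt (\<Sum>n. (l (\<phi> n))\<^sup>2)"
proof -
  have \<phi>: "\<And>n. \<phi> n \<in> W" and on: "\<And>m n. ip (\<phi> m) (\<phi> n) = (if m = n then 1 else 0)"
    and dense: "\<And>f \<epsilon>. f \<in> W \<Longrightarrow> \<epsilon> > 0 \<Longrightarrow> \<exists>N c. sqrt (ip (\<lambda>x. f x - (\<Sum>n<N. c n *\<^sub>R \<phi> n x)) (\<lambda>x. f x - (\<Sum>n<N. c n *\<^sub>R \<phi> n x))) < \<epsilon>"
    using b unfolding orthonormal_basis_def Let_def by auto
  define R where "R = sqrt (\<Sum>n. (l (\<phi> n))\<^sup>2)"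
  have summ: "summable (\<lambda>n. (l (\<phi> n))\<^sup>2)" by (rule dual_coordinates_summable[OF l \<phi> on])
  obtain C where C: "\<And>f. f \<in> W \<Longrightarrow> \<bar>l f\<bar> \<le> C * sqrt (ip f f)" using dual_bounded[OF l] by blast
  have "\<bar>l f\<bar> \<le> R" if f: "f \<in> W" "sqrt (ip f f) \<le> 1" for f
  proof (rule field_le_epsilon)
    fix e :: real assume e: "e > 0"
    \<comment> \<open>The total error is \<open>\<epsilon> * (\<bar>C\<bar> + R)\<close>; the
      summand 1 only prevents division by 0.\<close>
    define \<epsilon> where "\<epsilon> = e / (\<bar>C\<bar> + R + 1)"
    have R0: "R \<ge> 0" unfolding R_def by (simp add: suminf_nonneg[OF summ])
    have \<epsilon>: "\<epsilon> > 0" unfolding \<epsilon>_def using e R0 by (intro divide_pos_pos) auto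
    obtain N c where Nc: "sqrt (ip (\<lambda>x. f x - (\<Sum>n<N. c n *\<^sub>R \<phi> n x)) (\<lambda>x. f x - (\<Sum>n<N. c n *\<^sub>R \<phi> n x))) < \<epsilon>"
      using dense[OF f(1) \<epsilon>] by blast
    define s where "s = (\<lambda>x. \<Sum>n<N. c n *\<^sub>R \<phi> n x)"
    have sW: "s \<in> W" unfolding s_def by (rule sum_mem[OF \<phi>])
    define r where "r = (\<lambda>x. f x - s x)"
    have rW: "r \<in> W" unfolding r_def by (rule minus_mem[OF f(1) sW])
    have r\<epsilon>: "sqrt (ip r r) < \<epsilon>" using Nc by (simp add: r_def s_def)
    have lf: "l f = l r + l s" using dual_add[OF l rW sW] by (simp add: r_def)
    have "sqrt (ip s s) \<le> sqrt (ip f f) + sqrt (ip r r)"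
      using Minkowski[OF f(1) scale_mem[OF rW, of "-1"]] sqrt_ip_scale[OF rW, of "-1"] by (simp add: r_def)
    then have ss: "sqrt (ip s s) \<le> 1 + \<epsilon>" using f(2) r\<epsilon> by linarith
    have "\<bar>l s\<bar> = \<bar>\<Sum>n<N. c n * l (\<phi> n)\<bar>" unfolding s_def by (simp add: dual_sum[OF l \<phi>])
    also have "\<dots> \<le> (\<Sum>n<N. \<bar>c n\<bar> * \<bar>l (\<phi> n)\<bar>)"
      by (rule order_trans[OF sum_abs]) (simp add: abs_mult)
    also have "\<dots> \<le> L2_set c {..<N} * L2_set (\<lambda>n. l (\<phi> n)) {..<N}"
      by (rule L2_set_mult_ineq)
    also have "L2_set c {..<N} = sqrt (ip s s)"
      unfolding s_def L2_set_def ip_orthonormal_sum[where \<phi>=\<phi>, OF \<phi> on] ..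
    also have "L2_set (\<lambda>n. l (\<phi> n)) {..<N} \<le> R"
      unfolding L2_set_def R_def by (intro real_sqrt_le_mono sum_le_suminf[OF summ]) auto
    also have "sqrt (ip s s) * R \<le> (1 + \<epsilon>) * R" by (rule mult_right_mono[OF ss R0])
    finally have ls: "\<bar>l s\<bar> \<le> (1 + \<epsilon>) * R" by (simp add: mult_left_mono ip_nonneg)
    have "\<bar>l r\<bar> \<le> C * sqrt (ip r r)" by (rule C[OF rW])
    also have "\<dots> \<le> \<bar>C\<bar> * sqrt (ip r r)" by (intro mult_right_mono) (auto simp: ip_nonneg)
    also have "\<dots> \<le> \<bar>C\<bar> * \<epsilon>" using r\<epsilon> by (intro mult_left_mono) auto
    finally have "\<bar>l f\<bar> \<le> \<bar>C\<bar> * \<epsilon> + (1 + \<epsilon>) * R" using ls lf by linarith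
    also have "\<dots> = R + \<epsilon> * (\<bar>C\<bar> + R)" by (simp add: algebra_simps)
    also have "\<epsilon> * (\<bar>C\<bar> + R) \<le> e"
      unfolding \<epsilon>_def using e R0 by (simp add: field_simps)
    finally show "\<bar>l f\<bar> \<le> R + e" by simp
  qed
  moreover have "(\<lambda>x. 0) \<in> {f \<in> W. sqrt (ip f f) \<le> 1}" using zero_mem ip_zero[OF zero_mem] by simp
  ultimately show ?thesis unfolding dual_norm_def R_def[symmetric] by (intro cSUP_least) auto
qed

end

section \<open>Separability of l2 as a source of measurability\<close>

lemma l2_diff_summable:
  fixes a b :: "nat \<Rightarrow> 'e::real_normed_vector"
  assumes "summable (\<lambda>n. (norm (a n))\<^sup>2)" "summable (\<lambda>n. (norm (b n))\<^sup>2)"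
  shows "summable (\<lambda>n. (norm (a n - b n))\<^sup>2)"
    and "(\<Sum>n. (norm (a n - b n))\<^sup>2) \<le> 2 * (\<Sum>n. (norm (a n))\<^sup>2) + 2 * (\<Sum>n. (norm (b n))\<^sup>2)"
proof -
  have le: "(norm (x - y))\<^sup>2 \<le> 2 * (norm x)\<^sup>2 + 2 * (norm y)\<^sup>2" for x y :: 'e
  proof -
    have "(norm (x - y))\<^sup>2 \<le> (norm x + norm y)\<^sup>2" by (intro power_mono norm_triangle_ineq4) auto
    also have "\<dots> \<le> 2 * (norm x)\<^sup>2 + 2 * (norm y)\<^sup>2"
      using sum_squares_bound[of "norm x" "norm y"] by (simp add: power2_sum)
    finally show ?thesis .
  qed
  have s: "summable (\<lambda>n. 2 * (norm (a n))\<^sup>2 + 2 * (norm (b n))\<^sup>2)"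
    using assms by (intro summable_add summable_mult)
  show 1: "summable (\<lambda>n. (norm (a n - b n))\<^sup>2)"
    by (rule summable_comparison_test'[OF s, of 0]) (use le in auto)
  have "(\<Sum>n. (norm (a n - b n))\<^sup>2) \<le> (\<Sum>n. 2 * (norm (a n))\<^sup>2 + 2 * (norm (b n))\<^sup>2)"
    by (rule suminf_le[OF le 1 s])
  also have "\<dots> = 2 * (\<Sum>n. (norm (a n))\<^sup>2) + 2 * (\<Sum>n. (norm (b n))\<^sup>2)"
    using assms by (simp add: suminf_add[symmetric] suminf_mult summable_mult)
  finally show "(\<Sum>n. (norm (a n - b n))\<^sup>2) \<le> 2 * (\<Sum>n. (norm (a n))\<^sup>2) + 2 * (\<Sum>n. (norm (b n))\<^sup>2)" .
qed

text \<open>Lists padded with zeros: with entries from a countable dense set they form a countable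
  dense subset of l2.\<close>

definition list_seq :: "'e::zero list \<Rightarrow> nat \<Rightarrow> 'e" where
  "list_seq q n = (if n < length q then q ! n else 0)"

text \<open>The tail of the series is cut off, and then each of the remaining \<open>N\<close>
  coordinates is approximated with squared error below \<open>r / (2 * (N + 1))\<close>; the summand
  1 admits \<open>N = 0\<close>.\<close>

lemma list_seq_dense:
  fixes a :: "nat \<Rightarrow> 'e::real_normed_vector"
  assumes a: "summable (\<lambda>n. (norm (a n))\<^sup>2)" and r: "r > 0"
    and D: "\<And>x e. e > 0 \<Longrightarrow> \<exists>d\<in>D. norm (x - d) < (e::real)"
  shows "\<exists>q\<in>lists D. summable (\<lambda>n. (norm (a n - list_seq q n))\<^sup>2) \<and> (\<Sum>n. (norm (a n - list_seq q n))\<^sup>2) < r"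
proof -
  obtain N where N: "norm (\<Sum>i. (norm (a (i + N)))\<^sup>2) < r / 2"
    using suminf_exist_split[OF _ a, of "r/2"] r by auto
  define e where "e = sqrt (r / (2 * (real N + 1)))"
  have e: "e > 0" unfolding e_def using r by simp
  obtain d where d: "\<And>n. d n \<in> D \<and> norm (a n - d n) < e" using bchoice[of UNIV "\<lambda>n d. d \<in> D \<and> norm (a n - d) < e"] D[OF e] by auto
  define q where "q = map d [0..<N]"
  have q: "q \<in> lists D" using d by (auto simp: q_def)
  have ls: "list_seq q n = (if n < N then d n else 0)" for n by (auto simp: list_seq_def q_def)
  have eq: "(norm (a (n + N) - list_seq q (n + N)))\<^sup>2 = (norm (a (n + N)))\<^sup>2" for n by (simp add: ls)
  have "summable (\<lambda>n. (norm (a (n + N) - list_seq q (n + N)))\<^sup>2)"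
    unfolding eq by (subst summable_iff_shift) (rule a)
  then have summ: "summable (\<lambda>n. (norm (a n - list_seq q n))\<^sup>2)" by (subst (asm) summable_iff_shift)
  have "(\<Sum>n. (norm (a n - list_seq q n))\<^sup>2) = (\<Sum>n. (norm (a (n + N)))\<^sup>2) + (\<Sum>n<N. (norm (a n - d n))\<^sup>2)"
    using suminf_split_initial_segment[OF summ, of N] unfolding eq by (simp add: ls)
  also have "(\<Sum>n<N. (norm (a n - d n))\<^sup>2) \<le> (\<Sum>n<N. e\<^sup>2)"
    by (intro sum_mono power_mono) (use d in \<open>auto intro: less_imp_le\<close>)
  also have "\<dots> \<le> r / 2" unfolding e_def using r by (simp add: field_simps)
  finally show ?thesis using N summ q by (intro bexI[of _ q]) auto
qed

text \<open>\<open>U\<close> is a union of traces of l2 balls with rational radii and centres in a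
  countable dense set, hence of countably many of them. The preimage of such a ball is a sublevel
  set of a series of measurable functions. The centres are finite lists and need not be coordinate
  sequences of elements of \<open>H\<close>.\<close>

lemma l2_open_vimage_measurable:
  fixes c :: "'h \<Rightarrow> nat \<Rightarrow> 'e::{second_countable_topology, real_normed_vector}"
  assumes summ: "\<And>z. z \<in> H \<Longrightarrow> summable (\<lambda>n. (norm (c z n))\<^sup>2)"
    and U: "U \<subseteq> H" "\<And>z. z \<in> U \<Longrightarrow> \<exists>r>0. \<forall>y\<in>H. (\<Sum>n. (norm (c z n - c y n))\<^sup>2) < r \<longrightarrow> y \<in> U"
    and X: "\<And>\<omega>. \<omega> \<in> space M \<Longrightarrow> X \<omega> \<in> H"
    and [measurable]: "\<And>n. (\<lambda>\<omega>. c (X \<omega>) n) \<in> borel_measurable M"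
  shows "X -` U \<inter> space M \<in> sets M"
proof -
  obtain D :: "'e set" where D: "countable D" "\<And>X. open X \<Longrightarrow> X \<noteq> {} \<Longrightarrow> \<exists>d\<in>D. d \<in> X"
    using countable_dense_setE by blast
  have dense: "\<exists>d\<in>D. norm (x - d) < e" if "e > 0" for x :: 'e and e :: real
    using D(2)[of "ball x e"] that by (auto simp: dist_norm)
  define \<delta> where "\<delta> z q = (\<Sum>n. (norm (c z n - list_seq q n))\<^sup>2)" for z q
  define G where "G = {(q, r). q \<in> lists D \<and> r \<in> \<rat> \<and> (\<forall>z\<in>H. \<delta> z q < r \<longrightarrow> z \<in> U)}"
  have "countable (lists D \<times> \<rat>)" using D(1) countable_rat by (intro countable_SIGMA) auto
  then have G: "countable G" by (rule countable_subset[rotated]) (auto simp: G_def)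
  have ball: "{\<omega> \<in> space M. \<delta> (X \<omega>) q < r} \<in> sets M" for q r
    unfolding \<delta>_def by measurable
  have ls: "summable (\<lambda>n. (norm (list_seq q n :: 'e))\<^sup>2)" for q
    by (rule summable_finite[of "{..<length q}"]) (auto simp: list_seq_def)
  have "X -` U \<inter> space M = (\<Union>(q, r)\<in>G. {\<omega> \<in> space M. \<delta> (X \<omega>) q < r})"
  proof (intro equalityI subsetI)
    fix \<omega> assume \<omega>: "\<omega> \<in> X -` U \<inter> space M"
    then have z: "X \<omega> \<in> H" using X by auto
    obtain r where r: "r > 0" "\<And>y. y \<in> H \<Longrightarrow> (\<Sum>n. (norm (c (X \<omega>) n - c y n))\<^sup>2) < r \<Longrightarrow> y \<in> U"
      using U(2)[of "X \<omega>"] \<omega> by auto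
    \<comment> \<open>Two points within squared distance \<open>r'\<close> of the same centre have
      squared distance below \<open>4 * r'\<close>, by the factors 2 in
      \<open>l2_diff_summable\<close>.\<close>
    obtain r' where r': "r' \<in> \<rat>" "0 < r'" "r' < r / 4" using Rats_dense_in_real[of 0 "r/4"] r(1) by auto
    obtain q where q: "q \<in> lists D" "\<delta> (X \<omega>) q < r'"
      using list_seq_dense[OF summ[OF z] r'(2) dense] unfolding \<delta>_def by blast
    have "y \<in> U" if y: "y \<in> H" "\<delta> y q < r'" for y
    proof (rule r(2)[OF y(1)])
      let ?a = "\<lambda>n. c (X \<omega>) n - list_seq q n" and ?b = "\<lambda>n. c y n - list_seq q n"
      have "(\<Sum>n. (norm (?a n - ?b n))\<^sup>2) \<le> 2 * (\<Sum>n. (norm (?a n))\<^sup>2) + 2 * (\<Sum>n. (norm (?b n))\<^sup>2)"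
        by (intro l2_diff_summable(2) l2_diff_summable(1) summ z y ls)
      also have "\<dots> < r" using q(2) y(2) r'(3) by (simp add: \<delta>_def)
      finally show "(\<Sum>n. (norm (c (X \<omega>) n - c y n))\<^sup>2) < r" by simp
    qed
    then have "(q, r') \<in> G" using q r' by (auto simp: G_def)
    then show "\<omega> \<in> (\<Union>(q, r)\<in>G. {\<omega> \<in> space M. \<delta> (X \<omega>) q < r})" using q \<omega> by auto
  qed (use X in \<open>auto simp: G_def\<close>)
  also have "\<dots> \<in> sets M" using ball by (intro sets.countable_UN'[OF G]) auto
  finally show ?thesis .
qed

text \<open>The predicate defines a topology for an arbitrary real function \<open>d\<close>: the
  balls around one point are nested whatever \<open>d\<close> is, which is all that intersections
  require.\<close>

lemma openin_metric_topology:
  "openin (metric_topology M d) U \<longleftrightarrow> U \<subseteq> M \<and> (\<forall>x\<in>U. \<exists>r>0. \<forall>y\<in>M. d x y < r \<longrightarrow> y \<in> U)"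
proof -
  let ?P = "\<lambda>U. U \<subseteq> M \<and> (\<forall>x\<in>U. \<exists>r>0. \<forall>y\<in>M. d x y < r \<longrightarrow> y \<in> U)"
  have "istopology ?P"
    unfolding istopology_def
  proof (rule conjI; intro allI impI)
    fix S T assume S: "?P S" and T: "?P T"
    have "\<exists>r>0. \<forall>y\<in>M. d x y < r \<longrightarrow> y \<in> S \<inter> T" if x: "x \<in> S \<inter> T" for x
    proof -
      obtain r1 where r1: "r1 > 0" "\<forall>y\<in>M. d x y < r1 \<longrightarrow> y \<in> S" using S x by blast
      obtain r2 where r2: "r2 > 0" "\<forall>y\<in>M. d x y < r2 \<longrightarrow> y \<in> T" using T x by blast
      show ?thesis using r1 r2 by (intro exI[of _ "min r1 r2"]) simp
    qed
    moreover have "S \<inter> T \<subseteq> M" using S by blast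
    ultimately show "?P (S \<inter> T)" by blast
  next
    fix \<K> assume K: "\<forall>S\<in>\<K>. ?P S"
    have "\<exists>r>0. \<forall>y\<in>M. d x y < r \<longrightarrow> y \<in> \<Union>\<K>" if x: "x \<in> \<Union>\<K>" for x
    proof -
      obtain S where S: "S \<in> \<K>" "x \<in> S" using x by blast
      then obtain r where "r > 0" "\<forall>y\<in>M. d x y < r \<longrightarrow> y \<in> S" using K by meson
      then show ?thesis using S(1) by (intro exI[of _ r]) auto
    qed
    moreover have "\<Union>\<K> \<subseteq> M" using K by blast
    ultimately show "?P (\<Union>\<K>)" by blast
  qed
  then show ?thesis unfolding metric_topology_def by (simp add: topology_inverse')
qed

lemma topspace_metric_topology: "topspace (metric_topology M d) = M"
proof (rule subset_antisym)
  show "topspace (metric_topology M d) \<subseteq> M"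
    using openin_metric_topology[THEN iffD1, OF openin_topspace] by (rule conjunct1)
  have "openin (metric_topology M d) M"
    unfolding openin_metric_topology using zero_less_one by blast
  then show "M \<subseteq> topspace (metric_topology M d)" by (rule openin_subset)
qed

lemma space_borel_on [simp]: "space (borel_on X) = topspace X"
  by (simp add: borel_on_def space_measure_of_conv)

lemma openin_sets_borel_on: "openin X U \<Longrightarrow> U \<in> sets (borel_on X)"
  unfolding borel_on_def by (intro in_measure_of) (auto dest: openin_subset)

lemma measurable_borel_onI:
  assumes "\<And>\<omega>. \<omega> \<in> space M \<Longrightarrow> f \<omega> \<in> topspace X"
    and "\<And>U. openin X U \<Longrightarrow> f -` U \<inter> space M \<in> sets M"
  shows "f \<in> M \<rightarrow>\<^sub>M borel_on X"
  unfolding borel_on_def by (rule measurable_measure_of) (use assms in \<open>auto dest: openin_subset\<close>)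

section \<open>Test functions and weak derivatives\<close>

text \<open>Together with uniqueness of derivatives this reduces the calculus of \<open>pdx\<close>
  to that of one real variable.\<close>

lemma pdx_DERIV:
  assumes "f differentiable (at x)"
  shows "((\<lambda>t. f (x + t *\<^sub>R axis j 1)) has_real_derivative pdx j f x) (at 0)"
proof -
  have "(f has_derivative frechet_derivative f (at x)) (at x)"
    using assms frechet_derivative_works by blast
  then have f: "(f has_derivative frechet_derivative f (at x)) (at (x + 0 *\<^sub>R axis j 1))" by simp
  have g: "((\<lambda>t::real. x + t *\<^sub>R axis j 1) has_derivative (\<lambda>t. t *\<^sub>R axis j 1)) (at 0)"
    by (auto intro!: derivative_eq_intros)
  have "((\<lambda>t. f (x + t *\<^sub>R axis j 1)) has_derivative (\<lambda>t. frechet_derivative f (at x) (t *\<^sub>R axis j 1))) (at 0)"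
    by (rule has_derivative_compose[OF g f])
  moreover have "frechet_derivative f (at x) (t *\<^sub>R axis j 1) = pdx j f x * t" for t
    using linear_frechet_derivative[OF assms] by (simp add: linear_cmul pdx_def)
  ultimately show ?thesis unfolding has_field_derivative_def by simp
qed

lemma pdx_eqI:
  assumes "f differentiable (at x)"
    and "((\<lambda>t. f (x + t *\<^sub>R axis j 1)) has_real_derivative D) (at 0)"
  shows "pdx j f x = D"
  using DERIV_unique[OF pdx_DERIV[OF assms(1)] assms(2)] .

lemma pdx_DERIV_at:
  assumes "f differentiable (at (x + s *\<^sub>R axis j 1))"
  shows "((\<lambda>t. f (x + t *\<^sub>R axis j 1)) has_real_derivative pdx j f (x + s *\<^sub>R axis j 1)) (at s)"
  using pdx_DERIV[OF assms, of j] DERIV_shift[of "\<lambda>t. f (x + t *\<^sub>R axis j 1)" "pdx j f (x + s *\<^sub>R axis j 1)" 0 s]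
  by (simp add: algebra_simps scaleR_add_left)

lemma pdx_add:
  assumes "f differentiable (at x)" "g differentiable (at x)"
  shows "pdx j (\<lambda>x. f x + g x) x = pdx j f x + pdx j g x"
  by (intro pdx_eqI differentiable_add assms DERIV_add pdx_DERIV)

lemma pdx_scale:
  assumes "f differentiable (at x)"
  shows "pdx j (\<lambda>x. c * f x) x = c * pdx j f x"
  by (intro pdx_eqI DERIV_cmult pdx_DERIV assms differentiable_mult differentiable_const)

lemma pdx_mult:
  assumes "f differentiable (at x)" "g differentiable (at x)"
  shows "pdx j (\<lambda>x. f x * g x) x = pdx j f x * g x + f x * pdx j g x"
  using DERIV_mult[OF pdx_DERIV[OF assms(1), of j] pdx_DERIV[OF assms(2), of j]]
  by (intro pdx_eqI differentiable_mult assms) (simp add: algebra_simps)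

section \<open>Smooth functions and the algebra of test functions\<close>

lemma smooth_on_differentiable: "smooth_on UNIV f \<Longrightarrow> f differentiable (at x)"
  unfolding smooth_on_def by (metis UNIV_I foldr.simps(1) id_apply)

lemma smooth_on_foldr_pdx: "smooth_on UNIV f \<Longrightarrow> smooth_on UNIV (foldr pdx js f)"
  unfolding smooth_on_def by (metis foldr_append comp_apply)

lemma smooth_on_pdx: "smooth_on UNIV f \<Longrightarrow> smooth_on UNIV (pdx j f)"
  using smooth_on_foldr_pdx[of f "[j]"] by simp

lemma smooth_onI:
  assumes "\<And>js x. foldr pdx js f differentiable (at x)"
  shows "smooth_on UNIV f"
  using assms by (auto simp: smooth_on_def)

lemma foldr_pdx_add:
  assumes "smooth_on UNIV f" "smooth_on UNIV g"
  shows "foldr pdx js (\<lambda>x. f x + g x) = (\<lambda>x. foldr pdx js f x + foldr pdx js g x)"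
proof (induction js)
  case (Cons j js)
  then show ?case
    by (intro ext) (simp add: pdx_add smooth_on_differentiable smooth_on_foldr_pdx assms)
qed simp

lemma foldr_pdx_scale:
  assumes "smooth_on UNIV f"
  shows "foldr pdx js (\<lambda>x. c * f x) = (\<lambda>x. c * foldr pdx js f x)"
proof (induction js)
  case (Cons j js)
  then show ?case
    by (intro ext) (simp add: pdx_scale smooth_on_differentiable smooth_on_foldr_pdx assms)
qed simp

lemma smooth_on_add:
  assumes "smooth_on UNIV f" "smooth_on UNIV g"
  shows "smooth_on UNIV (\<lambda>x. f x + g x)"
  by (rule smooth_onI)
    (simp add: foldr_pdx_add[OF assms] smooth_on_differentiable smooth_on_foldr_pdx assms)

lemma smooth_on_scale:
  assumes "smooth_on UNIV f"
  shows "smooth_on UNIV (\<lambda>x. c * f x)"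
  by (rule smooth_onI)
    (simp add: foldr_pdx_scale[OF assms] smooth_on_differentiable smooth_on_foldr_pdx assms)

lemma pdx_mult_smooth:
  assumes "smooth_on UNIV f" "smooth_on UNIV g"
  shows "pdx j (\<lambda>x. f x * g x) = (\<lambda>x. pdx j f x * g x + f x * pdx j g x)"
  using assms by (auto simp: fun_eq_iff intro!: pdx_mult smooth_on_differentiable)

text \<open>Induction on the number of derivatives, with both factors arbitrary.
  \<open>foldr\<close> applies the last list element first, so it is split off at the end: the
  product rule turns it into a sum of two products of smooth functions, with fewer derivatives left
  to take.\<close>

lemma smooth_on_mult:
  assumes "smooth_on UNIV f" "smooth_on UNIV g"
  shows "smooth_on UNIV (\<lambda>x. f x * g x)"
proof -
  have "\<forall>f g x. smooth_on UNIV f \<longrightarrow> smooth_on UNIV g \<longrightarrow>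
      foldr pdx js (\<lambda>x. f x * g x) differentiable (at x)" for js
  proof (induction "length js" arbitrary: js rule: less_induct)
    case less
    show ?case
    proof (cases js rule: rev_cases)
      case Nil
      then show ?thesis by (simp add: differentiable_mult smooth_on_differentiable)
    next
      case (snoc js' j)
      show ?thesis
      proof (intro allI impI)
        fix f g x assume fg: "smooth_on UNIV f" "smooth_on UNIV g"
        have IH: "foldr pdx ks (\<lambda>x. f x * g x) differentiable (at x)"
          if "length ks \<le> length js'" "smooth_on UNIV f" "smooth_on UNIV g" for f g :: sfield and x ks
          using less(1)[of ks] that snoc by simp
        \<comment> \<open>\<open>foldr_pdx_add\<close> would presuppose smoothness of the two
          products, which is being proved. The induction hypothesis supplies the differentiability
          needed for lists of this length.\<close>
        have sum: "foldr pdx ks (\<lambda>x. pdx j f x * g x + f x * pdx j g x) =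
            (\<lambda>x. foldr pdx ks (\<lambda>x. pdx j f x * g x) x + foldr pdx ks (\<lambda>x. f x * pdx j g x) x)"
          if "length ks \<le> length js'" for ks
          using that
        proof (induction ks)
          case (Cons i ks)
          then have "foldr pdx ks (\<lambda>x. pdx j f x * g x + f x * pdx j g x) =
            (\<lambda>x. foldr pdx ks (\<lambda>x. pdx j f x * g x) x + foldr pdx ks (\<lambda>x. f x * pdx j g x) x)"
            by simp
          moreover have "length ks \<le> length js'" using Cons.prems by simp
          ultimately show ?case
            by (intro ext) (simp add: pdx_add IH fg smooth_on_pdx)
        qed simp
        show "foldr pdx js (\<lambda>x. f x * g x) differentiable (at x)"
          by (simp add: snoc pdx_mult_smooth[OF fg] sum)
            (intro differentiable_add IH fg smooth_on_pdx order_refl)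
      qed
    qed
  qed
  then show ?thesis using assms by (intro smooth_onI) blast
qed

lemma periodic_pdx:
  assumes "periodic f" "smooth_on UNIV f"
  shows "periodic (pdx j f)"
proof -
  have "pdx j f (x + c) = pdx j f x" if "\<And>x. f (x + c) = f x" for c x
  proof -
    have "(\<lambda>t. f (x + c + t *\<^sub>R axis j 1)) = (\<lambda>t. f (x + t *\<^sub>R axis j 1))"
      using that[of "x + _ *\<^sub>R axis j 1"] by (simp add: algebra_simps)
    then show ?thesis
      using pdx_DERIV[OF smooth_on_differentiable[OF assms(2)], of "x + c" j]
        pdx_DERIV[OF smooth_on_differentiable[OF assms(2)], of x j] DERIV_unique by metis
  qed
  then show ?thesis using assms(1) unfolding periodic_def by blast
qed

lemma pdx_zero_on_open:
  assumes "open S" "x \<in> S" "\<And>y. y \<in> S \<Longrightarrow> f y = 0"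
  shows "pdx j f x = 0"
proof -
  have "(f has_derivative (\<lambda>h. 0)) (at x)"
    using has_derivative_transform_within_open[of "\<lambda>x. 0" "\<lambda>h. 0" x UNIV S f] assms by auto
  then show ?thesis unfolding pdx_def using frechet_derivative_at by metis
qed

lemma Cc_inftyD:
  assumes "\<phi> \<in> Cc_infty"
  shows "smooth_on UNIV \<phi>" "periodic \<phi>" "\<phi> differentiable (at x)" "continuous_on S \<phi>"
proof -
  show s: "smooth_on UNIV \<phi>" and "periodic \<phi>" using assms by (auto simp: Cc_infty_def)
  show "\<phi> differentiable (at x)" for x by (rule smooth_on_differentiable[OF s])
  then show "continuous_on S \<phi>"
    using differentiable_imp_continuous_within continuous_at_imp_continuous_on by blast
qed

lemma Cc_infty_pdx:
  assumes "\<phi> \<in> Cc_infty"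
  shows "pdx j \<phi> \<in> Cc_infty"
proof -
  obtain \<delta> where \<delta>: "\<delta> > 0" "\<And>x. \<phi> x \<noteq> 0 \<Longrightarrow> \<delta> \<le> x$3 \<and> x$3 \<le> 1 - \<delta>"
    using assms by (auto simp: Cc_infty_def)
  have "\<delta> \<le> x$3 \<and> x$3 \<le> 1 - \<delta>" if "pdx j \<phi> x \<noteq> 0" for x
  proof (rule ccontr)
    assume c: "\<not> (\<delta> \<le> x$3 \<and> x$3 \<le> 1 - \<delta>)"
    have "open {y::real^3. y$3 < \<delta>}" "open {y::real^3. 1 - \<delta> < y$3}"
      by (auto intro!: open_Collect_less continuous_intros)
    then have "open ({y::real^3. y$3 < \<delta>} \<union> {y. 1 - \<delta> < y$3})" by (rule open_Un)
    moreover have "x \<in> {y::real^3. y$3 < \<delta>} \<union> {y. 1 - \<delta> < y$3}" using c by auto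
    ultimately have "pdx j \<phi> x = 0"
      by (rule pdx_zero_on_open) (use \<delta>(2) in force)
    with that show False by simp
  qed
  then show ?thesis
    using Cc_inftyD[OF assms] \<delta>(1) smooth_on_pdx periodic_pdx unfolding Cc_infty_def by blast
qed

lemma Cc_infty_foldr_pdx: "\<phi> \<in> Cc_infty \<Longrightarrow> foldr pdx js \<phi> \<in> Cc_infty"
  by (induction js) (auto intro: Cc_infty_pdx)

lemma Cc_infty_add:
  assumes "\<phi> \<in> Cc_infty" "\<psi> \<in> Cc_infty"
  shows "(\<lambda>x. \<phi> x + \<psi> x) \<in> Cc_infty"
proof -
  obtain \<delta> where \<delta>: "\<delta> > 0" "\<And>x. \<phi> x \<noteq> 0 \<Longrightarrow> \<delta> \<le> x$3 \<and> x$3 \<le> 1 - \<delta>"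
    using assms by (auto simp: Cc_infty_def)
  obtain \<delta>' where \<delta>': "\<delta>' > 0" "\<And>x. \<psi> x \<noteq> 0 \<Longrightarrow> \<delta>' \<le> x$3 \<and> x$3 \<le> 1 - \<delta>'"
    using assms by (auto simp: Cc_infty_def)
  have "min \<delta> \<delta>' \<le> x$3 \<and> x$3 \<le> 1 - min \<delta> \<delta>'" if "\<phi> x + \<psi> x \<noteq> 0" for x
    using \<delta>(2)[of x] \<delta>'(2)[of x] that by (cases "\<phi> x = 0") auto
  moreover have "periodic (\<lambda>x. \<phi> x + \<psi> x)" using assms[THEN Cc_inftyD(2)] by (simp add: periodic_def)
  moreover have "min \<delta> \<delta>' > 0" using \<delta> \<delta>' by simp
  ultimately show ?thesis
    using smooth_on_add Cc_inftyD(1) assms unfolding Cc_infty_def by blast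
qed

lemma Cc_infty_scale:
  assumes "\<phi> \<in> Cc_infty"
  shows "(\<lambda>x. c * \<phi> x) \<in> Cc_infty"
proof -
  have "periodic (\<lambda>x. c * \<phi> x)" using Cc_inftyD(2) assms by (simp add: periodic_def)
  then show ?thesis
    using assms smooth_on_scale[OF Cc_inftyD(1)[OF assms], of c] unfolding Cc_infty_def by auto
qed

lemma Cc_infty_mult:
  assumes "\<phi> \<in> Cc_infty" "\<psi> \<in> Cc_infty"
  shows "(\<lambda>x. \<phi> x * \<psi> x) \<in> Cc_infty"
proof -
  have "periodic (\<lambda>x. \<phi> x * \<psi> x)" using assms[THEN Cc_inftyD(2)] by (simp add: periodic_def)
  then show ?thesis
    using assms smooth_on_mult[OF Cc_inftyD(1) Cc_inftyD(1), of \<phi> \<psi>] unfolding Cc_infty_def by auto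
qed

section \<open>Periodic functions and integrals over the cell\<close>

lemma periodic_shift_nat:
  assumes "periodic f" "j = 1 \<or> j = 2"
  shows "f (x + real n *\<^sub>R axis j 1) = f x"
proof (induction n)
  case (Suc n)
  have "f (x + real (Suc n) *\<^sub>R axis j 1) = f ((x + real n *\<^sub>R axis j 1) + axis j 1)"
    by (simp add: algebra_simps scaleR_add_left)
  then show ?case using assms Suc by (auto simp: periodic_def)
qed simp

lemma periodic_shift_int:
  assumes "periodic f" "j = 1 \<or> j = 2"
  shows "f (x + of_int i *\<^sub>R axis j 1) = f x"
proof (cases "i \<ge> 0")
  case True
  then show ?thesis using periodic_shift_nat[OF assms, of x "nat i"] by simp
next
  case False
  then show ?thesis using periodic_shift_nat[OF assms, of "x + of_int i *\<^sub>R axis j 1" "nat (-i)"]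
    by (simp add: algebra_simps)
qed

text \<open>Integer translations in the first two variables move any point with
  \<open>\<phi> x \<noteq> 0\<close> into the closed unit cube, which is compact.\<close>

lemma Cc_infty_bounded:
  assumes "\<phi> \<in> Cc_infty"
  shows "\<exists>B>0. \<forall>x. \<bar>\<phi> x\<bar> \<le> B"
proof -
  define K :: "(real^3) set" where "K = cbox 0 1"
  have "compact (\<phi> ` K)"
    unfolding K_def by (intro compact_continuous_image Cc_inftyD assms compact_cbox)
  then obtain B where B: "B > 0" "\<And>x. x \<in> K \<Longrightarrow> \<bar>\<phi> x\<bar> \<le> B"
    using compact_imp_bounded bounded_pos by (metis imageI real_norm_def)
  have "\<bar>\<phi> x\<bar> \<le> B" for x
  proof (cases "\<phi> x = 0")
    case False
    define y where "y = x + of_int (- \<lfloor>x$1\<rfloor>) *\<^sub>R axis 1 1 + of_int (- \<lfloor>x$2\<rfloor>) *\<^sub>R axis 2 1"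
    have y: "\<phi> y = \<phi> x" unfolding y_def
      using periodic_shift_int[OF Cc_inftyD(2)[OF assms]] by metis
    have "0 \<le> x$3 \<and> x$3 \<le> 1" using assms False unfolding Cc_infty_def by force
    moreover have "y$1 = frac (x$1)" "y$2 = frac (x$2)" "y$3 = x$3"
      by (simp_all add: y_def axis_def frac_def)
    ultimately have "y \<in> K"
      unfolding K_def mem_box_cart by (simp add: forall_3 frac_lt_1 less_imp_le)
    then show ?thesis using B(2) y by metis
  qed (use B in simp)
  with B(1) show ?thesis by blast
qed

lemma cell_borel [measurable]: "cell \<in> sets borel"
  unfolding cell_def by measurable

lemma cell_lebesgue [simp, measurable]: "cell \<in> sets lebesgue"
  using cell_borel by simp

lemma emeasure_cell: "emeasure lebesgue cell < \<infinity>"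
proof -
  have "cell \<subseteq> cbox 0 1" by (auto simp: cell_def mem_box_cart forall_3)
  then have "bounded cell" using bounded_cbox bounded_subset by blast
  then have "cell \<in> lmeasurable" by (rule bounded_set_imp_lmeasurable) simp
  then show ?thesis by (simp add: fmeasurable_def)
qed

interpretation cell: finite_measure "lebesgue_on cell"
  by (rule finite_measureI) (use emeasure_cell in \<open>auto simp: emeasure_restrict_space\<close>)

lemma Cc_infty_measurable:
  "\<phi> \<in> Cc_infty \<Longrightarrow> \<phi> \<in> borel_measurable borel"
  by (intro borel_measurable_continuous_onI Cc_inftyD)

lemma borel_imp_lebesgue_on:
  "f \<in> borel_measurable borel \<Longrightarrow> f \<in> borel_measurable (lebesgue_on S)"
  by (intro measurable_restrict_space1) (simp add: measurable_completion)

lemma Cc_infty_integrable: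
  assumes "\<phi> \<in> Cc_infty"
  shows "integrable (lebesgue_on cell) \<phi>"
proof -
  obtain B where "\<forall>x. \<bar>\<phi> x\<bar> \<le> B" using Cc_infty_bounded[OF assms] by blast
  then show ?thesis
    by (intro cell.integrable_const_bound[of _ B] borel_imp_lebesgue_on Cc_infty_measurable assms) auto
qed

lemma Cc_infty_mult_integrable:
  assumes "\<phi> \<in> Cc_infty" "integrable (lebesgue_on cell) f"
  shows "integrable (lebesgue_on cell) (\<lambda>x. f x * \<phi> x)"
proof -
  obtain B where B: "\<forall>x. \<bar>\<phi> x\<bar> \<le> B" using Cc_infty_bounded[OF assms(1)] by blast
  have [measurable]: "f \<in> borel_measurable (lebesgue_on cell)" "\<phi> \<in> borel_measurable (lebesgue_on cell)"
    using assms by (auto intro!: borel_imp_lebesgue_on Cc_infty_measurable)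
  have "integrable (lebesgue_on cell) (\<lambda>x. B * \<bar>f x\<bar>)" using assms(2) by simp
  then show ?thesis
  proof (rule Bochner_Integration.integrable_bound)
    show "AE x in lebesgue_on cell. norm (f x * \<phi> x) \<le> norm (B * \<bar>f x\<bar>)"
    proof (rule AE_I2)
      fix x
      have "\<bar>f x\<bar> * \<bar>\<phi> x\<bar> \<le> \<bar>f x\<bar> * \<bar>B\<bar>" using B by (intro mult_left_mono) (auto intro: order_trans)
      then show "norm (f x * \<phi> x) \<le> norm (B * \<bar>f x\<bar>)" by (simp add: abs_mult mult.commute)
    qed
  qed measurable
qed

lemma L2_integrable: "f \<in> L2 \<Longrightarrow> integrable (lebesgue_on cell) f"
  using cell.square_integrable_imp_integrable by (auto simp: L2_def)

lemma Cc_infty_L2: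
  assumes "\<phi> \<in> Cc_infty"
  shows "\<phi> \<in> L2"
  using Cc_infty_mult_integrable[OF assms Cc_infty_integrable[OF assms]] assms
  by (auto simp: L2_def power2_eq_square intro!: borel_imp_lebesgue_on Cc_infty_measurable)

lemma LINT_cell_lborel:
  fixes f :: sfield
  assumes "f \<in> borel_measurable borel"
  shows "(LINT x|lebesgue_on cell. f x) = (LINT x|lborel. indicator cell x * f x)"
proof -
  have "(LINT x|lebesgue_on cell. f x) = (LINT x|lebesgue. indicator cell x * f x)"
    using integral_restrict_space[of cell lebesgue f] by simp
  also have "\<dots> = (LINT x|lborel. indicator cell x * f x)"
    using assms by (intro integral_completion borel_measurable_times borel_measurable_indicator) auto
  finally show ?thesis .
qed

lemma lborel_translate:
  fixes f :: "real^3 \<Rightarrow> real"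
  assumes [measurable]: "f \<in> borel_measurable borel"
  shows "(LINT x|lborel. f (x + c)) = (LINT x|lborel. f x)"
proof -
  have "(LINT x|lborel. f x) = (LINT x|distr lborel borel ((+) c). f x)" by (simp add: lborel_distr_plus)
  also have "\<dots> = (LINT x|lborel. f (c + x))" by (intro integral_distr) auto
  finally show ?thesis by (simp add: add.commute)
qed

text \<open>In the third direction the distance \<open>\<delta>\<close> of the support from the
  boundary leaves room for the translation. In the other two, the part of the cell that is pushed
  out is brought back by a unit translation, under which the function is invariant.\<close>

lemma integral_cell_translate:
  assumes \<phi>: "\<phi> \<in> Cc_infty"
  shows "\<exists>e>0. e \<le> 1 \<and> (\<forall>t. 0 < t \<and> t < e \<longrightarrow>
     (LINT x|lebesgue_on cell. \<phi> (x + t *\<^sub>R axis j 1)) = (LINT x|lebesgue_on cell. \<phi> x))"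
proof -
  note [measurable] = Cc_infty_measurable[OF \<phi>]
  obtain \<delta> where \<delta>: "\<delta> > 0" "\<And>x. \<phi> x \<noteq> 0 \<Longrightarrow> \<delta> \<le> x$3 \<and> x$3 \<le> 1 - \<delta>"
    using \<phi> by (auto simp: Cc_infty_def)
  have L: "(LINT x|lebesgue_on cell. \<phi> (x + t *\<^sub>R axis j 1)) =
      (LINT x|lborel. indicator cell (x - t *\<^sub>R axis j 1) * \<phi> x)" for t
    using lborel_translate[of "\<lambda>x. indicator cell (x - t *\<^sub>R axis j 1) * \<phi> x" "t *\<^sub>R axis j 1"]
    by (simp add: LINT_cell_lborel)
  show ?thesis
  proof (cases "j = 3")
    case True
    show ?thesis
    proof (intro exI[of _ "min 1 \<delta>"] conjI allI impI)
      fix t assume t: "0 < t \<and> t < min 1 \<delta>"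
      have "indicator cell (x - t *\<^sub>R axis j 1) * \<phi> x = indicator cell x * \<phi> x" for x
        using \<delta>(2)[of x] t \<delta>(1) by (cases "\<phi> x = 0") (auto simp: indicator_def cell_def axis_def True)
      then show "(LINT x|lebesgue_on cell. \<phi> (x + t *\<^sub>R axis j 1)) = (LINT x|lebesgue_on cell. \<phi> x)"
        unfolding L LINT_cell_lborel[OF Cc_infty_measurable[OF \<phi>]] by (simp only:)
    qed (use \<delta> in auto)
  next
    case False
    then have j: "j = 1 \<or> j = 2" using exhaust_3 by blast
    show ?thesis
    proof (intro exI[of _ 1] conjI allI impI)
      fix t :: real assume t: "0 < t \<and> t < 1"
      have j_per: "\<phi> (x + axis j 1) = \<phi> x" for x
        using j Cc_inftyD(2)[OF \<phi>] by (auto simp: periodic_def)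
      \<comment> \<open>The translated cell is cut at \<open>x$j = 1\<close>: the first piece lies
        in the cell, the second lies in the neighbouring copy.\<close>
      have shift_set: "x - t *\<^sub>R axis j 1 \<in> cell \<longleftrightarrow>
          (x \<in> cell \<and> t \<le> x$j) \<or> (x - axis j 1 \<in> cell \<and> x$j < 1 + t)"
        and disj: "\<not> ((x \<in> cell \<and> t \<le> x$j) \<and> (x - axis j 1 \<in> cell \<and> x$j < 1 + t))" for x
        using j t by (auto simp: cell_def axis_def)
      have int: "integrable lborel (\<lambda>x. indicator cell x * \<phi> x * indicator S x)" if [measurable]: "S \<in> sets borel" for S
      proof -
        have "integrable lebesgue (\<lambda>x. indicator cell x * \<phi> x)"
          using Cc_infty_integrable[OF \<phi>] integrable_restrict_space[of cell lebesgue \<phi>] by simp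
        then have "integrable lborel (\<lambda>x. indicator cell x * \<phi> x)"
          by (subst (asm) integrable_completion) measurable
        then show ?thesis using integrable_real_mult_indicator[of S lborel] by simp
      qed
      let ?A = "{x::real^3. t \<le> x$j}" and ?B = "{x::real^3. x$j < t}"
      have "(LINT x|lebesgue_on cell. \<phi> (x + t *\<^sub>R axis j 1)) =
         (LINT x|lborel. indicator cell x * \<phi> x * indicator ?A x +
            indicator cell (x + (- axis j 1)) * \<phi> (x + (- axis j 1)) * indicator ?B (x + (- axis j 1)))"
        unfolding L
      proof (rule Bochner_Integration.integral_cong)
        fix x
        have "\<phi> (x + (- axis j 1)) = \<phi> x" using j_per[of "x + (- axis j 1)"] by simp
        moreover have "x + (- axis j 1) \<in> ?B \<longleftrightarrow> x$j < 1 + t" by (auto simp: axis_def)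
        ultimately show "indicator cell (x - t *\<^sub>R axis j 1) * \<phi> x = indicator cell x * \<phi> x * indicator ?A x +
            indicator cell (x + (- axis j 1)) * \<phi> (x + (- axis j 1)) * indicator ?B (x + (- axis j 1))"
          using shift_set[of x] disj[of x] by (auto simp: indicator_def)
      qed simp
      also have "\<dots> = (LINT x|lborel. indicator cell x * \<phi> x * indicator ?A x) +
          (LINT x|lborel. indicator cell (x + (- axis j 1)) * \<phi> (x + (- axis j 1)) * indicator ?B (x + (- axis j 1)))"
      proof (rule Bochner_Integration.integral_add)
        have "integrable (distr lborel borel ((+) (- axis j 1))) (\<lambda>x. indicator cell x * \<phi> x * indicator ?B x)"
          unfolding lborel_distr_plus by (rule int) measurable
        then show "integrable lborel (\<lambda>x. indicator cell (x + (- axis j 1)) * \<phi> (x + (- axis j 1)) * indicator ?B (x + (- axis j 1)))"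
          by (subst (asm) integrable_distr_eq) (auto simp: add.commute)
      qed (rule int, measurable)
      also have "(LINT x|lborel. indicator cell (x + (- axis j 1)) * \<phi> (x + (- axis j 1)) * indicator ?B (x + (- axis j 1)))
          = (LINT x|lborel. indicator cell x * \<phi> x * indicator ?B x)"
        by (rule lborel_translate) measurable
      also have "(LINT x|lborel. indicator cell x * \<phi> x * indicator ?A x) + \<dots> =
          (LINT x|lborel. indicator cell x * \<phi> x * indicator ?A x + indicator cell x * \<phi> x * indicator ?B x)"
        by (intro Bochner_Integration.integral_add[symmetric] int) measurable
      also have "\<dots> = (LINT x|lborel. indicator cell x * \<phi> x)"
        by (rule Bochner_Integration.integral_cong) (auto simp: indicator_def)
      finally show "(LINT x|lebesgue_on cell. \<phi> (x + t *\<^sub>R axis j 1)) = (LINT x|lebesgue_on cell. \<phi> x)"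
        by (simp add: LINT_cell_lborel)
    qed auto
  qed
qed

lemma Cc_infty_Lipschitz_axis:
  assumes \<phi>: "\<phi> \<in> Cc_infty" and B: "\<And>x. \<bar>pdx j \<phi> x\<bar> \<le> B"
  shows "\<bar>\<phi> (x + t *\<^sub>R axis j 1) - \<phi> x\<bar> \<le> B * \<bar>t\<bar>"
proof -
  have "norm (\<phi> (x + t *\<^sub>R axis j 1) - \<phi> (x + 0 *\<^sub>R axis j 1)) \<le> B * norm (t - 0)"
    by (rule field_differentiable_bound[of UNIV _ "\<lambda>s. pdx j \<phi> (x + s *\<^sub>R axis j 1)"])
      (auto intro!: pdx_DERIV_at Cc_inftyD(3)[OF \<phi>] B)
  then show ?thesis by simp
qed

text \<open>Translation invariance makes the integral of every small difference quotient vanish. The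
  quotients are bounded by the supremum of the partial derivative, so dominated convergence passes
  to the limit.\<close>

lemma integral_pdx_zero:
  assumes \<phi>: "\<phi> \<in> Cc_infty"
  shows "(LINT x|lebesgue_on cell. pdx j \<phi> x) = 0"
proof -
  note [measurable] = Cc_infty_measurable[OF \<phi>] Cc_infty_measurable[OF Cc_infty_pdx[OF \<phi>]]
  obtain B where B: "\<And>x. \<bar>pdx j \<phi> x\<bar> \<le> B" using Cc_infty_bounded[OF Cc_infty_pdx[OF \<phi>]] by blast
  obtain e where e: "e > 0" "\<And>t. 0 < t \<and> t < e \<Longrightarrow>
     (LINT x|lebesgue_on cell. \<phi> (x + t *\<^sub>R axis j 1)) = (LINT x|lebesgue_on cell. \<phi> x)"
    using integral_cell_translate[OF \<phi>] by blast
  \<comment> \<open>Any null sequence strictly between 0 and \<open>e\<close> would do; the 2 keeps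
    the first term below \<open>e\<close>.\<close>
  define h where "h n = e / (real n + 2)" for n :: nat
  have h: "0 < h n" "h n < e" for n unfolding h_def using e(1) by (auto simp: field_simps intro!: add_pos_nonneg)
  have h0: "h \<longlonglongrightarrow> 0" unfolding h_def[abs_def] by real_asymp
  define q where "q n x = (\<phi> (x + h n *\<^sub>R axis j 1) - \<phi> x) / h n" for n x
  obtain C where C: "\<And>x. \<bar>\<phi> x\<bar> \<le> C" using Cc_infty_bounded[OF \<phi>] by blast
  have "(\<lambda>n. LINT x|lebesgue_on cell. q n x) \<longlonglongrightarrow> (LINT x|lebesgue_on cell. pdx j \<phi> x)"
  proof (rule integral_dominated_convergence[where w = "\<lambda>x. B"])
    show "pdx j \<phi> \<in> borel_measurable (lebesgue_on cell)" by (rule borel_imp_lebesgue_on) measurable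
    show "q n \<in> borel_measurable (lebesgue_on cell)" for n
      unfolding q_def[abs_def] by (rule borel_imp_lebesgue_on) measurable
    show "integrable (lebesgue_on cell) (\<lambda>x. B)" by simp
    show "AE x in lebesgue_on cell. norm (q n x) \<le> B" for n
      using Cc_infty_Lipschitz_axis[OF \<phi> B, of _ "h n"] h(1)[of n]
      by (auto simp: q_def abs_divide divide_le_eq)
    show "AE x in lebesgue_on cell. (\<lambda>n. q n x) \<longlonglongrightarrow> pdx j \<phi> x"
    proof (rule AE_I2)
      fix x
      have d: "((\<lambda>t. (\<phi> (x + t *\<^sub>R axis j 1) - \<phi> x) / t) \<longlongrightarrow> pdx j \<phi> x) (at 0)"
        using pdx_DERIV[OF Cc_inftyD(3)[OF \<phi>], of x j] by (simp add: DERIV_def)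
      have "filterlim h (at 0) sequentially"
        using h0 h(1) by (auto simp: filterlim_at less_imp_neq[symmetric])
      from filterlim_compose[OF d this]
      show "(\<lambda>n. q n x) \<longlonglongrightarrow> pdx j \<phi> x" by (simp add: q_def)
    qed
  qed
  moreover have "(LINT x|lebesgue_on cell. q n x) = 0" for n
  proof -
    have "integrable (lebesgue_on cell) (\<lambda>x. \<phi> (x + h n *\<^sub>R axis j 1))"
      using C by (intro cell.integrable_const_bound[of _ C] borel_imp_lebesgue_on) auto
    then show ?thesis
      using e(2)[of "h n"] h Cc_infty_integrable[OF \<phi>] by (simp add: q_def)
  qed
  ultimately show ?thesis using LIMSEQ_unique[of "\<lambda>n. 0" 0] by simp
qed

section \<open>Integration by parts and weak derivatives\<close>

lemma integral_by_parts_pdx: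
  assumes "f \<in> Cc_infty" "g \<in> Cc_infty"
  shows "(LINT x|lebesgue_on cell. f x * pdx j g x) = - (LINT x|lebesgue_on cell. pdx j f x * g x)"
proof -
  have "(LINT x|lebesgue_on cell. pdx j f x * g x + f x * pdx j g x) = 0"
    using integral_pdx_zero[OF Cc_infty_mult[OF assms], of j]
    by (simp add: pdx_mult_smooth Cc_inftyD assms)
  then show ?thesis
    using Cc_infty_integrable[OF Cc_infty_mult[OF Cc_infty_pdx[OF assms(1)] assms(2)], of j]
      Cc_infty_integrable[OF Cc_infty_mult[OF assms(1) Cc_infty_pdx[OF assms(2)]], of j] by simp
qed

text \<open>Each step takes the outermost derivative off \<open>g\<close> and puts it on
  \<open>f\<close>, so the order of differentiation is reversed. Keeping track of it avoids
  interchanging mixed partial derivatives.\<close>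

lemma integral_by_parts_foldr_pdx:
  assumes "f \<in> Cc_infty" "g \<in> Cc_infty"
  shows "(LINT x|lebesgue_on cell. f x * foldr pdx js g x) =
    (-1) ^ length js * (LINT x|lebesgue_on cell. foldr pdx (rev js) f x * g x)"
  using assms(1)
proof (induction js arbitrary: f)
  case (Cons j js)
  then show ?case
    using integral_by_parts_pdx[OF Cons.prems Cc_infty_foldr_pdx[OF assms(2)], of j js]
      Cons.IH[OF Cc_infty_pdx[OF Cons.prems], of j] by simp
qed simp

definition mi_list :: "multi_index \<Rightarrow> 3 list" where
  "mi_list \<alpha> = replicate (\<alpha> 1) 1 @ replicate (\<alpha> 2) 2 @ replicate (\<alpha> 3) 3"

lemma foldr_replicate_funpow: "foldr f (replicate n a) x = (f a ^^ n) x"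
  by (induction n) auto

lemma mderiv_foldr: "mderiv \<alpha> f = foldr pdx (mi_list \<alpha>) f"
  by (simp add: mderiv_def mi_list_def foldr_replicate_funpow)

lemma length_mi_list: "length (mi_list \<alpha>) = mi_order \<alpha>"
  by (simp add: mi_list_def mi_order_def sum_3)

lemma Cc_infty_mderiv: "\<phi> \<in> Cc_infty \<Longrightarrow> mderiv \<alpha> \<phi> \<in> Cc_infty"
  by (simp add: mderiv_foldr Cc_infty_foldr_pdx)

lemma Cc_infty_weak_deriv:
  assumes "f \<in> Cc_infty"
  shows "weak_deriv \<alpha> f (foldr pdx (rev (mi_list \<alpha>)) f)"
  unfolding weak_deriv_def mderiv_foldr length_mi_list[symmetric]
  using integral_by_parts_foldr_pdx[OF assms] by blast

lemma weak_deriv_add: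
  assumes "f \<in> L2" "g \<in> L2" "f' \<in> L2" "g' \<in> L2" "weak_deriv \<alpha> f f'" "weak_deriv \<alpha> g g'"
  shows "weak_deriv \<alpha> (\<lambda>x. f x + g x) (\<lambda>x. f' x + g' x)"
  unfolding weak_deriv_def
proof
  fix \<phi> assume \<phi>: "\<phi> \<in> Cc_infty"
  note i = Cc_infty_mult_integrable[OF Cc_infty_mderiv[OF \<phi>] L2_integrable] Cc_infty_mult_integrable[OF \<phi> L2_integrable]
  show "(LINT x|lebesgue_on cell. (f x + g x) * mderiv \<alpha> \<phi> x) =
      (-1) ^ mi_order \<alpha> * (LINT x|lebesgue_on cell. (f' x + g' x) * \<phi> x)"
    using i assms \<phi> by (simp add: distrib_right distrib_left weak_deriv_def)
qed

lemma weak_deriv_scale: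
  assumes "weak_deriv \<alpha> f f'"
  shows "weak_deriv \<alpha> (\<lambda>x. c * f x) (\<lambda>x. c * f' x)"
  using assms unfolding weak_deriv_def by (simp add: mult.assoc)

section \<open>The fundamental lemma of the calculus of variations\<close>

text \<open>The usual flat function \<open>exp (- 1 / y)\<close>. The powers of \<open>1 / y\<close>
  are included because they arise on differentiation: each derivative is a linear combination of
  members of the family.\<close>

definition flat_exp :: "nat \<Rightarrow> real \<Rightarrow> real" where
  "flat_exp m y = (if y > 0 then exp (- inverse y) * inverse y ^ m else 0)"

text \<open>This is the difference quotient at 0, where the function vanishes. From the right the
  exponential in \<open>1 / y\<close> beats every power.\<close>

lemma flat_exp_at_0: "((\<lambda>y. flat_exp m y / y) \<longlongrightarrow> 0) (at 0)"
proof (rule filterlim_split_at)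
  have "\<forall>\<^sub>F y::real in at_left 0. flat_exp m y / y = 0"
    unfolding eventually_at_filter by (rule always_eventually) (simp add: flat_exp_def)
  then show "((\<lambda>y. flat_exp m y / y) \<longlongrightarrow> 0) (at_left 0)" by (rule tendsto_eventually)
  have "((\<lambda>y::real. inverse y ^ Suc m / exp (inverse y)) \<longlongrightarrow> 0) (at_right 0)"
    by (rule filterlim_compose[OF tendsto_power_div_exp_0 filterlim_inverse_at_top_right])
  moreover have "\<forall>\<^sub>F y::real in at_right 0. inverse y ^ Suc m / exp (inverse y) = flat_exp m y / y"
    unfolding eventually_at_filter
    by (rule always_eventually) (simp add: flat_exp_def exp_minus divide_inverse mult_ac)
  ultimately show "((\<lambda>y. flat_exp m y / y) \<longlongrightarrow> 0) (at_right 0)"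
    by (rule Lim_transform_eventually)
qed

lemma flat_exp_DERIV:
  "(flat_exp m has_real_derivative (flat_exp (m + 2) y - real m * flat_exp (Suc m) y)) (at y)"
proof -
  consider "y > 0" | "y = 0" | "y < 0" by linarith
  then show ?thesis
  proof cases
    case 1
    have "((\<lambda>y. exp (- inverse y) * inverse y ^ m) has_real_derivative
       (flat_exp (m + 2) y - real m * flat_exp (Suc m) y)) (at y)"
    proof -
      \<comment> \<open>The subtraction is truncated at \<open>m = 0\<close>, where the factor
        \<open>real m\<close> makes both sides vanish.\<close>
      have p: "real m * inverse y ^ (m - Suc 0) * inverse y ^ 2 = real m * inverse y ^ Suc m"
        by (cases m) (auto simp: power2_eq_square)
      have "((\<lambda>y. exp (- inverse y) * inverse y ^ m) has_real_derivative
         exp (- inverse y) * inverse y ^ 2 * inverse y ^ m - exp (- inverse y) * (real m * inverse y ^ (m - Suc 0) * inverse y ^ 2)) (at y)"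
        using 1 by (auto intro!: derivative_eq_intros simp: power2_eq_square)
      then show ?thesis
        using 1 unfolding p by (simp add: flat_exp_def power_add power2_eq_square mult_ac)
    qed
    then show ?thesis
    proof (rule has_field_derivative_transform_within_open[of _ _ _ "{0<..}"])
      show "\<And>x. x \<in> {0<..} \<Longrightarrow> exp (- inverse x) * inverse x ^ m = flat_exp m x"
        by (simp add: flat_exp_def)
    qed (use 1 in auto)
  next
    case 2
    then show ?thesis using flat_exp_at_0[of m] by (simp add: DERIV_def flat_exp_def)
  next
    case 3
    have "((\<lambda>y. 0) has_real_derivative 0) (at y)" by simp
    then have "(flat_exp m has_real_derivative 0) (at y)"
      by (rule has_field_derivative_transform_within_open[of _ _ _ "{..<0}"])
        (use 3 in \<open>auto simp: flat_exp_def\<close>)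
    then show ?thesis using 3 by (simp add: flat_exp_def)
  qed
qed

text \<open>A class of expressions that contains the bump functions below and is closed under
  partial derivatives. Since its members are differentiable, closure alone makes them
  smooth.\<close>

inductive_set smooth_terms :: "sfield set" where
  const: "(\<lambda>x. c) \<in> smooth_terms"
| coord: "(\<lambda>x. x $ j) \<in> smooth_terms"
| add: "f \<in> smooth_terms \<Longrightarrow> g \<in> smooth_terms \<Longrightarrow> (\<lambda>x. f x + g x) \<in> smooth_terms"
| mult: "f \<in> smooth_terms \<Longrightarrow> g \<in> smooth_terms \<Longrightarrow> (\<lambda>x. f x * g x) \<in> smooth_terms"
| sin: "f \<in> smooth_terms \<Longrightarrow> (\<lambda>x. sin (f x)) \<in> smooth_terms"
| cos: "f \<in> smooth_terms \<Longrightarrow> (\<lambda>x. cos (f x)) \<in> smooth_terms"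
| flat: "f \<in> smooth_terms \<Longrightarrow> (\<lambda>x. flat_exp m (f x)) \<in> smooth_terms"

lemma smooth_terms_diff:
  assumes "f \<in> smooth_terms" "g \<in> smooth_terms"
  shows "(\<lambda>x. f x - g x) \<in> smooth_terms"
  using smooth_terms.add[OF assms(1) smooth_terms.mult[OF smooth_terms.const[of "-1"] assms(2)]] by simp

lemma pdx_compose:
  assumes f: "\<And>x. f differentiable (at x)" and g: "\<And>y. (g has_real_derivative g' y) (at y)"
  shows "(\<lambda>x. g (f x)) differentiable (at x)" "pdx j (\<lambda>x. g (f x)) = (\<lambda>x. g' (f x) * pdx j f x)"
proof -
  have d: "(\<lambda>x. g (f x)) differentiable (at x)" for x
    using f[of x] g[of "f x"] differentiable_chain_at[of f x g]
    by (auto simp: o_def has_field_derivative_def differentiable_def)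
  show "(\<lambda>x. g (f x)) differentiable (at x)" by (rule d)
  show "pdx j (\<lambda>x. g (f x)) = (\<lambda>x. g' (f x) * pdx j f x)"
  proof
    fix x
    have "((\<lambda>t. g (f (x + t *\<^sub>R axis j 1))) has_real_derivative g' (f (x + 0 *\<^sub>R axis j 1)) * pdx j f x) (at 0)"
      by (rule DERIV_chain2[OF g pdx_DERIV[OF f]])
    then show "pdx j (\<lambda>x. g (f x)) x = g' (f x) * pdx j f x"
      by (intro pdx_eqI d) simp
  qed
qed

lemma smooth_terms_pdx:
  assumes "f \<in> smooth_terms"
  shows "(\<forall>x. f differentiable (at x)) \<and> pdx j f \<in> smooth_terms"
  using assms
proof induction
  case (const c)
  have "pdx j (\<lambda>x. c) = (\<lambda>x. 0)" by (intro ext pdx_eqI) auto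
  then show ?case using smooth_terms.const[of 0] by simp
next
  case (coord i)
  have d: "(\<lambda>x::real^3. x $ i) differentiable (at x)" for x
    by (rule bounded_linear_imp_differentiable) (rule bounded_linear_vec_nth)
  have "pdx j (\<lambda>x. x $ i) = (\<lambda>x. axis j 1 $ i)"
    by (intro ext pdx_eqI d) (auto intro!: derivative_eq_intros)
  then show ?case using d smooth_terms.const[of "axis j 1 $ i"] by simp
next
  case (add f g)
  then have "pdx j (\<lambda>x. f x + g x) = (\<lambda>x. pdx j f x + pdx j g x)" by (intro ext pdx_add) auto
  then show ?case using add by (simp add: smooth_terms.add)
next
  case (mult f g)
  then have "pdx j (\<lambda>x. f x * g x) = (\<lambda>x. pdx j f x * g x + f x * pdx j g x)" by (intro ext pdx_mult) auto
  then show ?case using mult by (simp add: smooth_terms.add smooth_terms.mult)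
next
  case (sin f)
  have "pdx j (\<lambda>x. sin (f x)) = (\<lambda>x. cos (f x) * pdx j f x)"
    by (rule pdx_compose(2)[OF _ DERIV_sin]) (use sin in auto)
  moreover have "(\<lambda>x. sin (f x)) differentiable (at x)" for x
    by (rule pdx_compose(1)[OF _ DERIV_sin]) (use sin in auto)
  ultimately show ?case using sin by (simp add: smooth_terms.mult smooth_terms.cos)
next
  case (cos f)
  have "pdx j (\<lambda>x. cos (f x)) = (\<lambda>x. - sin (f x) * pdx j f x)"
    by (rule pdx_compose(2)[OF _ DERIV_cos]) (use cos in auto)
  moreover have "(\<lambda>x. cos (f x)) differentiable (at x)" for x
    by (rule pdx_compose(1)[OF _ DERIV_cos]) (use cos in auto)
  moreover have "(\<lambda>x. - sin (f x) * pdx j f x) \<in> smooth_terms"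
    using smooth_terms.mult[OF smooth_terms.const[of "-1"] smooth_terms.mult[OF smooth_terms.sin]] cos by simp
  ultimately show ?case by simp
next
  case (flat f m)
  have "pdx j (\<lambda>x. flat_exp m (f x)) = (\<lambda>x. (flat_exp (m + 2) (f x) - real m * flat_exp (Suc m) (f x)) * pdx j f x)"
    by (rule pdx_compose(2)[OF _ flat_exp_DERIV]) (use flat in auto)
  moreover have "(\<lambda>x. flat_exp m (f x)) differentiable (at x)" for x
    by (rule pdx_compose(1)[OF _ flat_exp_DERIV]) (use flat in auto)
  ultimately show ?case using flat
    by (simp add: smooth_terms.mult smooth_terms.flat smooth_terms.const smooth_terms_diff)
qed

lemma smooth_terms_smooth:
  assumes "f \<in> smooth_terms"
  shows "smooth_on UNIV f"
proof (rule smooth_onI)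
  fix js x
  have "foldr pdx js f \<in> smooth_terms"
    by (induction js) (use assms smooth_terms_pdx in auto)
  then show "foldr pdx js f differentiable (at x)" using smooth_terms_pdx by blast
qed

text \<open>
  Each sine changes sign under a unit shift, so their product is periodic; over a period it is positive
  exactly between the two zeros.  The shifts by \<open>1\<close> in the third factor keep the support inside the slab.
\<close>

definition box_bump :: "real^3 \<Rightarrow> real^3 \<Rightarrow> nat \<Rightarrow> sfield" where
  "box_bump a b n x =
     flat_exp 0 (real n * (sin (pi * (x$1 - a$1)) * sin (pi * (b$1 - x$1)))) *
     flat_exp 0 (real n * (sin (pi * (x$2 - a$2)) * sin (pi * (b$2 - x$2)))) *
     (flat_exp 0 (real n * (x$3 - a$3) - 1) * flat_exp 0 (real n * (b$3 - x$3) - 1))"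

lemma flat_exp_0_bounds: "0 \<le> flat_exp 0 y" "flat_exp 0 y \<le> 1"
  by (auto simp: flat_exp_def)

lemma box_bump_Cc_infty:
  assumes "0 \<le> a$3" "b$3 \<le> 1" "n > 0"
  shows "box_bump a b n \<in> Cc_infty"
proof -
  have "box_bump a b n \<in> smooth_terms"
    unfolding box_bump_def[abs_def]
    by (intro smooth_terms.intros smooth_terms_diff)
  moreover have "periodic (box_bump a b n)"
  proof -
    have sp: "sin (pi * (y + 1 - c)) = - sin (pi * (y - c))" "sin (pi * (c - (y + 1))) = - sin (pi * (c - y))" for y c :: real
      using sin_periodic_pi[of "pi * (y - c)"] sin_periodic_pi[of "pi * (c - (y + 1))"]
      by (simp_all add: algebra_simps)
    show ?thesis
      unfolding periodic_def box_bump_def by (simp add: axis_def sp)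
  qed
  moreover have "1 / real n \<le> x$3 \<and> x$3 \<le> 1 - 1 / real n" if "box_bump a b n x \<noteq> 0" for x
  proof -
    have "real n * (x$3 - a$3) - 1 > 0" "real n * (b$3 - x$3) - 1 > 0"
      using that unfolding box_bump_def flat_exp_def by (auto split: if_splits)
    then have "1 / real n < x$3 - a$3" "1 / real n < b$3 - x$3"
      using assms(3) by (simp_all add: field_simps)
    then show ?thesis using assms by linarith
  qed
  ultimately show ?thesis
    unfolding Cc_infty_def using smooth_terms_smooth assms(3)
    by (auto intro!: exI[of _ "1 / real n"])
qed

lemma flat_exp_0_tendsto:
  assumes "c > 0"
  shows "(\<lambda>n. flat_exp 0 (real n * c - d)) \<longlonglongrightarrow> 1"
proof -
  have f: "filterlim (\<lambda>n. real n * c - d) at_top sequentially" using assms by real_asymp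
  have "(\<lambda>n. exp (- inverse (real n * c - d))) \<longlonglongrightarrow> exp (- 0)"
    by (intro tendsto_intros filterlim_compose[OF tendsto_inverse_0_at_top[OF filterlim_ident] f])
  moreover have "\<forall>\<^sub>F n in sequentially. exp (- inverse (real n * c - d)) = flat_exp 0 (real n * c - d)"
    using filterlim_at_top_dense[THEN iffD1, OF f, rule_format, of 0]
    by eventually_elim (simp add: flat_exp_def)
  ultimately show ?thesis
    using Lim_transform_eventually by fastforce
qed

text \<open>Both \<open>y - a\<close> and \<open>b - y\<close> lie between -1 and 1, so each sine
  has the sign of its argument. Strictly between \<open>a\<close> and \<open>b\<close> the product
  is positive and the argument tends to infinity; elsewhere the product is at most 0 and the flat
  function is 0 for every \<open>n\<close>.\<close>

lemma flat_exp_sin_tendsto: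
  fixes y a b :: real
  assumes "0 \<le> a" "b \<le> 1" "0 \<le> y" "y < 1" "a < b"
  shows "(\<lambda>n. flat_exp 0 (real n * (sin (pi * (y - a)) * sin (pi * (b - y))))) \<longlonglongrightarrow> (if a < y \<and> y < b then 1 else 0)"
proof (cases "a < y \<and> y < b")
  case True
  then have "sin (pi * (y - a)) > 0" "sin (pi * (b - y)) > 0"
    using assms by (auto intro!: sin_gt_zero)
  then show ?thesis
    using flat_exp_0_tendsto[of "sin (pi * (y - a)) * sin (pi * (b - y))" 0] True by simp
next
  case False
  have ge: "sin (pi * t) \<ge> 0" if "0 \<le> t" "t \<le> 1" for t
    using that by (intro sin_ge_zero) auto
  have le: "sin (pi * t) \<le> 0" if "-1 \<le> t" "t \<le> 0" for t
    using ge[of "-t"] that by simp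
  have "sin (pi * (y - a)) * sin (pi * (b - y)) \<le> 0"
  proof (cases "y \<le> a")
    case True
    show ?thesis by (rule mult_nonpos_nonneg) (use True assms in \<open>auto intro!: ge le\<close>)
  next
    case False
    with \<open>\<not> (a < y \<and> y < b)\<close> have "b \<le> y" by simp
    show ?thesis by (rule mult_nonneg_nonpos) (use \<open>b \<le> y\<close> assms in \<open>auto intro!: ge le\<close>)
  qed
  then have "flat_exp 0 (real n * (sin (pi * (y - a)) * sin (pi * (b - y)))) = 0" for n
    using mult_nonneg_nonpos[of "real n" "sin (pi * (y - a)) * sin (pi * (b - y))"]
    unfolding flat_exp_def by simp
  then show ?thesis using False by (simp add: if_not_P)
qed

lemma flat_exp_linear_tendsto:
  fixes c :: real
  shows "(\<lambda>n. flat_exp 0 (real n * c - 1)) \<longlonglongrightarrow> (if c > 0 then 1 else 0)"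
proof (cases "c > 0")
  case False
  then have "flat_exp 0 (real n * c - 1) = 0" for n
    using mult_nonneg_nonpos[of "real n" c] unfolding flat_exp_def by simp
  then show ?thesis using False by simp
qed (simp add: flat_exp_0_tendsto)

lemma box_bump_tendsto:
  assumes "\<And>i. 0 \<le> a$i" "\<And>i. b$i \<le> 1" "\<And>i. a$i < b$i" "x \<in> cell"
  shows "(\<lambda>n. box_bump a b n x) \<longlonglongrightarrow> indicator (box a b) x"
proof -
  have "(\<lambda>n. box_bump a b n x) \<longlonglongrightarrow> (if a$1 < x$1 \<and> x$1 < b$1 then 1 else 0) *
      (if a$2 < x$2 \<and> x$2 < b$2 then 1 else 0) * ((if x$3 - a$3 > 0 then 1 else 0) * (if b$3 - x$3 > 0 then 1 else 0))"
    unfolding box_bump_def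
    by (intro tendsto_mult flat_exp_sin_tendsto flat_exp_linear_tendsto assms)
      (use assms(4) in \<open>simp_all add: cell_def\<close>)
  moreover have "(if a$1 < x$1 \<and> x$1 < b$1 then 1 else 0) *
      (if a$2 < x$2 \<and> x$2 < b$2 then 1 else 0) * ((if x$3 - a$3 > 0 then 1 else 0) * (if b$3 - x$3 > 0 then 1 else 0))
      = (indicator (box a b) x :: real)"
    by (auto simp: indicator_def mem_box_cart forall_3)
  ultimately show ?thesis by simp
qed

text \<open>The positive and the negative part of \<open>g\<close> are densities of two measures
  that agree on boxes. Boxes are stable under intersection and generate the Borel sets, so the
  measures coincide and the two parts agree almost everywhere.\<close>

lemma integral_boxes_zero_AE:
  fixes g :: "real^3 \<Rightarrow> real"
  assumes g [measurable]: "integrable lborel g"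
    and zero: "\<And>a b. (LINT x|lborel. g x * indicator (box a b) x) = 0"
  shows "AE x in lborel. g x = 0"
proof -
  define P where "P x = ennreal (g x)" for x
  define N where "N x = ennreal (- g x)" for x
  have [measurable]: "P \<in> borel_measurable borel" "N \<in> borel_measurable borel"
    using borel_measurable_integrable[OF g] unfolding P_def N_def by auto
  have ab: "integrable lborel (\<lambda>x. max 0 (s * g x) * indicator (box a b) x)" for s :: real and a b
  proof -
    have "integrable lborel (\<lambda>x. max 0 (s * g x))" using g by simp
    then show ?thesis using integrable_real_mult_indicator[of "box a b" lborel] by simp
  qed
  have P: "emeasure (density lborel P) (box a b) = ennreal (LINT x|lborel. max 0 (1 * g x) * indicator (box a b) x)"
    and N: "emeasure (density lborel N) (box a b) = ennreal (LINT x|lborel. max 0 (-1 * g x) * indicator (box a b) x)" for a b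
  proof -
    have "emeasure (density lborel P) (box a b) = (\<integral>\<^sup>+x. ennreal (max 0 (1 * g x) * indicator (box a b) x) \<partial>lborel)"
      by (subst emeasure_density) (auto intro!: nn_integral_cong simp: P_def indicator_def max_def ennreal_neg)
    then show "emeasure (density lborel P) (box a b) = ennreal (LINT x|lborel. max 0 (1 * g x) * indicator (box a b) x)"
      by (subst (asm) nn_integral_eq_integral[OF ab]) auto
    have "emeasure (density lborel N) (box a b) = (\<integral>\<^sup>+x. ennreal (max 0 (-1 * g x) * indicator (box a b) x) \<partial>lborel)"
      by (subst emeasure_density) (auto intro!: nn_integral_cong simp: N_def indicator_def max_def ennreal_neg)
    then show "emeasure (density lborel N) (box a b) = ennreal (LINT x|lborel. max 0 (-1 * g x) * indicator (box a b) x)"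
      by (subst (asm) nn_integral_eq_integral[OF ab]) auto
  qed
  have "density lborel P = density lborel N"
  proof (rule measure_eqI_generator_eq[where E = "range (\<lambda>(a, b). box a b)" and \<Omega> = UNIV
        and A = "\<lambda>n. box (- (real n *\<^sub>R One)) (real n *\<^sub>R One :: real^3)"])
    show "Int_stable (range (\<lambda>(a, b). box a b :: (real^3) set))"
      by (auto simp: Int_stable_def box_Int_box)
    fix X assume "X \<in> range (\<lambda>(a, b). box a b :: (real^3) set)"
    then obtain a b where X: "X = box a b" by auto
    have "(LINT x|lborel. max 0 (1 * g x) * indicator (box a b) x) - (LINT x|lborel. max 0 (-1 * g x) * indicator (box a b) x)
        = (LINT x|lborel. max 0 (1 * g x) * indicator (box a b) x - max 0 (-1 * g x) * indicator (box a b) x)"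
      by (rule Bochner_Integration.integral_diff[symmetric]) (rule ab)+
    also have "\<dots> = (LINT x|lborel. g x * indicator (box a b) x)"
      by (rule Bochner_Integration.integral_cong) (auto simp: indicator_def max_def)
    finally show "emeasure (density lborel P) X = emeasure (density lborel N) X"
      unfolding X P N zero by simp
  next
    show "sets (density lborel P) = sigma_sets UNIV (range (\<lambda>(a, b). box a b))"
      "sets (density lborel N) = sigma_sets UNIV (range (\<lambda>(a, b). box a b))"
      by (simp_all add: borel_eq_box)
    show "(\<Union>i. box (- (real i *\<^sub>R One)) (real i *\<^sub>R One)) = (UNIV :: (real^3) set)"
      by (rule UN_box_eq_UNIV)
    show "emeasure (density lborel P) (box (- (real i *\<^sub>R One)) (real i *\<^sub>R One)) \<noteq> \<infinity>" for i
      unfolding P by simp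
  qed auto
  then have "AE x in lborel. P x = N x"
    by (subst (asm) sigma_finite_measure.density_unique_iff[OF sigma_finite_lborel]) auto
  then show ?thesis
  proof eventually_elim
    case (elim x)
    show ?case
    proof (cases "g x \<le> 0")
      case True
      then have "ennreal (- g x) = 0" using elim by (simp only: P_def N_def ennreal_neg)
      then show ?thesis using True by (simp only: ennreal_eq_0_iff)
    next
      case False
      then have "ennreal (g x) = 0" using elim ennreal_neg[of "- g x"] by (simp add: P_def N_def)
      then show ?thesis using False by (simp only: ennreal_eq_0_iff)
    qed
  qed
qed

text \<open>The bump functions stay between 0 and 1 and converge on the cell to the indicator of a
  box, so \<open>g\<close> has integral 0 over every box in the unit cube. Extension by 0 then
  reduces the claim to the statement about boxes in the whole space.\<close>

lemma fundamental_lemma: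
  assumes g: "integrable (lebesgue_on cell) g"
    and zero: "\<And>\<phi>. \<phi> \<in> Cc_infty \<Longrightarrow> (LINT x|lebesgue_on cell. g x * \<phi> x) = 0"
  shows "AE x in lebesgue_on cell. g x = 0"
proof -
  have box0: "(LINT x|lebesgue_on cell. g x * indicator (box a b) x) = 0"
    if ab: "\<And>i. 0 \<le> a$i" "\<And>i. b$i \<le> 1" "\<And>i. a$i < b$i" for a b
  proof -
    have "(\<lambda>n. LINT x|lebesgue_on cell. g x * box_bump a b (Suc n) x) \<longlonglongrightarrow>
        (LINT x|lebesgue_on cell. g x * indicator (box a b) x)"
    proof (rule integral_dominated_convergence[where w = "\<lambda>x. \<bar>g x\<bar>"])
      show "(\<lambda>x. g x * indicator (box a b) x) \<in> borel_measurable (lebesgue_on cell)"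
        by (intro borel_measurable_times borel_measurable_integrable[OF g] borel_imp_lebesgue_on) auto
      show "(\<lambda>x. g x * box_bump a b (Suc n) x) \<in> borel_measurable (lebesgue_on cell)" for n
        using g box_bump_Cc_infty[of a b "Suc n"] ab
        by (intro borel_measurable_times borel_measurable_integrable[OF g] borel_imp_lebesgue_on Cc_infty_measurable) auto
      show "integrable (lebesgue_on cell) (\<lambda>x. \<bar>g x\<bar>)" using g by simp
      show "AE x in lebesgue_on cell. (\<lambda>n. g x * box_bump a b (Suc n) x) \<longlonglongrightarrow> g x * indicator (box a b) x"
        using box_bump_tendsto[OF ab] by (intro AE_I2 tendsto_mult tendsto_const LIMSEQ_Suc) (simp add: space_restrict_space)
      show "AE x in lebesgue_on cell. norm (g x * box_bump a b (Suc n) x) \<le> \<bar>g x\<bar>" for n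
      proof (rule AE_I2)
        fix x
        have "0 \<le> box_bump a b (Suc n) x \<and> box_bump a b (Suc n) x \<le> 1"
          unfolding box_bump_def by (intro conjI mult_nonneg_nonneg mult_le_one flat_exp_0_bounds)
        then show "norm (g x * box_bump a b (Suc n) x) \<le> \<bar>g x\<bar>"
          by (simp add: abs_mult mult_left_le)
      qed
    qed
    moreover have "(LINT x|lebesgue_on cell. g x * box_bump a b (Suc n) x) = 0" for n
      by (intro zero box_bump_Cc_infty ab) auto
    ultimately show ?thesis using LIMSEQ_unique[of "\<lambda>n. 0" 0] by simp
  qed
  have gl: "integrable lebesgue (\<lambda>x. indicator cell x * g x)"
    using g integrable_restrict_space[of cell lebesgue g] by simp
  \<comment> \<open>\<open>g\<close> is only Lebesgue measurable; the argument with boxes needs a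
    Borel representative.\<close>
  obtain g' where g' [measurable]: "g' \<in> borel_measurable lborel" and eq: "AE x in lborel. indicator cell x * g x = g' x"
    using completion_ex_borel_measurable_real[OF borel_measurable_integrable[OF gl]] by auto
  have eql: "AE x in lebesgue. indicator cell x * g x = g' x" using eq by (rule AE_completion)
  have g'_meas: "g' \<in> borel_measurable lebesgue" using g' by (rule measurable_completion)
  have "integrable lebesgue g'"
    using gl by (rule integrable_cong_AE_imp) (use g'_meas eql in \<open>auto elim!: eventually_mono\<close>)
  then have g'_int: "integrable lborel g'" by (subst (asm) integrable_completion) (rule g')
  have "AE x in lborel. g' x = 0"
  proof (rule integral_boxes_zero_AE[OF g'_int])
    fix c d :: "real^3"
    define a :: "real^3" where "a = (\<chi> i. max 0 (c$i))"
    define b :: "real^3" where "b = (\<chi> i. min 1 (d$i))"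
    have "(LINT x|lborel. g' x * indicator (box c d) x) = (LINT x|lebesgue. g' x * indicator (box c d) x)"
      by (rule integral_completion[symmetric]) measurable
    also have "\<dots> = (LINT x|lebesgue. indicator cell x * (g x * indicator (box a b) x))"
    proof (rule integral_cong_AE)
      \<comment> \<open>The cell contains its faces \<open>x$1 = 0\<close> and
        \<open>x$2 = 0\<close>, while the box clipped to the unit cube is open and misses them.
        These faces are null sets.\<close>
      have hyp: "AE x in lebesgue. (x::real^3)$i \<noteq> 0" for i
      proof -
        have "negligible {x::real^3. axis i 1 \<bullet> x = 0}" by (rule negligible_hyperplane) auto
        then have "{x::real^3. x$i = 0} \<in> null_sets lebesgue"
          by (simp add: negligible_iff_null_sets inner_axis')
        then show ?thesis by (rule AE_I') auto
      qed
      show "AE x in lebesgue. g' x * indicator (box c d) x = indicator cell x * (g x * indicator (box a b) x)"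
        using eql hyp[of 1] hyp[of 2]
      proof eventually_elim
        case (elim x)
        have "x \<in> cell \<Longrightarrow> x \<in> box c d \<longleftrightarrow> x \<in> box a b"
          using elim(2,3) by (auto simp: cell_def mem_box_cart forall_3 a_def b_def)
        then show ?case using elim(1)[symmetric] by (auto simp: indicator_def)
      qed
      show "(\<lambda>x. g' x * indicator (box c d) x) \<in> borel_measurable lebesgue"
        by (intro borel_measurable_times g'_meas borel_measurable_indicator) auto
      have "(\<lambda>x. indicator cell x * g x * indicator (box a b) x) \<in> borel_measurable lebesgue"
        by (intro borel_measurable_times[OF borel_measurable_integrable[OF gl]] borel_measurable_indicator) auto
      then show "(\<lambda>x. indicator cell x * (g x * indicator (box a b) x)) \<in> borel_measurable lebesgue"
        by (simp add: mult.assoc)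
    qed
    also have "\<dots> = (LINT x|lebesgue_on cell. g x * indicator (box a b) x)"
      using integral_restrict_space[of cell lebesgue "\<lambda>x. g x * indicator (box a b) x"] by simp
    also have "\<dots> = 0"
    proof (cases "\<forall>i. a$i < b$i")
      case True
      then show ?thesis by (intro box0) (auto simp: a_def b_def)
    next
      case False
      then have "box a b = {}" by (auto simp: interval_eq_empty_cart not_less)
      then show ?thesis by simp
    qed
    finally show "(LINT x|lborel. g' x * indicator (box c d) x) = 0" .
  qed
  then have "AE x in lebesgue. g' x = 0" by (rule AE_completion)
  with eql have "AE x in lebesgue. x \<in> cell \<longrightarrow> g x = 0"
    by eventually_elim (auto simp: indicator_def split: if_splits)
  then show ?thesis by (simp add: AE_restrict_space_iff)
qed

lemma weak_deriv_unique:
  assumes "g \<in> L2" "g' \<in> L2" "weak_deriv \<alpha> f g" "weak_deriv \<alpha> f g'"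
  shows "AE x in lebesgue_on cell. g x = g' x"
proof -
  have "AE x in lebesgue_on cell. g x - g' x = 0"
  proof (rule fundamental_lemma)
    show "integrable (lebesgue_on cell) (\<lambda>x. g x - g' x)" using L2_integrable assms by auto
    fix \<phi> assume \<phi>: "\<phi> \<in> Cc_infty"
    have "(-1) ^ mi_order \<alpha> * (LINT x|lebesgue_on cell. g x * \<phi> x) = (-1) ^ mi_order \<alpha> * (LINT x|lebesgue_on cell. g' x * \<phi> x)"
      using bspec[OF assms(3)[unfolded weak_deriv_def] \<phi>] bspec[OF assms(4)[unfolded weak_deriv_def] \<phi>] by simp
    then have "(LINT x|lebesgue_on cell. g x * \<phi> x) = (LINT x|lebesgue_on cell. g' x * \<phi> x)" by simp
    then show "(LINT x|lebesgue_on cell. (g x - g' x) * \<phi> x) = 0"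
      using Cc_infty_mult_integrable[OF \<phi> L2_integrable] assms by (simp add: left_diff_distrib)
  qed
  then show ?thesis by eventually_elim simp
qed

section \<open>The Slobodeckij form\<close>

lemma L2_mult_integrable:
  assumes "f \<in> L2" "g \<in> L2"
  shows "integrable (lebesgue_on cell) (\<lambda>x. f x * g x)"
proof -
  have "integrable (lebesgue_on cell) (\<lambda>x. (f x)\<^sup>2 + (g x)\<^sup>2)" using assms by (auto simp: L2_def)
  then show ?thesis
  proof (rule Bochner_Integration.integrable_bound)
    show "(\<lambda>x. f x * g x) \<in> borel_measurable (lebesgue_on cell)" using assms by (auto simp: L2_def)
    have "\<bar>a * b\<bar> \<le> a\<^sup>2 + b\<^sup>2" for a b :: real
      using sum_squares_bound[of a b] sum_squares_bound[of a "-b"] by (simp add: abs_le_iff)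
    then show "AE x in lebesgue_on cell. norm (f x * g x) \<le> norm ((f x)\<^sup>2 + (g x)\<^sup>2)" by simp
  qed
qed

lemma L2_add:
  assumes "f \<in> L2" "g \<in> L2"
  shows "(\<lambda>x. f x + g x) \<in> L2"
proof -
  have "integrable (lebesgue_on cell) (\<lambda>x. (f x)\<^sup>2 + 2 * (f x * g x) + (g x)\<^sup>2)"
    using assms L2_mult_integrable[OF assms] by (auto simp: L2_def)
  then have "integrable (lebesgue_on cell) (\<lambda>x. (f x + g x)\<^sup>2)"
    by (simp add: power2_sum mult.assoc add.commute add.left_commute)
  then show ?thesis using assms by (auto simp: L2_def)
qed

lemma L2_scale: "f \<in> L2 \<Longrightarrow> (\<lambda>x. c * f x) \<in> L2"
  by (auto simp: L2_def power_mult_distrib)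

lemma wderiv_L2: "g \<in> L2 \<Longrightarrow> weak_deriv \<alpha> f g \<Longrightarrow> wderiv \<alpha> f \<in> L2"
  and wderiv_weak_deriv: "g \<in> L2 \<Longrightarrow> weak_deriv \<alpha> f g \<Longrightarrow> weak_deriv \<alpha> f (wderiv \<alpha> f)"
  using someI[of "\<lambda>g. g \<in> L2 \<and> weak_deriv \<alpha> f g" g] by (auto simp: wderiv_def)

lemma wderiv_AE_eq:
  assumes "g \<in> L2" "weak_deriv \<alpha> f g"
  shows "AE x in lebesgue_on cell. wderiv \<alpha> f x = g x"
  by (rule weak_deriv_unique[OF wderiv_L2[OF assms] assms(1) wderiv_weak_deriv[OF assms] assms(2)])

lemma AE_fst_snd_lborel:
  assumes "AE x in lborel. P (x :: real^3)"
  shows "AE z in lborel. P (fst (z :: (real^3) \<times> (real^3)))" "AE z in lborel. P (snd (z :: (real^3) \<times> (real^3)))"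
proof -
  obtain N where N: "N \<in> null_sets lborel" "{x. \<not> P x} \<subseteq> N"
    using assms unfolding eventually_ae_filter by auto
  have e: "emeasure lborel (A \<times> B) = emeasure lborel A * emeasure lborel B"
    if "A \<in> sets borel" "B \<in> sets borel" for A B :: "(real^3) set"
    unfolding lborel_prod[symmetric] using that by (intro lborel.emeasure_pair_measure_Times) auto
  have Nb: "N \<in> sets borel" "emeasure lborel N = 0" using N(1) null_setsD2[OF N(1)] null_setsD1[OF N(1)] by auto
  have n: "N \<times> (UNIV :: (real^3) set) \<in> null_sets lborel" "(UNIV :: (real^3) set) \<times> N \<in> null_sets lborel"
    using e[of N UNIV] e[of UNIV N] Nb by (auto intro!: null_setsI borel_Times)
  show "AE z in lborel. P (fst (z :: (real^3) \<times> (real^3)))"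
    by (rule AE_I'[OF n(1)]) (use N(2) in auto)
  show "AE z in lborel. P (snd (z :: (real^3) \<times> (real^3)))"
    by (rule AE_I'[OF n(2)]) (use N(2) in auto)
qed

lemma AE_fst_snd_cell:
  assumes "AE x in lebesgue_on cell. P x"
  shows "AE z in lebesgue_on (cell \<times> cell). P (fst z) \<and> P (snd z)"
proof -
  have "AE x in lebesgue. x \<in> cell \<longrightarrow> P x" using assms by (simp add: AE_restrict_space_iff)
  then have *: "AE x in lborel. x \<in> cell \<longrightarrow> P x" by (simp add: AE_completion_iff)
  have "AE z in lborel. (fst z \<in> cell \<longrightarrow> P (fst z)) \<and> (snd z \<in> cell \<longrightarrow> P (snd z))"
    using AE_fst_snd_lborel[OF *] by eventually_elim blast
  then have "AE z in lebesgue. (fst z \<in> cell \<longrightarrow> P (fst z)) \<and> (snd z \<in> cell \<longrightarrow> P (snd z))"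
    by (rule AE_completion)
  then have "AE z in lebesgue. z \<in> cell \<times> cell \<longrightarrow> P (fst z) \<and> P (snd z)"
    by eventually_elim auto
  moreover have "cell \<times> cell \<in> sets lebesgue" by (intro sets_completionI_sets) (simp add: borel_Times)
  ultimately show ?thesis by (subst AE_restrict_space_iff) auto
qed

text \<open>Weak derivatives are only Lebesgue measurable, so the projections must be measurable
  between the completed measures. Besides Borel measurability this requires preimages of null sets
  to be null.\<close>

lemma fst_snd_measurable_cell:
  "fst \<in> lebesgue_on (cell \<times> cell) \<rightarrow>\<^sub>M lebesgue_on cell"
  "snd \<in> lebesgue_on (cell \<times> cell) \<rightarrow>\<^sub>M lebesgue_on cell"
proof -
  have *: "p \<in> lebesgue_on (cell \<times> cell) \<rightarrow>\<^sub>M lebesgue_on cell"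
    if p: "p \<in> borel_measurable borel" "p \<in> cell \<times> cell \<rightarrow> cell"
      and ae: "\<And>P. AE x in lborel. P x \<Longrightarrow> AE z in lborel. P (p z)"
    for p :: "(real^3) \<times> (real^3) \<Rightarrow> real^3"
  proof (rule measurable_restrict_space3[OF _ p(2)])
    show "p \<in> lebesgue \<rightarrow>\<^sub>M lebesgue"
    proof (rule completion.measurable_completion2)
      show m: "p \<in> lebesgue \<rightarrow>\<^sub>M lborel" using p(1) by (simp add: measurable_completion)
      show "null_sets lborel \<subseteq> null_sets (distr lebesgue lborel p)"
      proof
        fix N :: "(real^3) set" assume N: "N \<in> null_sets lborel"
        then have "AE z in lebesgue. p z \<notin> N" by (intro AE_completion ae AE_not_in)
        then have "p -` N \<in> null_sets lebesgue" by (simp add: completion.AE_iff_null_sets vimage_def)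
        then show "N \<in> null_sets (distr lebesgue lborel p)" using null_setsD2[OF N] m by (simp add: null_sets_distr_iff)
      qed
    qed
  qed
  show "fst \<in> lebesgue_on (cell \<times> cell) \<rightarrow>\<^sub>M lebesgue_on cell"
    by (rule *) (auto intro!: borel_measurable_continuous_onI continuous_intros AE_fst_snd_lborel)
  show "snd \<in> lebesgue_on (cell \<times> cell) \<rightarrow>\<^sub>M lebesgue_on cell"
    by (rule *) (auto intro!: borel_measurable_continuous_onI continuous_intros AE_fst_snd_lborel)
qed

section \<open>The torus distance and integrability near the diagonal\<close>

lemma torus_dist_bdd_below:
  fixes x y :: "real^3"
  shows "bdd_below ((\<lambda>(i, j). norm (x - y + of_int i *\<^sub>R axis 1 1 + of_int j *\<^sub>R axis 2 1)) ` (UNIV :: (int \<times> int) set))"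
  by (rule bdd_belowI[of _ 0]) auto

lemma torus_dist_nonneg: "0 \<le> torus_dist x y"
  unfolding torus_dist_def by (rule cINF_greatest) auto

lemma torus_dist_measurable [measurable]:
  "(\<lambda>z. torus_dist (fst z) (snd z)) \<in> borel_measurable borel"
proof -
  have "(\<lambda>z::(real^3)\<times>(real^3). INF p\<in>(UNIV :: (int \<times> int) set). norm (fst z - snd z + of_int (fst p) *\<^sub>R axis 1 1 + of_int (snd p) *\<^sub>R axis 2 1)) \<in> borel_measurable borel"
  proof (rule borel_measurable_cINF)
    show "countable (UNIV :: (int \<times> int) set)" by simp
    show "(\<lambda>z::(real^3)\<times>(real^3). norm (fst z - snd z + of_int (fst p) *\<^sub>R axis 1 1 + of_int (snd p) *\<^sub>R axis 2 1)) \<in> borel_measurable borel" for p :: "int \<times> int"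
      by (intro borel_measurable_continuous_onI continuous_intros)
    show "bdd_below ((\<lambda>p. norm (fst z - snd z + of_int (fst p) *\<^sub>R axis 1 1 + of_int (snd p) *\<^sub>R axis 2 1)) ` (UNIV :: (int \<times> int) set))" for z :: "(real^3)\<times>(real^3)"
      by (rule bdd_belowI[of _ 0]) auto
  qed
  then show ?thesis unfolding torus_dist_def by (simp add: case_prod_beta)
qed

lemma slob_measurable:
  assumes "g \<in> borel_measurable (lebesgue_on cell)" "h \<in> borel_measurable (lebesgue_on cell)"
  shows "slob_integrand \<sigma> g h \<in> borel_measurable (lebesgue_on (cell \<times> cell))"
proof -
  note m = measurable_compose[OF fst_snd_measurable_cell(1)] measurable_compose[OF fst_snd_measurable_cell(2)]
  have "(\<lambda>z. torus_dist (fst z) (snd z)) \<in> borel_measurable (lebesgue_on (cell \<times> cell))"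
    by (intro measurable_restrict_space1 measurable_completion) simp
  then show ?thesis
    unfolding slob_integrand_def case_prod_beta
    by (intro borel_measurable_divide borel_measurable_times borel_measurable_diff powr_real_measurable m assms) auto
qed

lemma slob_add_left: "slob_integrand \<sigma> (\<lambda>x. a x + b x) h z = slob_integrand \<sigma> a h z + slob_integrand \<sigma> b h z"
  by (simp add: slob_integrand_def case_prod_beta add_divide_distrib[symmetric] algebra_simps)

lemma slob_scale_left: "slob_integrand \<sigma> (\<lambda>x. c * a x) h z = c * slob_integrand \<sigma> a h z"
  by (simp add: slob_integrand_def case_prod_beta algebra_simps)

lemma slob_commute: "slob_integrand \<sigma> g h = slob_integrand \<sigma> h g"
  by (simp add: slob_integrand_def mult.commute)

lemma slob_nonneg: "0 \<le> slob_integrand \<sigma> g g z"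
  by (simp add: slob_integrand_def case_prod_beta)

text \<open>Changing a function on a null set \<open>N\<close> alters the integrand only where one
  of the two points lies in \<open>N\<close>, which is again a null set.\<close>

lemma slob_cong_AE:
  assumes "AE x in lebesgue_on cell. g x = g' x" "AE x in lebesgue_on cell. h x = h' x"
  shows "AE z in lebesgue_on (cell \<times> cell). slob_integrand \<sigma> g h z = slob_integrand \<sigma> g' h' z"
  using AE_fst_snd_cell[OF assms(1)] AE_fst_snd_cell[OF assms(2)]
  by eventually_elim (simp add: slob_integrand_def case_prod_beta)

lemma slob_integrable_mult:
  assumes "g \<in> L2" "h \<in> L2"
    and "integrable (lebesgue_on (cell \<times> cell)) (slob_integrand \<sigma> g g)"
    and "integrable (lebesgue_on (cell \<times> cell)) (slob_integrand \<sigma> h h)"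
  shows "integrable (lebesgue_on (cell \<times> cell)) (slob_integrand \<sigma> g h)"
proof -
  have "integrable (lebesgue_on (cell \<times> cell)) (\<lambda>z. slob_integrand \<sigma> g g z + slob_integrand \<sigma> h h z)"
    using assms by simp
  then show ?thesis
  proof (rule Bochner_Integration.integrable_bound)
    show "slob_integrand \<sigma> g h \<in> borel_measurable (lebesgue_on (cell \<times> cell))"
      using assms by (intro slob_measurable) (auto simp: L2_def)
    \<comment> \<open>The case \<open>c = 0\<close>, met where the torus distance is 0, is covered
      because quotients by 0 are 0.\<close>
    have *: "norm (a * b / c) \<le> norm (a * a / c + b * b / c)" if "c \<ge> 0" for a b c :: real
    proof -
      have "\<bar>a * b\<bar> \<le> a * a + b * b"
        using sum_squares_bound[of a b] sum_squares_bound[of a "-b"] by (simp add: abs_le_iff power2_eq_square)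
      then have "\<bar>a * b\<bar> / c \<le> (a * a + b * b) / c" using that by (rule divide_right_mono)
      then show ?thesis using that by (simp add: add_divide_distrib abs_divide)
    qed
    show "AE z in lebesgue_on (cell \<times> cell). norm (slob_integrand \<sigma> g h z) \<le> norm (slob_integrand \<sigma> g g z + slob_integrand \<sigma> h h z)"
      unfolding slob_integrand_def case_prod_beta by (intro AE_I2 *) simp
  qed
qed

text \<open>One goes from \<open>y\<close> to \<open>x\<close> along the three coordinate
  directions, where the partial derivatives bound the increments.\<close>

lemma Cc_infty_Lipschitz:
  assumes \<phi>: "\<phi> \<in> Cc_infty"
  shows "\<exists>C>0. \<forall>x y. \<bar>\<phi> x - \<phi> y\<bar> \<le> C * norm (x - y)"
proof -
  have "\<exists>B>0. \<forall>x. \<bar>pdx j \<phi> x\<bar> \<le> B" for j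
    by (rule Cc_infty_bounded[OF Cc_infty_pdx[OF \<phi>]])
  then obtain B where B: "\<And>j. B j > 0" "\<And>j x. \<bar>pdx j \<phi> x\<bar> \<le> B j" by metis
  have "\<bar>\<phi> x - \<phi> y\<bar> \<le> (B 1 + B 2 + B 3) * norm (x - y)" for x y
  proof -
    define h where "h = x - y"
    define y1 where "y1 = y + h$1 *\<^sub>R axis 1 1"
    define y2 where "y2 = y1 + h$2 *\<^sub>R axis 2 1"
    have x: "x = y2 + h$3 *\<^sub>R axis 3 1"
      by (simp add: y1_def y2_def h_def vec_eq_iff forall_3 axis_def)
    have s: "\<bar>\<phi> (w + h$j *\<^sub>R axis j 1) - \<phi> w\<bar> \<le> B j * norm h" for w j
      using Cc_infty_Lipschitz_axis[OF \<phi> B(2)[of j], of w "h$j"] component_le_norm_cart[of h j] B(1)[of j]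
      by (meson less_imp_le mult_left_mono order_trans)
    show ?thesis
      using s[of y 1, folded y1_def] s[of y1 2, folded y2_def] s[of y2 3, folded x]
      unfolding distrib_right h_def[symmetric] by linarith
  qed
  moreover have "B 1 + B 2 + B 3 > 0" using B(1) by (simp add: add_pos_pos)
  ultimately show ?thesis by blast
qed

text \<open>Periodicity gives the Euclidean bound for every integer translate of \<open>x\<close>,
  hence for the infimum over all of them.\<close>

lemma Cc_infty_Lipschitz_torus:
  assumes \<phi>: "\<phi> \<in> Cc_infty"
  shows "\<exists>C>0. \<forall>x y. \<bar>\<phi> x - \<phi> y\<bar> \<le> C * torus_dist x y"
proof -
  obtain C where C: "C > 0" "\<And>x y. \<bar>\<phi> x - \<phi> y\<bar> \<le> C * norm (x - y)"
    using Cc_infty_Lipschitz[OF \<phi>] by blast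
  have "\<bar>\<phi> x - \<phi> y\<bar> / C \<le> torus_dist x y" for x y
    unfolding torus_dist_def
  proof (rule cINF_greatest)
    fix p :: "int \<times> int"
    obtain i j where p: "p = (i, j)" by (cases p)
    have "\<phi> (x + of_int i *\<^sub>R axis 1 1 + of_int j *\<^sub>R axis 2 1) = \<phi> x"
      using periodic_shift_int[OF Cc_inftyD(2)[OF \<phi>]] by simp
    then have "\<bar>\<phi> x - \<phi> y\<bar> \<le> C * norm (x + of_int i *\<^sub>R axis 1 1 + of_int j *\<^sub>R axis 2 1 - y)"
      using C(2)[of "x + of_int i *\<^sub>R axis 1 1 + of_int j *\<^sub>R axis 2 1" y] by simp
    then show "\<bar>\<phi> x - \<phi> y\<bar> / C \<le> (case p of (i, j) \<Rightarrow> norm (x - y + of_int i *\<^sub>R axis 1 1 + of_int j *\<^sub>R axis 2 1))"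
      using C(1) by (simp add: p divide_le_eq mult.commute algebra_simps)
  qed simp
  then show ?thesis using C(1) by (intro exI[of _ C]) (simp add: divide_le_eq mult.commute)
qed

text \<open>For points of the cell the first two components differ by less than 1, so with
  \<open>r \<le> 1\<close> only translations by -1, 0 or 1 in each periodic direction can bring them
  closer than \<open>r\<close>. For each of these translations and fixed second point, the first
  point ranges in a ball of volume proportional to \<open>r ^ 3\<close>.\<close>

lemma emeasure_near_diagonal:
  "\<exists>K<\<infinity>. \<forall>r. 0 < r \<and> r \<le> 1 \<longrightarrow>
     emeasure lborel {z \<in> cell \<times> cell. torus_dist (fst z) (snd z) < r} \<le> K * ennreal (r ^ 3)"
proof -
  define v :: real where "v = unit_ball_vol 3"
  define I :: "(int \<times> int) set" where "I = {-1..1} \<times> {-1..1}"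
  define K where "K = of_nat (card I) * (ennreal v * emeasure lborel cell)"
  have "emeasure lborel cell < \<infinity>" using emeasure_cell by simp
  then have K: "K < \<infinity>" unfolding K_def by (simp add: ennreal_mult_less_top ennreal_of_nat_eq_real_of_nat)
  define E where "E p r = {z :: (real^3) \<times> (real^3). snd z \<in> cell \<and>
      norm (fst z - snd z + of_int (fst p) *\<^sub>R axis 1 1 + of_int (snd p) *\<^sub>R axis 2 1) < r}" for p :: "int \<times> int" and r
  have E_meas: "E p r \<in> sets borel" for p r
  proof -
    have "snd -` cell \<inter> space borel \<in> sets (borel :: ((real^3) \<times> (real^3)) measure)"
      by (rule measurable_sets[of _ _ borel]) (auto intro!: borel_measurable_continuous_onI continuous_intros)
    moreover have "open {z :: (real^3) \<times> (real^3). norm (fst z - snd z + of_int (fst p) *\<^sub>R axis 1 1 + of_int (snd p) *\<^sub>R axis 2 1) < r}"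
      by (intro open_Collect_less continuous_intros)
    ultimately have "(snd -` cell \<inter> space borel) \<inter> {z :: (real^3) \<times> (real^3). norm (fst z - snd z + of_int (fst p) *\<^sub>R axis 1 1 + of_int (snd p) *\<^sub>R axis 2 1) < r} \<in> sets borel"
      by (intro sets.Int) auto
    then show ?thesis by (simp add: E_def vimage_def Int_def)
  qed
  have E_le: "emeasure lborel (E p r) = ennreal v * emeasure lborel cell * ennreal (r ^ 3)" if r: "r > 0" for p r
  proof -
    let ?c = "of_int (fst p) *\<^sub>R axis 1 1 + of_int (snd p) *\<^sub>R axis 2 1 :: real^3"
    have "emeasure lborel (E p r) = emeasure (lborel \<Otimes>\<^sub>M lborel) (E p r)" by (simp add: lborel_prod)
    also have "\<dots> = (\<integral>\<^sup>+y. emeasure lborel ((\<lambda>x. (x, y)) -` E p r) \<partial>lborel)"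
      using E_meas[of p r] by (intro lborel_pair.emeasure_pair_measure_alt2) (simp only: lborel_prod sets_lborel)
    also have "\<dots> = (\<integral>\<^sup>+y. ennreal v * ennreal (r ^ 3) * indicator cell y \<partial>lborel)"
    proof (rule nn_integral_cong)
      fix y :: "real^3"
      have "(\<lambda>x. (x, y)) -` E p r = (if y \<in> cell then ball (y - ?c) r else {})"
        by (auto simp: E_def dist_norm norm_minus_commute algebra_simps)
      moreover have "emeasure lborel (ball (y - ?c) r) = ennreal v * ennreal (r ^ 3)"
        using emeasure_ball[of r "y - ?c"] r by (simp add: v_def ennreal_mult)
      ultimately show "emeasure lborel ((\<lambda>x. (x, y)) -` E p r) = ennreal v * ennreal (r ^ 3) * indicator cell y"
        by (simp add: indicator_def)
    qed
    also have "\<dots> = ennreal v * ennreal (r ^ 3) * emeasure lborel cell"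
      by (rule nn_integral_cmult_indicator) simp
    finally show ?thesis by (simp add: mult_ac)
  qed
  have "emeasure lborel {z \<in> cell \<times> cell. torus_dist (fst z) (snd z) < r} \<le> K * ennreal (r ^ 3)"
    if r: "0 < r" "r \<le> 1" for r
  proof -
    have "{z \<in> cell \<times> cell. torus_dist (fst z) (snd z) < r} \<subseteq> (\<Union>p\<in>I. E p r)"
    proof
      fix z assume z: "z \<in> {z \<in> cell \<times> cell. torus_dist (fst z) (snd z) < r}"
      obtain x y where xy: "z = (x, y)" by (cases z)
      have "torus_dist x y < r" and cell: "x \<in> cell" "y \<in> cell" using z xy by auto
      then obtain i j where ij: "norm (x - y + of_int i *\<^sub>R axis 1 1 + of_int j *\<^sub>R axis 2 1) < r"
        unfolding torus_dist_def using cINF_less_iff[OF _ torus_dist_bdd_below] by (auto simp: case_prod_beta)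
      let ?d = "x - y + of_int i *\<^sub>R axis 1 1 + of_int j *\<^sub>R axis 2 1"
      have "\<bar>?d $ 1\<bar> < 1" "\<bar>?d $ 2\<bar> < 1"
        using component_le_norm_cart[of ?d 1] component_le_norm_cart[of ?d 2] ij r by linarith+
      then have "\<bar>x$1 - y$1 + of_int i\<bar> < 1" "\<bar>x$2 - y$2 + of_int j\<bar> < 1"
        by (simp_all add: axis_def)
      moreover have "\<bar>x$1 - y$1\<bar> < 1" "\<bar>x$2 - y$2\<bar> < 1" using cell by (auto simp: cell_def)
      ultimately have "\<bar>real_of_int i\<bar> < 2" "\<bar>real_of_int j\<bar> < 2" by linarith+
      then have "(i, j) \<in> I" unfolding I_def by auto
      moreover have "z \<in> E (i, j) r" using cell ij by (simp add: E_def xy)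
      ultimately show "z \<in> (\<Union>p\<in>I. E p r)" by blast
    qed
    then have "emeasure lborel {z \<in> cell \<times> cell. torus_dist (fst z) (snd z) < r} \<le> emeasure lborel (\<Union>p\<in>I. E p r)"
      using E_meas by (intro emeasure_mono) (auto simp: I_def)
    also have "\<dots> \<le> (\<Sum>p\<in>I. emeasure lborel (E p r))"
      using E_meas by (intro emeasure_subadditive_finite) (auto simp: I_def)
    also have "\<dots> = K * ennreal (r ^ 3)"
      by (simp add: E_le r K_def mult.assoc)
    finally show ?thesis .
  qed
  with K show ?thesis by blast
qed

text \<open>Where the distance is between \<open>(1/2) ^ Suc n\<close> and \<open>(1/2) ^ n\<close>,
  the integrand is at most \<open>a ^ Suc n\<close> with \<open>a = 2 powr s\<close>, while the
  measure of \<open>A n\<close> is at most a multiple of \<open>(1/8) ^ n\<close>. The resulting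
  geometric series has ratio \<open>a / 8\<close>, which is below 1 exactly because
  \<open>s < 3\<close>.\<close>

lemma torus_dist_powr_integral:
  assumes s: "0 \<le> s" "s < 3"
  shows "(\<integral>\<^sup>+z. ennreal (torus_dist (fst z) (snd z) powr (- s)) * indicator (cell \<times> cell) z \<partial>lborel) < \<infinity>"
proof -
  obtain K where K: "K < \<infinity>" "\<And>r. 0 < r \<Longrightarrow> r \<le> 1 \<Longrightarrow>
     emeasure lborel {z \<in> cell \<times> cell. torus_dist (fst z) (snd z) < r} \<le> K * ennreal (r ^ 3)"
    using emeasure_near_diagonal by blast
  define a where "a = 2 powr s"
  have a: "0 < a" "a < 8"
  proof -
    have "2 powr s < 2 powr (3::real)" using s by (intro powr_less_mono) auto
    then show "a < 8" by (simp add: a_def)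
  qed (simp add: a_def)
  define A where "A n = {z \<in> cell \<times> cell. torus_dist (fst z) (snd z) < (1/2) ^ n}" for n
  have cc: "cell \<times> cell \<in> sets borel" by (simp add: borel_Times)
  have A_meas: "A n \<in> sets borel" for n
  proof -
    have "(\<lambda>z. torus_dist (fst z) (snd z)) -` {..<(1/2)^n} \<inter> space borel \<in> sets borel"
      by (rule measurable_sets[OF torus_dist_measurable]) simp
    then have "(cell \<times> cell) \<inter> ((\<lambda>z. torus_dist (fst z) (snd z)) -` {..<(1/2)^n} \<inter> space borel) \<in> sets borel"
      using cc by (rule sets.Int[rotated])
    then show ?thesis by (simp add: A_def vimage_def Int_def)
  qed
  \<comment> \<open>dyadic decomposition of the neighbourhood of the diagonal\<close>
  have bound: "ennreal (torus_dist (fst z) (snd z) powr (- s)) * indicator (cell \<times> cell) z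
      \<le> indicator (cell \<times> cell) z + (\<Sum>n. ennreal (a ^ Suc n) * indicator (A n) z)" for z
  proof (cases "z \<in> cell \<times> cell \<and> torus_dist (fst z) (snd z) \<noteq> 0")
    case True
    define d where "d = torus_dist (fst z) (snd z)"
    have d: "d > 0" using True torus_dist_nonneg[of "fst z" "snd z"] by (simp add: d_def)
    show ?thesis
    proof (cases "d \<ge> 1")
      case True
      then have "d powr (- s) \<le> 1 powr (- s)" using s by (intro powr_mono2') auto
      then have "ennreal (d powr (- s)) \<le> 1" by simp
      then have "ennreal (d powr (- s)) * indicator (cell \<times> cell) z \<le> 1 * indicator (cell \<times> cell) z"
        by (rule mult_right_mono) simp
      then show ?thesis unfolding d_def[symmetric]
        by (simp add: add_increasing2)
    next
      case False
      have "\<exists>n. (1/2) ^ Suc n \<le> d"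
      proof -
        obtain n where "(1/2) ^ n < d" using real_arch_pow_inv[OF d, of "1/2"] by auto
        then have "(1/2) ^ Suc n \<le> d" using d by (simp add: field_simps)
        then show ?thesis ..
      qed
      define n where "n = (LEAST n. (1/2) ^ Suc n \<le> d)"
      have n: "(1/2) ^ Suc n \<le> d" unfolding n_def by (rule LeastI_ex) fact
      have n': "d < (1/2) ^ n"
      proof (cases n)
        case 0
        then show ?thesis using False by simp
      next
        case (Suc m)
        then have "\<not> (1/2) ^ Suc m \<le> d" unfolding n_def using not_less_Least[of m "\<lambda>n. (1/2) ^ Suc n \<le> d"] by simp
        then show ?thesis using Suc by simp
      qed
      have "d powr (- s) \<le> ((1/2) ^ Suc n) powr (- s)"
        using s n by (intro powr_mono2') auto
      also have "(1/2::real) ^ Suc n = 2 powr (- real (Suc n))"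
        by (simp add: powr_minus powr_realpow power_one_over[symmetric] inverse_eq_divide del: of_nat_Suc power_Suc)
      also have "(2 powr (- real (Suc n))) powr (- s) = a ^ Suc n"
        by (simp add: a_def powr_powr powr_realpow[symmetric] mult.commute del: of_nat_Suc power_Suc)
      finally have "ennreal (d powr (- s)) \<le> ennreal (a ^ Suc n) * indicator (A n) z"
        using True n' by (simp add: A_def d_def[symmetric] ennreal_leI)
      also have "\<dots> \<le> (\<Sum>n. ennreal (a ^ Suc n) * indicator (A n) z)"
        using sum_le_suminf[of "\<lambda>n. ennreal (a ^ Suc n) * indicator (A n) z" "{n}"]
        by (simp only: sum.insert sum.empty finite.intros empty_iff add_0_right summableI zero_le not_False_eq_True simp_thms)
      finally show ?thesis using True unfolding d_def[symmetric] by (simp add: add_increasing)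
    qed
  next
    \<comment> \<open>At distance 0 the power is 0 as well, by the value of \<open>powr\<close> at
      base 0, so the singularity itself contributes nothing.\<close>
    case False
    then show ?thesis by (auto simp: indicator_def)
  qed
  have "(\<integral>\<^sup>+z. ennreal (torus_dist (fst z) (snd z) powr (- s)) * indicator (cell \<times> cell) z \<partial>lborel)
      \<le> (\<integral>\<^sup>+z. indicator (cell \<times> cell) z + (\<Sum>n. ennreal (a ^ Suc n) * indicator (A n) z) \<partial>lborel)"
    by (rule nn_integral_mono) (rule bound)
  also have "\<dots> = emeasure lborel (cell \<times> cell) + (\<Sum>n. ennreal (a ^ Suc n) * emeasure lborel (A n))"
    using cc A_meas by (simp add: nn_integral_add nn_integral_suminf nn_integral_cmult)
  also have "\<dots> < \<infinity>"
  proof -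
    have "emeasure lborel (cell \<times> cell) = emeasure lborel cell * emeasure lborel cell"
      unfolding lborel_prod[symmetric] by (intro lborel.emeasure_pair_measure_Times) auto
    then have 1: "emeasure lborel (cell \<times> cell) < \<infinity>"
      using emeasure_cell by (simp add: ennreal_mult_less_top)
    have "(\<Sum>n. ennreal (a ^ Suc n) * emeasure lborel (A n)) \<le> (\<Sum>n. (K * ennreal a) * ennreal ((a / 8) ^ n))"
    proof (rule suminf_le)
      fix n
      have "ennreal (a ^ Suc n) * emeasure lborel (A n) \<le> ennreal (a ^ Suc n) * (K * ennreal (((1/2) ^ n) ^ 3))"
        unfolding A_def by (intro mult_left_mono K(2)) (auto simp: power_le_one)
      also have "\<dots> = K * ennreal (a ^ Suc n * ((1/2) ^ n) ^ 3)"
        using a by (simp add: ennreal_mult mult_ac)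
      also have "a ^ Suc n * ((1/2) ^ n) ^ 3 = a * (a / 8) ^ n"
      proof -
        have "((1/2) ^ n) ^ 3 = ((1/2 :: real) ^ 3) ^ n"
          by (simp only: power_mult[symmetric] mult.commute[of n 3])
        also have "(1/2 :: real) ^ 3 = 1/8" by (simp add: power3_eq_cube)
        finally show ?thesis by (simp add: power_divide)
      qed
      also have "K * ennreal (a * (a / 8) ^ n) = (K * ennreal a) * ennreal ((a / 8) ^ n)"
        using a by (simp add: ennreal_mult mult.assoc)
      finally show "ennreal (a ^ Suc n) * emeasure lborel (A n) \<le> (K * ennreal a) * ennreal ((a / 8) ^ n)" .
    qed auto
    also have "\<dots> = (K * ennreal a) * (\<Sum>n. ennreal ((a / 8) ^ n))" by (rule ennreal_suminf_cmult)
    also have "(\<Sum>n. ennreal ((a / 8) ^ n)) = ennreal (\<Sum>n. (a / 8) ^ n)"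
      using a by (intro suminf_ennreal2 summable_geometric) auto
    also have "(K * ennreal a) * \<dots> < \<infinity>" using K(1) by (simp add: ennreal_mult_less_top)
    finally show ?thesis using 1 by simp
  qed
  finally show ?thesis .
qed

text \<open>The Lipschitz bound cancels two powers of the distance and leaves the exponent
  \<open>1 + 2 * \<sigma>\<close>, which is below 3 because \<open>\<sigma> < 1\<close>.\<close>

lemma Cc_infty_slob_integrable:
  assumes \<phi>: "\<phi> \<in> Cc_infty" and \<sigma>: "0 < \<sigma>" "\<sigma> < 1"
  shows "integrable (lebesgue_on (cell \<times> cell)) (slob_integrand \<sigma> \<phi> \<phi>)"
proof (rule integrableI_nonneg)
  show "slob_integrand \<sigma> \<phi> \<phi> \<in> borel_measurable (lebesgue_on (cell \<times> cell))"
    by (intro slob_measurable borel_imp_lebesgue_on Cc_infty_measurable \<phi>)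
  show "AE z in lebesgue_on (cell \<times> cell). 0 \<le> slob_integrand \<sigma> \<phi> \<phi> z" by (simp add: slob_nonneg)
  obtain C where C: "C > 0" "\<And>x y. \<bar>\<phi> x - \<phi> y\<bar> \<le> C * torus_dist x y"
    using Cc_infty_Lipschitz_torus[OF \<phi>] by blast
  have b: "slob_integrand \<sigma> \<phi> \<phi> z \<le> C\<^sup>2 * torus_dist (fst z) (snd z) powr (- (1 + 2 * \<sigma>))" for z
  proof (cases "torus_dist (fst z) (snd z) = 0")
    case True
    then show ?thesis by (simp add: slob_integrand_def case_prod_beta)
  next
    case False
    define d where "d = torus_dist (fst z) (snd z)"
    have d: "d > 0" using False torus_dist_nonneg[of "fst z" "snd z"] by (simp add: d_def)
    have "(\<phi> (fst z) - \<phi> (snd z))\<^sup>2 \<le> (C * d)\<^sup>2"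
      using power_mono[OF C(2)[of "fst z" "snd z"], of 2] by (simp only: d_def power2_abs abs_ge_zero simp_thms)
    then have "slob_integrand \<sigma> \<phi> \<phi> z \<le> (C * d)\<^sup>2 / d powr (3 + 2 * \<sigma>)"
      unfolding slob_integrand_def case_prod_beta d_def[symmetric] power2_eq_square[symmetric]
      by (intro divide_right_mono) auto
    also have "\<dots> = C\<^sup>2 * (d powr 2 / d powr (3 + 2 * \<sigma>))"
      using d by (simp add: power_mult_distrib powr_numeral)
    also have "d powr 2 / d powr (3 + 2 * \<sigma>) = d powr (- (1 + 2 * \<sigma>))"
      by (simp add: powr_diff[symmetric])
    finally show ?thesis by (simp add: d_def)
  qed
  have cc: "cell \<times> cell \<in> sets lebesgue" by (intro sets_completionI_sets) (simp add: borel_Times)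
  have "(\<integral>\<^sup>+z. ennreal (slob_integrand \<sigma> \<phi> \<phi> z) \<partial>lebesgue_on (cell \<times> cell))
      = (\<integral>\<^sup>+z. ennreal (slob_integrand \<sigma> \<phi> \<phi> z) * indicator (cell \<times> cell) z \<partial>lborel)"
    using cc by (simp add: nn_integral_restrict_space nn_integral_completion)
  also have "\<dots> \<le> (\<integral>\<^sup>+z. ennreal (C\<^sup>2) * (ennreal (torus_dist (fst z) (snd z) powr (- (1 + 2 * \<sigma>))) * indicator (cell \<times> cell) z) \<partial>lborel)"
  proof (rule nn_integral_mono)
    fix z
    have "ennreal (slob_integrand \<sigma> \<phi> \<phi> z) \<le> ennreal (C\<^sup>2) * ennreal (torus_dist (fst z) (snd z) powr (- (1 + 2 * \<sigma>)))"
      using ennreal_leI[OF b[of z]] by (simp only: ennreal_mult'' powr_ge_zero)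
    from mult_right_mono[OF this, of "indicator (cell \<times> cell) z"]
    show "ennreal (slob_integrand \<sigma> \<phi> \<phi> z) * indicator (cell \<times> cell) z \<le>
        ennreal (C\<^sup>2) * (ennreal (torus_dist (fst z) (snd z) powr (- (1 + 2 * \<sigma>))) * indicator (cell \<times> cell) z)"
      by (simp only: mult.assoc zero_le simp_thms)
  qed
  also have "\<dots> = ennreal (C\<^sup>2) * (\<integral>\<^sup>+z. ennreal (torus_dist (fst z) (snd z) powr (- (1 + 2 * \<sigma>))) * indicator (cell \<times> cell) z \<partial>lborel)"
  proof (rule nn_integral_cmult)
    have "(\<lambda>z. torus_dist (fst z) (snd z) powr (- (1 + 2 * \<sigma>))) \<in> borel_measurable lborel"
      using powr_real_measurable[OF torus_dist_measurable borel_measurable_const] by simp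
    moreover have "cell \<times> cell \<in> sets lborel" by (simp add: borel_Times)
    ultimately show "(\<lambda>z. ennreal (torus_dist (fst z) (snd z) powr (- (1 + 2 * \<sigma>))) * indicator (cell \<times> cell) z) \<in> borel_measurable lborel"
      by (intro borel_measurable_times_ennreal borel_measurable_indicator measurable_compose[OF _ measurable_ennreal])
  qed
  also have "\<dots> < \<infinity>"
    using torus_dist_powr_integral[of "1 + 2 * \<sigma>"] \<sigma> by (simp add: ennreal_mult_less_top)
  finally show "(\<integral>\<^sup>+z. ennreal (slob_integrand \<sigma> \<phi> \<phi> z) \<partial>lebesgue_on (cell \<times> cell)) < \<infinity>" .
qed

section \<open>Sobolev spaces as semi-inner product spaces\<close>

lemma Cc_infty_zero: "(\<lambda>x. 0) \<in> Cc_infty"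
proof -
  have "smooth_on UNIV (\<lambda>x. 0)" by (intro smooth_terms_smooth smooth_terms.const)
  then show ?thesis by (auto simp: Cc_infty_def periodic_def intro: exI[of _ 1])
qed

lemma W2_weak_deriv:
  assumes "f \<in> W2 k" "real (mi_order \<alpha>) \<le> k"
  shows "wderiv \<alpha> f \<in> L2" "weak_deriv \<alpha> f (wderiv \<alpha> f)"
  using assms wderiv_L2 wderiv_weak_deriv by (auto simp: W2_def)

text \<open>The three weak derivatives are chosen independently of one another, so the identity
  holds only almost everywhere and stems from uniqueness.\<close>

lemma wderiv_add:
  assumes "f \<in> W2 k" "g \<in> W2 k" "real (mi_order \<alpha>) \<le> k"
  shows "AE x in lebesgue_on cell. wderiv \<alpha> (\<lambda>x. f x + g x) x = wderiv \<alpha> f x + wderiv \<alpha> g x"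
  using assms
  by (intro wderiv_AE_eq L2_add weak_deriv_add W2_weak_deriv[where k = k]) (auto simp: W2_def)

lemma wderiv_scale:
  assumes "f \<in> W2 k" "real (mi_order \<alpha>) \<le> k"
  shows "AE x in lebesgue_on cell. wderiv \<alpha> (\<lambda>x. c * f x) x = c * wderiv \<alpha> f x"
  using assms by (intro wderiv_AE_eq L2_scale weak_deriv_scale W2_weak_deriv[where k = k])

lemma top_order_le: "int (mi_order \<alpha>) = \<lfloor>k\<rfloor> \<Longrightarrow> real (mi_order \<alpha>) \<le> k"
  by linarith

lemma W2_slob_integrable:
  assumes "f \<in> W2 k" "g \<in> W2 k" "frac k > 0" "int (mi_order \<alpha>) = \<lfloor>k\<rfloor>"
  shows "integrable (lebesgue_on (cell \<times> cell)) (slob_integrand (frac k) (wderiv \<alpha> f) (wderiv \<alpha> g))"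
proof (rule slob_integrable_mult)
  show "wderiv \<alpha> f \<in> L2" "wderiv \<alpha> g \<in> L2"
    by (intro W2_weak_deriv(1)[where k = k] assms(1,2) top_order_le[OF assms(4)])+
qed (use assms in \<open>simp_all add: W2_def\<close>)

text \<open>Membership in \<open>W2 k\<close> speaks of the chosen derivatives
  \<open>wderiv\<close>; here any explicit weak derivatives \<open>g \<alpha>\<close> may be
  exhibited, since the Slobodeckij form does not see null sets.\<close>

lemma W2I:
  assumes "f \<in> L2"
    and "\<And>\<alpha>. real (mi_order \<alpha>) \<le> k \<Longrightarrow> g \<alpha> \<in> L2 \<and> weak_deriv \<alpha> f (g \<alpha>)"
    and "\<And>\<alpha>. frac k > 0 \<Longrightarrow> int (mi_order \<alpha>) = \<lfloor>k\<rfloor> \<Longrightarrow>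
      integrable (lebesgue_on (cell \<times> cell)) (slob_integrand (frac k) (g \<alpha>) (g \<alpha>))"
  shows "f \<in> W2 k"
proof -
  have "integrable (lebesgue_on (cell \<times> cell)) (slob_integrand (frac k) (wderiv \<alpha> f) (wderiv \<alpha> f))"
    if k: "frac k > 0" and \<alpha>: "int (mi_order \<alpha>) = \<lfloor>k\<rfloor>" for \<alpha>
  proof -
    have g: "g \<alpha> \<in> L2" "weak_deriv \<alpha> f (g \<alpha>)" using assms(2) top_order_le[OF \<alpha>] by auto
    have ae: "AE x in lebesgue_on cell. g \<alpha> x = wderiv \<alpha> f x"
      using wderiv_AE_eq[OF g] by eventually_elim simp
    have "slob_integrand (frac k) (wderiv \<alpha> f) (wderiv \<alpha> f) \<in> borel_measurable (lebesgue_on (cell \<times> cell))"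
      using wderiv_L2[OF g] by (intro slob_measurable) (auto simp: L2_def)
    then show ?thesis
      by (rule integrable_cong_AE_imp[OF assms(3)[OF k \<alpha>] _ slob_cong_AE[OF ae ae]])
  qed
  then show ?thesis unfolding W2_def using assms(1,2) by blast
qed

lemma Cc_infty_subset_W2: "Cc_infty \<subseteq> W2 k"
proof
  fix \<phi> assume \<phi>: "\<phi> \<in> Cc_infty"
  show "\<phi> \<in> W2 k"
  proof (rule W2I)
    show "\<phi> \<in> L2" by (rule Cc_infty_L2[OF \<phi>])
    show "foldr pdx (rev (mi_list \<alpha>)) \<phi> \<in> L2 \<and> weak_deriv \<alpha> \<phi> (foldr pdx (rev (mi_list \<alpha>)) \<phi>)" for \<alpha>
      by (intro conjI Cc_infty_L2 Cc_infty_foldr_pdx \<phi> Cc_infty_weak_deriv)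
    show "frac k > 0 \<Longrightarrow> integrable (lebesgue_on (cell \<times> cell))
        (slob_integrand (frac k) (foldr pdx (rev (mi_list \<alpha>)) \<phi>) (foldr pdx (rev (mi_list \<alpha>)) \<phi>))" for \<alpha>
      by (intro Cc_infty_slob_integrable Cc_infty_foldr_pdx \<phi>) (auto simp: frac_lt_1)
  qed
qed

lemma W2_add:
  assumes f: "f \<in> W2 k" and g: "g \<in> W2 k"
  shows "(\<lambda>x. f x + g x) \<in> W2 k"
proof (rule W2I)
  show "(\<lambda>x. f x + g x) \<in> L2" using assms by (auto simp: W2_def intro: L2_add)
  show "(\<lambda>x. wderiv \<alpha> f x + wderiv \<alpha> g x) \<in> L2 \<and> weak_deriv \<alpha> (\<lambda>x. f x + g x) (\<lambda>x. wderiv \<alpha> f x + wderiv \<alpha> g x)"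
    if "real (mi_order \<alpha>) \<le> k" for \<alpha>
    using that assms
    by (intro conjI L2_add weak_deriv_add W2_weak_deriv[where k = k]) (auto simp: W2_def)
  show "integrable (lebesgue_on (cell \<times> cell)) (slob_integrand (frac k) (\<lambda>x. wderiv \<alpha> f x + wderiv \<alpha> g x) (\<lambda>x. wderiv \<alpha> f x + wderiv \<alpha> g x))"
    if k: "frac k > 0" "int (mi_order \<alpha>) = \<lfloor>k\<rfloor>" for \<alpha>
  proof -
    let ?S = "slob_integrand (frac k)" and ?f = "wderiv \<alpha> f" and ?g = "wderiv \<alpha> g"
    have "?S (\<lambda>x. ?f x + ?g x) (\<lambda>x. ?f x + ?g x) = (\<lambda>z. ?S ?f ?f z + ?S ?g ?f z + (?S ?f ?g z + ?S ?g ?g z))"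
      by (rule ext) (simp only: slob_add_left slob_commute[of _ ?f "\<lambda>x. ?f x + ?g x"] slob_commute[of _ ?g "\<lambda>x. ?f x + ?g x"])
    then show ?thesis
      using W2_slob_integrable[OF f f k] W2_slob_integrable[OF f g k] W2_slob_integrable[OF g f k] W2_slob_integrable[OF g g k]
      by simp
  qed
qed

lemma W2_scale:
  assumes f: "f \<in> W2 k"
  shows "(\<lambda>x. c * f x) \<in> W2 k"
proof (rule W2I)
  show "(\<lambda>x. c * f x) \<in> L2" using assms by (auto simp: W2_def intro: L2_scale)
  show "(\<lambda>x. c * wderiv \<alpha> f x) \<in> L2 \<and> weak_deriv \<alpha> (\<lambda>x. c * f x) (\<lambda>x. c * wderiv \<alpha> f x)"
    if "real (mi_order \<alpha>) \<le> k" for \<alpha>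
    using that assms by (intro conjI L2_scale weak_deriv_scale W2_weak_deriv[where k = k])
  show "integrable (lebesgue_on (cell \<times> cell)) (slob_integrand (frac k) (\<lambda>x. c * wderiv \<alpha> f x) (\<lambda>x. c * wderiv \<alpha> f x))"
    if k: "frac k > 0" "int (mi_order \<alpha>) = \<lfloor>k\<rfloor>" for \<alpha>
  proof -
    let ?S = "slob_integrand (frac k)" and ?f = "wderiv \<alpha> f"
    have "?S (\<lambda>x. c * ?f x) (\<lambda>x. c * ?f x) = (\<lambda>z. c * (c * ?S ?f ?f z))"
      by (rule ext) (simp only: slob_scale_left slob_commute[of _ ?f "\<lambda>x. c * ?f x"])
    then show ?thesis using W2_slob_integrable[OF f f k] by simp
  qed
qed

lemma W2_inner_commute: "W2_inner k f g = W2_inner k g f"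
  by (simp add: W2_inner_def mult.commute slob_commute[of _ "wderiv _ f"])

lemma W2_inner_nonneg: "0 \<le> W2_inner k f f"
  unfolding W2_inner_def
  by (intro add_nonneg_nonneg sum_nonneg Bochner_Integration.integral_nonneg)
    (auto intro!: sum_nonneg Bochner_Integration.integral_nonneg slob_nonneg)

lemma W2_inner_add:
  assumes f: "f \<in> W2 k" and g: "g \<in> W2 k" and h: "h \<in> W2 k"
  shows "W2_inner k (\<lambda>x. f x + g x) h = W2_inner k f h + W2_inner k g h"
proof -
  have fg: "(\<lambda>x. f x + g x) \<in> W2 k" by (rule W2_add[OF f g])
  have 1: "(LINT x|lebesgue_on cell. wderiv \<alpha> (\<lambda>x. f x + g x) x * wderiv \<alpha> h x) =
      (LINT x|lebesgue_on cell. wderiv \<alpha> f x * wderiv \<alpha> h x) + (LINT x|lebesgue_on cell. wderiv \<alpha> g x * wderiv \<alpha> h x)"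
    if \<alpha>: "real (mi_order \<alpha>) \<le> k" for \<alpha>
  proof -
    note m = W2_weak_deriv(1)[OF f \<alpha>] W2_weak_deriv(1)[OF g \<alpha>] W2_weak_deriv(1)[OF h \<alpha>] W2_weak_deriv(1)[OF fg \<alpha>]
    note i = L2_mult_integrable[OF m(1,3)] L2_mult_integrable[OF m(2,3)] L2_mult_integrable[OF m(4,3)]
    have "(LINT x|lebesgue_on cell. wderiv \<alpha> (\<lambda>x. f x + g x) x * wderiv \<alpha> h x) =
        (LINT x|lebesgue_on cell. wderiv \<alpha> f x * wderiv \<alpha> h x + wderiv \<alpha> g x * wderiv \<alpha> h x)"
    proof (rule integral_cong_AE)
      show "AE x in lebesgue_on cell. wderiv \<alpha> (\<lambda>x. f x + g x) x * wderiv \<alpha> h x = wderiv \<alpha> f x * wderiv \<alpha> h x + wderiv \<alpha> g x * wderiv \<alpha> h x"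
        using wderiv_add[OF f g \<alpha>] by eventually_elim (simp add: distrib_right)
    qed (use i in auto)
    then show ?thesis using i by simp
  qed
  have 2: "(LINT z|lebesgue_on (cell \<times> cell). slob_integrand (frac k) (wderiv \<alpha> (\<lambda>x. f x + g x)) (wderiv \<alpha> h) z) =
      (LINT z|lebesgue_on (cell \<times> cell). slob_integrand (frac k) (wderiv \<alpha> f) (wderiv \<alpha> h) z) +
      (LINT z|lebesgue_on (cell \<times> cell). slob_integrand (frac k) (wderiv \<alpha> g) (wderiv \<alpha> h) z)"
    if k: "frac k > 0" "int (mi_order \<alpha>) = \<lfloor>k\<rfloor>" for \<alpha>
  proof -
    note i = W2_slob_integrable[OF f h k] W2_slob_integrable[OF g h k] W2_slob_integrable[OF fg h k]
    have "(LINT z|lebesgue_on (cell \<times> cell). slob_integrand (frac k) (wderiv \<alpha> (\<lambda>x. f x + g x)) (wderiv \<alpha> h) z) =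
      (LINT z|lebesgue_on (cell \<times> cell). slob_integrand (frac k) (wderiv \<alpha> f) (wderiv \<alpha> h) z + slob_integrand (frac k) (wderiv \<alpha> g) (wderiv \<alpha> h) z)"
    proof (rule integral_cong_AE)
      have "AE x in lebesgue_on cell. wderiv \<alpha> h x = wderiv \<alpha> h x" by simp
      from slob_cong_AE[OF wderiv_add[OF f g top_order_le[OF k(2)]] this, of "frac k"]
      show "AE z in lebesgue_on (cell \<times> cell). slob_integrand (frac k) (wderiv \<alpha> (\<lambda>x. f x + g x)) (wderiv \<alpha> h) z =
          slob_integrand (frac k) (wderiv \<alpha> f) (wderiv \<alpha> h) z + slob_integrand (frac k) (wderiv \<alpha> g) (wderiv \<alpha> h) z"
        by (simp only: slob_add_left)
    qed (use i in auto)
    then show ?thesis using i by simp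
  qed
  show ?thesis unfolding W2_inner_def using 1 2 by (simp add: sum.distrib)
qed

lemma W2_inner_scale:
  assumes f: "f \<in> W2 k" and h: "h \<in> W2 k"
  shows "W2_inner k (\<lambda>x. c * f x) h = c * W2_inner k f h"
proof -
  have cf: "(\<lambda>x. c * f x) \<in> W2 k" by (rule W2_scale[OF f])
  have 1: "(LINT x|lebesgue_on cell. wderiv \<alpha> (\<lambda>x. c * f x) x * wderiv \<alpha> h x) =
      c * (LINT x|lebesgue_on cell. wderiv \<alpha> f x * wderiv \<alpha> h x)"
    if \<alpha>: "real (mi_order \<alpha>) \<le> k" for \<alpha>
  proof -
    note m = W2_weak_deriv(1)[OF f \<alpha>] W2_weak_deriv(1)[OF h \<alpha>] W2_weak_deriv(1)[OF cf \<alpha>]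
    note i = L2_mult_integrable[OF m(1,2)] L2_mult_integrable[OF m(3,2)]
    have "(LINT x|lebesgue_on cell. wderiv \<alpha> (\<lambda>x. c * f x) x * wderiv \<alpha> h x) =
        (LINT x|lebesgue_on cell. c * (wderiv \<alpha> f x * wderiv \<alpha> h x))"
    proof (rule integral_cong_AE)
      show "AE x in lebesgue_on cell. wderiv \<alpha> (\<lambda>x. c * f x) x * wderiv \<alpha> h x = c * (wderiv \<alpha> f x * wderiv \<alpha> h x)"
        using wderiv_scale[OF f \<alpha>, of c] by eventually_elim (simp add: mult.assoc)
    qed (use i in auto)
    then show ?thesis by simp
  qed
  have 2: "(LINT z|lebesgue_on (cell \<times> cell). slob_integrand (frac k) (wderiv \<alpha> (\<lambda>x. c * f x)) (wderiv \<alpha> h) z) =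
      c * (LINT z|lebesgue_on (cell \<times> cell). slob_integrand (frac k) (wderiv \<alpha> f) (wderiv \<alpha> h) z)"
    if k: "frac k > 0" "int (mi_order \<alpha>) = \<lfloor>k\<rfloor>" for \<alpha>
  proof -
    note i = W2_slob_integrable[OF f h k] W2_slob_integrable[OF cf h k]
    have "(LINT z|lebesgue_on (cell \<times> cell). slob_integrand (frac k) (wderiv \<alpha> (\<lambda>x. c * f x)) (wderiv \<alpha> h) z) =
      (LINT z|lebesgue_on (cell \<times> cell). c * slob_integrand (frac k) (wderiv \<alpha> f) (wderiv \<alpha> h) z)"
    proof (rule integral_cong_AE)
      have "AE x in lebesgue_on cell. wderiv \<alpha> h x = wderiv \<alpha> h x" by simp
      from slob_cong_AE[OF wderiv_scale[OF f top_order_le[OF k(2)], of c] this, of "frac k"]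
      show "AE z in lebesgue_on (cell \<times> cell). slob_integrand (frac k) (wderiv \<alpha> (\<lambda>x. c * f x)) (wderiv \<alpha> h) z =
          c * slob_integrand (frac k) (wderiv \<alpha> f) (wderiv \<alpha> h) z"
        by (simp only: slob_scale_left)
    qed (use i in auto)
    then show ?thesis by simp
  qed
  show ?thesis unfolding W2_inner_def using 1 2 by (simp add: sum_distrib_left distrib_left)
qed

lemma W2_semi_inner_space: "semi_inner_space (W2 k) (W2_inner k)"
  by unfold_locales
    (use Cc_infty_zero Cc_infty_subset_W2[of k] W2_add W2_scale W2_inner_add W2_inner_scale W2_inner_commute W2_inner_nonneg in auto)

text \<open>Approximability by test functions passes to sums and multiples by the Minkowski
  inequality and homogeneity, both available in \<open>W2 k\<close>.\<close>

lemma W20_semi_inner_space: "semi_inner_space (W20 k) (W2_inner k)"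
proof -
  interpret W2: semi_inner_space "W2 k" "W2_inner k" by (rule W2_semi_inner_space)
  have sub: "f \<in> W2 k" if "f \<in> W20 k" for f using that by (simp add: W20_def)
  have Cc: "\<phi> \<in> W2 k" if "\<phi> \<in> Cc_infty" for \<phi> using that Cc_infty_subset_W2 by blast
  let ?n = "\<lambda>f. sqrt (W2_inner k f f)"
  have approx: "\<exists>\<phi>\<in>Cc_infty. ?n (\<lambda>x. f x - \<phi> x) < \<epsilon>" if "f \<in> W20 k" "\<epsilon> > 0" for f \<epsilon>
    using that by (simp add: W20_def)
  show ?thesis
  proof
    show "(\<lambda>x. 0) \<in> W20 k"
      unfolding W20_def using W2.zero_mem Cc_infty_zero W2.ip_zero[OF W2.zero_mem]
      by (auto intro!: bexI[of _ "\<lambda>x. 0"])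
    show "(\<lambda>x. f x + g x) \<in> W20 k" if f: "f \<in> W20 k" and g: "g \<in> W20 k" for f g
    proof -
      have "\<exists>\<phi>\<in>Cc_infty. ?n (\<lambda>x. f x + g x - \<phi> x) < \<epsilon>" if \<epsilon>: "\<epsilon> > 0" for \<epsilon>
      proof -
        obtain \<phi> where \<phi>: "\<phi> \<in> Cc_infty" "?n (\<lambda>x. f x - \<phi> x) < \<epsilon> / 2" using approx[OF f half_gt_zero[OF \<epsilon>]] by blast
        obtain \<psi> where \<psi>: "\<psi> \<in> Cc_infty" "?n (\<lambda>x. g x - \<psi> x) < \<epsilon> / 2" using approx[OF g half_gt_zero[OF \<epsilon>]] by blast
        have "?n (\<lambda>x. (f x - \<phi> x) + (g x - \<psi> x)) \<le> ?n (\<lambda>x. f x - \<phi> x) + ?n (\<lambda>x. g x - \<psi> x)"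
          by (intro W2.Minkowski W2.minus_mem sub f g Cc \<phi> \<psi>)
        also have "\<dots> < \<epsilon>" using \<phi> \<psi> by simp
        finally show ?thesis
          using Cc_infty_add[OF \<phi>(1) \<psi>(1)] by (intro bexI[of _ "\<lambda>x. \<phi> x + \<psi> x"]) (simp_all add: algebra_simps)
      qed
      then show ?thesis using W2.add_mem[OF sub[OF f] sub[OF g]] by (simp add: W20_def)
    qed
    show "(\<lambda>x. c *\<^sub>R f x) \<in> W20 k" if f: "f \<in> W20 k" for c f
    proof -
      have "\<exists>\<phi>\<in>Cc_infty. ?n (\<lambda>x. c *\<^sub>R f x - \<phi> x) < \<epsilon>" if \<epsilon>: "\<epsilon> > 0" for \<epsilon>
      proof -
        \<comment> \<open>The summand 1 in the denominator admits \<open>c = 0\<close>.\<close>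
        obtain \<phi> where \<phi>: "\<phi> \<in> Cc_infty" "?n (\<lambda>x. f x - \<phi> x) < \<epsilon> / (\<bar>c\<bar> + 1)"
          using approx[OF f divide_pos_pos[OF \<epsilon>, of "\<bar>c\<bar> + 1"]] by fastforce
        have "?n (\<lambda>x. c *\<^sub>R (f x - \<phi> x)) = \<bar>c\<bar> * ?n (\<lambda>x. f x - \<phi> x)"
          by (intro W2.sqrt_ip_scale W2.minus_mem sub f Cc \<phi>)
        also have "\<dots> \<le> \<bar>c\<bar> * (\<epsilon> / (\<bar>c\<bar> + 1))" using \<phi>(2) by (intro mult_left_mono) auto
        also have "\<dots> < \<epsilon>" using \<epsilon> by (simp add: field_simps)
        finally show ?thesis
          using Cc_infty_scale[OF \<phi>(1), of c] by (intro bexI[of _ "\<lambda>x. c * \<phi> x"]) (simp_all add: algebra_simps)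
      qed
      then show ?thesis using W2.scale_mem[OF sub[OF f], of c] by (simp add: W20_def)
    qed
  qed (use sub W2.ip_add W2.ip_scale W2_inner_commute W2_inner_nonneg in auto)
qed

lemma W20v_semi_inner_space: "semi_inner_space (W20v k) (W2v_inner k)"
proof -
  interpret W: semi_inner_space "W20 k" "W2_inner k" by (rule W20_semi_inner_space)
  show ?thesis
  proof
    show "(\<lambda>x. 0) \<in> W20v k" using W.zero_mem by (simp add: W20v_def)
    show "f \<in> W20v k \<Longrightarrow> g \<in> W20v k \<Longrightarrow> (\<lambda>x. f x + g x) \<in> W20v k" for f g
      using W.add_mem by (simp add: W20v_def)
    show "f \<in> W20v k \<Longrightarrow> (\<lambda>x. c *\<^sub>R f x) \<in> W20v k" for c f
      using W.scale_mem by (simp add: W20v_def)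
    show "f \<in> W20v k \<Longrightarrow> g \<in> W20v k \<Longrightarrow> h \<in> W20v k \<Longrightarrow>
       W2v_inner k (\<lambda>x. f x + g x) h = W2v_inner k f h + W2v_inner k g h" for f g h
      by (simp add: W2v_inner_def W20v_def W.ip_add sum.distrib)
    show "f \<in> W20v k \<Longrightarrow> h \<in> W20v k \<Longrightarrow> W2v_inner k (\<lambda>x. c *\<^sub>R f x) h = c * W2v_inner k f h" for c f h
      using W.ip_scale by (simp add: W2v_inner_def W20v_def sum_distrib_left)
    show "W2v_inner k f g = W2v_inner k g f" for f g
      by (simp add: W2v_inner_def W2_inner_commute)
    show "0 \<le> W2v_inner k f f" for f
      by (simp add: W2v_inner_def W2_inner_nonneg sum_nonneg)
  qed
qed

section \<open>The topology of the trajectory space\<close>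

text \<open>Taking the trace on a level commutes with intersections and unions, so the family of
  sets is a topology.\<close>

lemma openin_traj_top:
  "openin (traj_top k \<phi> \<psi> dM) U \<longleftrightarrow> U \<subseteq> traj_set k \<phi> \<psi> \<and>
     (\<forall>L\<ge>1. openin (metric_topology (traj_level k \<phi> \<psi> L) (traj_dist \<phi> \<psi> dM)) (U \<inter> traj_level k \<phi> \<psi> L))"
proof -
  let ?T = "\<lambda>L. metric_topology (traj_level k \<phi> \<psi> L) (traj_dist \<phi> \<psi> dM)"
  have "istopology (\<lambda>U. U \<subseteq> traj_set k \<phi> \<psi> \<and> (\<forall>L\<ge>1. openin (?T L) (U \<inter> traj_level k \<phi> \<psi> L)))"
    unfolding istopology_def
  proof (rule conjI; intro allI impI conjI)
    fix S T L assume S: "S \<subseteq> traj_set k \<phi> \<psi> \<and> (\<forall>L\<ge>1. openin (?T L) (S \<inter> traj_level k \<phi> \<psi> L))"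
      and T: "T \<subseteq> traj_set k \<phi> \<psi> \<and> (\<forall>L\<ge>1. openin (?T L) (T \<inter> traj_level k \<phi> \<psi> L))"
    show "S \<inter> T \<subseteq> traj_set k \<phi> \<psi>" using S by blast
    assume L: "(1::nat) \<le> L"
    have "S \<inter> T \<inter> traj_level k \<phi> \<psi> L = (S \<inter> traj_level k \<phi> \<psi> L) \<inter> (T \<inter> traj_level k \<phi> \<psi> L)" by blast
    then show "openin (?T L) (S \<inter> T \<inter> traj_level k \<phi> \<psi> L)"
      using S T L by (simp add: openin_Int)
  next
    fix \<K> L assume K: "\<forall>S\<in>\<K>. S \<subseteq> traj_set k \<phi> \<psi> \<and> (\<forall>L\<ge>1. openin (?T L) (S \<inter> traj_level k \<phi> \<psi> L))"
    show "\<Union>\<K> \<subseteq> traj_set k \<phi> \<psi>" using K by blast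
    assume L: "(1::nat) \<le> L"
    have eq: "\<Union>\<K> \<inter> traj_level k \<phi> \<psi> L = \<Union>((\<lambda>S. S \<inter> traj_level k \<phi> \<psi> L) ` \<K>)" by blast
    show "openin (?T L) (\<Union>\<K> \<inter> traj_level k \<phi> \<psi> L)"
      unfolding eq by (rule openin_Union) (use K L in blast)
  qed
  then show ?thesis unfolding traj_top_def by (simp add: topology_inverse')
qed

lemma traj_level_subset: "1 \<le> L \<Longrightarrow> traj_level k \<phi> \<psi> L \<subseteq> traj_set k \<phi> \<psi>"
  unfolding traj_set_def by (rule UN_upper) simp

lemma topspace_traj_top: "topspace (traj_top k \<phi> \<psi> dM) = traj_set k \<phi> \<psi>"
proof (rule subset_antisym)
  show "topspace (traj_top k \<phi> \<psi> dM) \<subseteq> traj_set k \<phi> \<psi>"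
    using openin_traj_top[THEN iffD1, OF openin_topspace] by (rule conjunct1)
  have "openin (metric_topology (traj_level k \<phi> \<psi> L) d) (traj_level k \<phi> \<psi> L)" for L d
    using openin_topspace[of "metric_topology (traj_level k \<phi> \<psi> L) d"] unfolding topspace_metric_topology .
  then have "openin (traj_top k \<phi> \<psi> dM) (traj_set k \<phi> \<psi>)"
    unfolding openin_traj_top using traj_level_subset by (auto simp: inf_absorb2)
  then show "traj_set k \<phi> \<psi> \<subseteq> topspace (traj_top k \<phi> \<psi> dM)" by (rule openin_subset)
qed


section \<open>What convergence of trajectories says about single coordinates\<close>

lemma Phi_bounds: "z \<ge> 0 \<Longrightarrow> 0 \<le> Phi z \<and> Phi z \<le> 1"
  by (simp add: Phi_def)

lemma Phi_measurable [measurable]: "Phi \<in> borel_measurable borel"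
  unfolding Phi_def[abs_def] by measurable

text \<open>On nonnegative numbers \<open>Phi\<close> has the inverse \<open>w / (1 - w)\<close>,
  which is continuous at 0.\<close>

lemma Phi_tendsto_0D:
  assumes "(\<lambda>j. Phi (z j)) \<longlonglongrightarrow> 0" "\<And>j. z j \<ge> 0"
  shows "z \<longlonglongrightarrow> 0"
proof -
  have "(\<lambda>j. Phi (z j) / (1 - Phi (z j))) \<longlonglongrightarrow> 0 / (1 - 0)"
    by (intro tendsto_intros assms(1)) simp
  moreover have "Phi (z j) / (1 - Phi (z j)) = z j" for j
  proof -
    have "1 + z j \<noteq> 0" using assms(2)[of j] by linarith
    then show ?thesis by (simp add: Phi_def field_simps)
  qed
  ultimately show ?thesis by simp
qed

lemma C_dist_bdd:
  fixes x y :: "real \<Rightarrow> real"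
  assumes "continuous_on UNIV x" "continuous_on UNIV y"
  shows "bdd_above ((\<lambda>s. \<bar>x s - y s\<bar>) ` {- r..r::real})"
proof -
  have "continuous_on {- r..r} x" "continuous_on {- r..r} y"
    using assms continuous_on_subset by blast+
  then have "compact ((\<lambda>s. \<bar>x s - y s\<bar>) ` {- r..r})"
    by (intro compact_continuous_image continuous_intros) auto
  then show ?thesis by (intro bounded_imp_bdd_above compact_imp_bounded)
qed

lemma C_dist_upper:
  assumes "continuous_on UNIV x" "continuous_on UNIV y" "\<bar>s\<bar> \<le> r"
  shows "\<bar>x s - y s\<bar> \<le> C_dist r x y"
  unfolding C_dist_def using assms by (intro cSUP_upper C_dist_bdd) auto

lemma C_dist_nonneg:
  assumes "continuous_on UNIV x" "continuous_on UNIV y" "0 \<le> r"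
  shows "0 \<le> C_dist r x y"
  using C_dist_upper[OF assms(1,2), of 0 r] assms(3) by linarith

text \<open>The distance is monotone in the radius, and monotone functions are Borel.\<close>

lemma C_dist_measurable:
  assumes "continuous_on UNIV x" "continuous_on UNIV y"
  shows "(\<lambda>t. C_dist \<bar>t\<bar> x y) \<in> borel_measurable borel"
proof -
  \<comment> \<open>The truncation keeps the interval nonempty, so that the supremum is meaningful
    for every \<open>r\<close>.\<close>
  define f where "f r = C_dist (max 0 r) x y" for r
  have "mono f"
  proof (rule monoI)
    fix r r' :: real assume "r \<le> r'"
    then show "f r \<le> f r'"
      unfolding f_def C_dist_def by (intro cSUP_subset_mono C_dist_bdd assms) auto
  qed
  then have "f \<in> borel_measurable borel" by (rule borel_measurable_mono)
  then have "(\<lambda>t. f \<bar>t\<bar>) \<in> borel_measurable borel" by measurable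
  then show ?thesis by (simp add: f_def)
qed

definition window :: "real \<Rightarrow> (real \<Rightarrow> real) \<Rightarrow> real \<Rightarrow> real" where
  "window t x = restrict x {- \<bar>t\<bar>..\<bar>t\<bar>}"

lemma window_caglad:
  assumes x: "caglad x" and t: "t > 0"
  shows "window t x \<in> caglad_space (- t) t"
proof -
  have "(window t x \<longlongrightarrow> window t x s) (at_left s)" if s: "- t < s" "s \<le> t" for s
  proof -
    have "\<forall>\<^sub>F r in at_left s. x r = window t x r"
      using eventually_at_left_real[OF s(1)] by eventually_elim (use s t in \<open>auto simp: window_def\<close>)
    moreover have "(x \<longlongrightarrow> x s) (at_left s)" using x by (simp add: caglad_def)
    ultimately show ?thesis using s t Lim_transform_eventually by (fastforce simp: window_def)
  qed
  moreover have "\<exists>l. (window t x \<longlongrightarrow> l) (at_right s)" if s: "- t \<le> s" "s < t" for s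
  proof -
    have "\<forall>\<^sub>F r in at_right s. x r = window t x r"
      using eventually_at_right_real[OF s(2)] by eventually_elim (use s t in \<open>auto simp: window_def\<close>)
    moreover obtain l where "(x \<longlongrightarrow> l) (at_right s)" using x by (auto simp: caglad_def)
    ultimately show ?thesis using Lim_transform_eventually by blast
  qed
  ultimately show ?thesis using t by (auto simp: caglad_space_def window_def)
qed

lemma traj_levelD:
  assumes "(\<rho>, S, m) \<in> traj_level k \<phi> \<psi> L"
  shows "continuous_on UNIV (\<lambda>t. \<rho> t (\<phi> n))" "continuous_on UNIV (\<lambda>t. m t (\<psi> n))" "caglad (\<lambda>t. S t (\<phi> n))"
    "\<rho> t \<in> Wneg k" "S t \<in> Wneg k" "m t \<in> Wnegv k"
  using assms by (auto simp: traj_level_def)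

lemma gauss_integrable: "integrable lborel (\<lambda>t::real. exp (- t\<^sup>2))"
proof -
  have "integrable lborel (\<lambda>t. sqrt pi * normal_density 0 (sqrt (1 / 2)) t)" by (intro integrable_mult_right integrable_normal_density) simp
  then show ?thesis by (simp add: normal_density_def)
qed

text \<open>The distance is a series of nonnegative terms, so it dominates each of them. Its
  convergence has to be shown for that: every integrand is at most 3 times the Gaussian, because
  \<open>Phi\<close> is at most 1.\<close>

lemma traj_dist_ge:
  fixes dM
  assumes dM: "M1_complete_metrics dM"
    and 1: "(\<rho>1, S1, m1) \<in> traj_level k \<phi> \<psi> L" and 2: "(\<rho>2, S2, m2) \<in> traj_level k \<phi> \<psi> L"
  defines "h \<equiv> \<lambda>n t. exp (- t\<^sup>2) *
        (Phi (C_dist \<bar>t\<bar> (\<lambda>s. \<rho>1 s (\<phi> n)) (\<lambda>s. \<rho>2 s (\<phi> n))) +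
         Phi (C_dist \<bar>t\<bar> (\<lambda>s. m1 s (\<psi> n)) (\<lambda>s. m2 s (\<psi> n))) +
         Phi (dM \<bar>t\<bar> (window t (\<lambda>s. S1 s (\<phi> n))) (window t (\<lambda>s. S2 s (\<phi> n)))))"
  shows "integrable lborel (h n)" "AE t in lborel. 0 \<le> h n t"
    "1 / 2 ^ Suc n * (LINT t|lborel. h n t) \<le> traj_dist \<phi> \<psi> dM (\<rho>1, S1, m1) (\<rho>2, S2, m2)"
proof -
  note D1 = traj_levelD[OF 1] and D2 = traj_levelD[OF 2]
  \<comment> \<open>\<open>M1_complete_metrics\<close> constrains windows of positive size only, so
    the sign is known for \<open>t \<noteq> 0\<close>, that is almost everywhere.\<close>
  have dnn: "0 \<le> dM \<bar>t\<bar> x y" if "t \<noteq> 0" for t x y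
    using dM that unfolding M1_complete_metrics_def by (meson Metric_space.nonneg zero_less_abs_iff)
  have [measurable]: "h n \<in> borel_measurable borel" for n
  proof -
    have "(\<lambda>t. dM \<bar>t\<bar> (window t (\<lambda>s. S1 s (\<phi> n))) (window t (\<lambda>s. S2 s (\<phi> n)))) \<in> borel_measurable borel"
      using dM D1(3)[of n] D2(3)[of n] unfolding M1_complete_metrics_def window_def by blast
    then show ?thesis
      unfolding h_def
      by (intro borel_measurable_times borel_measurable_add measurable_compose[OF _ Phi_measurable] C_dist_measurable D1 D2) auto
  qed
  have b: "0 \<le> h n t \<and> h n t \<le> 3 * exp (- t\<^sup>2)" if "t \<noteq> 0" for n t
  proof -
    define P where "P = Phi (C_dist \<bar>t\<bar> (\<lambda>s. \<rho>1 s (\<phi> n)) (\<lambda>s. \<rho>2 s (\<phi> n))) +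
         Phi (C_dist \<bar>t\<bar> (\<lambda>s. m1 s (\<psi> n)) (\<lambda>s. m2 s (\<psi> n))) +
         Phi (dM \<bar>t\<bar> (window t (\<lambda>s. S1 s (\<phi> n))) (window t (\<lambda>s. S2 s (\<phi> n))))"
    have "0 \<le> P" "P \<le> 3"
      using Phi_bounds[OF C_dist_nonneg[OF D1(1)[of n] D2(1)[of n], of "\<bar>t\<bar>"]]
        Phi_bounds[OF C_dist_nonneg[OF D1(2)[of n] D2(2)[of n], of "\<bar>t\<bar>"]]
        Phi_bounds[OF dnn[OF that, of "window t (\<lambda>s. S1 s (\<phi> n))" "window t (\<lambda>s. S2 s (\<phi> n))"]]
      unfolding P_def by auto
    moreover have "h n t = exp (- t\<^sup>2) * P" by (simp add: h_def P_def)
    ultimately show ?thesis using mult_left_mono[of P 3 "exp (- t\<^sup>2)"] by (simp add: mult.commute)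
  qed
  have ae: "AE t in lborel. 0 \<le> h n t \<and> h n t \<le> 3 * exp (- t\<^sup>2)" for n
    using AE_lborel_singleton[of 0] by eventually_elim (rule b)
  show nn: "AE t in lborel. 0 \<le> h n t" for n using ae[of n] by eventually_elim simp
  have gi: "integrable lborel (\<lambda>t::real. 3 * exp (- t\<^sup>2))" using gauss_integrable by simp
  show int: "integrable lborel (h n)" for n
  proof (rule Bochner_Integration.integrable_bound[OF gi])
    show "AE t in lborel. norm (h n t) \<le> norm (3 * exp (- t\<^sup>2))"
      using ae[of n] by eventually_elim simp
  qed simp
  define G where "G = (LINT t::real|lborel. 3 * exp (- t\<^sup>2))"
  have I0: "0 \<le> (LINT t|lborel. h n t)" for n by (rule integral_nonneg_AE[OF nn])
  have IG: "(LINT t|lborel. h n t) \<le> G" for n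
    unfolding G_def
  proof (rule integral_mono_AE[OF int gi])
    show "AE t in lborel. h n t \<le> 3 * exp (- t\<^sup>2)" using ae[of n] by eventually_elim simp
  qed
  have summ: "summable (\<lambda>n. 1 / 2 ^ Suc n * (LINT t|lborel. h n t))"
  proof (rule summable_comparison_test')
    show "summable (\<lambda>n. G * (1/2) ^ Suc n)" by (intro summable_mult summable_Suc_iff[THEN iffD2] summable_geometric) simp
    show "norm (1 / 2 ^ Suc n * (LINT t|lborel. h n t)) \<le> G * (1/2) ^ Suc n" for n
      using mult_left_mono[OF IG[of n], of "1 / 2 ^ Suc n"] I0[of n]
      by (simp add: abs_mult power_one_over mult.commute del: power_Suc)
  qed
  have "1 / 2 ^ Suc n * (LINT t|lborel. h n t) \<le> (\<Sum>n. 1 / 2 ^ Suc n * (LINT t|lborel. h n t))"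
    using sum_le_suminf[OF summ, of "{n}"] I0 by (simp del: power_Suc)
  also have "\<dots> = traj_dist \<phi> \<psi> dM (\<rho>1, S1, m1) (\<rho>2, S2, m2)"
    by (simp add: traj_dist_def h_def window_def del: power_Suc)
  finally show "1 / 2 ^ Suc n * (LINT t|lborel. h n t) \<le> traj_dist \<phi> \<psi> dM (\<rho>1, S1, m1) (\<rho>2, S2, m2)" .
qed

text \<open>Convergence in the distance bounds integrals over all window sizes. Convergence in the
  mean gives a subsequence that converges for almost every size, and the sizes beyond
  \<open>R\<close> contain an interval of positive measure from which a good one is picked.\<close>

lemma traj_dist_tendsto_subseq:
  assumes dM: "M1_complete_metrics dM"
    and x: "(\<rho>, S, m) \<in> traj_level k \<phi> \<psi> L" and y: "\<And>j. (\<rho>' j, S' j, m' j) \<in> traj_level k \<phi> \<psi> L"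
    and lim: "(\<lambda>j::nat. traj_dist \<phi> \<psi> dM (\<rho>, S, m) (\<rho>' j, S' j, m' j)) \<longlonglongrightarrow> 0"
  shows "\<exists>r t. strict_mono r \<and> R < t \<and>
     (\<lambda>j. C_dist t (\<lambda>s. \<rho> s (\<phi> n)) (\<lambda>s. \<rho>' (r j) s (\<phi> n))) \<longlonglongrightarrow> 0 \<and>
     (\<lambda>j. C_dist t (\<lambda>s. m s (\<psi> n)) (\<lambda>s. m' (r j) s (\<psi> n))) \<longlonglongrightarrow> 0 \<and>
     (\<lambda>j. M1_dist (- t) t (window t (\<lambda>s. S' (r j) s (\<phi> n))) (window t (\<lambda>s. S s (\<phi> n)))) \<longlonglongrightarrow> 0"
proof -
  note Dx = traj_levelD[OF x] and Dy = traj_levelD[OF y]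
  define A where "A j t = C_dist \<bar>t\<bar> (\<lambda>s. \<rho> s (\<phi> n)) (\<lambda>s. \<rho>' j s (\<phi> n))" for j t
  define B where "B j t = C_dist \<bar>t\<bar> (\<lambda>s. m s (\<psi> n)) (\<lambda>s. m' j s (\<psi> n))" for j t
  define C where "C j t = dM \<bar>t\<bar> (window t (\<lambda>s. S s (\<phi> n))) (window t (\<lambda>s. S' j s (\<phi> n)))" for j t
  define h where "h j t = exp (- t\<^sup>2) * (Phi (A j t) + Phi (B j t) + Phi (C j t))" for j t
  note H = traj_dist_ge[OF dM x y, where n = n, folded A_def B_def C_def, folded h_def]
  have int: "integrable lborel (h j)" and nn: "AE t in lborel. 0 \<le> h j t" for j
    using H[of j] by auto
  have "(\<lambda>j. LINT t|lborel. h j t) \<longlonglongrightarrow> 0"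
  proof (rule tendsto_sandwich)
    show "\<forall>\<^sub>F j in sequentially. 0 \<le> (LINT t|lborel. h j t)" by (simp add: integral_nonneg_AE[OF nn])
    have "(LINT t|lborel. h j t) \<le> 2 ^ Suc n * traj_dist \<phi> \<psi> dM (\<rho>, S, m) (\<rho>' j, S' j, m' j)" for j
      using H(3)[of j] by (simp add: field_simps)
    then show "\<forall>\<^sub>F j in sequentially. (LINT t|lborel. h j t) \<le> 2 ^ Suc n * traj_dist \<phi> \<psi> dM (\<rho>, S, m) (\<rho>' j, S' j, m' j)" by simp
    show "(\<lambda>j. 2 ^ Suc n * traj_dist \<phi> \<psi> dM (\<rho>, S, m) (\<rho>' j, S' j, m' j)) \<longlonglongrightarrow> 0"
      using tendsto_mult_left[OF lim, of "2 ^ Suc n"] by simp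
  qed simp
  moreover have "(LINT t|lborel. norm (h j t)) = (LINT t|lborel. h j t)" for j
    by (rule integral_cong_AE) (use int nn[of j] in \<open>auto elim!: eventually_mono\<close>)
  ultimately have "(\<lambda>j. LINT t|lborel. norm (h j t)) \<longlonglongrightarrow> 0" by simp
  then obtain r where r: "strict_mono r" "AE t in lborel. (\<lambda>j. h (r j) t) \<longlonglongrightarrow> 0"
    using tendsto_L1_AE_subseq[of lborel h, OF int] by blast
  \<comment> \<open>The chosen size must be positive for \<open>dM\<close> to be a metric on the
    window.\<close>
  define R' where "R' = max R 0"
  have "\<not> (AE t in lborel. t \<notin> {R'<..<R' + 1})"
  proof
    assume "AE t in lborel. t \<notin> {R'<..<R' + 1}"
    then have "{R'<..<R' + 1} \<in> null_sets lborel" by (subst AE_iff_null_sets) auto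
    then show False by (simp add: null_sets_def)
  qed
  then obtain t where t: "R' < t" "(\<lambda>j. h (r j) t) \<longlonglongrightarrow> 0"
    using eventually_mono[OF r(2), of "\<lambda>t. t \<notin> {R'<..<R' + 1}"] by auto
  have t0: "t > 0" "R < t" "\<bar>t\<bar> = t" using t(1) by (auto simp: R'_def)
  have ms: "Metric_space (caglad_space (- t) t) (dM t)"
    and eq: "\<And>X x. range X \<subseteq> caglad_space (-t) t \<and> x \<in> caglad_space (-t) t \<Longrightarrow>
           (\<lambda>j::nat. dM t (X j) x) \<longlonglongrightarrow> 0 \<longleftrightarrow> (\<lambda>j. M1_dist (-t) t (X j) x) \<longlonglongrightarrow> 0"
    using dM t0(1) unfolding M1_complete_metrics_def by auto
  have ABC: "0 \<le> A j t" "0 \<le> B j t" "0 \<le> C j t" for j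
    using C_dist_nonneg[OF Dx(1) Dy(1)] C_dist_nonneg[OF Dx(2) Dy(2)] Metric_space.nonneg[OF ms]
      less_imp_le[OF t0(1)]
    by (auto simp: A_def B_def C_def t0(3))
  have "(\<lambda>j. exp (t\<^sup>2) * h (r j) t) \<longlonglongrightarrow> exp (t\<^sup>2) * 0" by (intro tendsto_intros t(2))
  moreover have "exp (t\<^sup>2) * h j t = Phi (A j t) + Phi (B j t) + Phi (C j t)" for j
    by (simp add: h_def mult.assoc[symmetric] exp_add[symmetric])
  ultimately have s: "(\<lambda>j. Phi (A (r j) t) + Phi (B (r j) t) + Phi (C (r j) t)) \<longlonglongrightarrow> 0" by simp
  have P: "0 \<le> Phi (A j t)" "0 \<le> Phi (B j t)" "0 \<le> Phi (C j t)" for j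
    using Phi_bounds ABC by auto
  have "(\<lambda>j. Phi (A (r j) t)) \<longlonglongrightarrow> 0" "(\<lambda>j. Phi (B (r j) t)) \<longlonglongrightarrow> 0" "(\<lambda>j. Phi (C (r j) t)) \<longlonglongrightarrow> 0"
    by (rule tendsto_sandwich[OF _ _ tendsto_const s]; simp add: P add_nonneg_nonneg add_increasing add_increasing2)+
  then have AB: "(\<lambda>j. A (r j) t) \<longlonglongrightarrow> 0" "(\<lambda>j. B (r j) t) \<longlonglongrightarrow> 0" and C: "(\<lambda>j. C (r j) t) \<longlonglongrightarrow> 0"
    using Phi_tendsto_0D ABC by auto
  have wx: "window t (\<lambda>s. S s (\<phi> n)) \<in> caglad_space (- t) t"
    and wy: "\<And>j. window t (\<lambda>s. S' j s (\<phi> n)) \<in> caglad_space (- t) t"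
    by (intro window_caglad Dx Dy t0)+
  have "(\<lambda>j. dM t (window t (\<lambda>s. S' (r j) s (\<phi> n))) (window t (\<lambda>s. S s (\<phi> n)))) \<longlonglongrightarrow> 0"
    using C unfolding C_def t0(3) by (simp add: Metric_space.commute[OF ms])
  then have "(\<lambda>j. M1_dist (- t) t (window t (\<lambda>s. S' (r j) s (\<phi> n))) (window t (\<lambda>s. S s (\<phi> n)))) \<longlonglongrightarrow> 0"
    by (subst (asm) eq) (use wx wy in auto)
  then show ?thesis using r(1) t0 AB unfolding A_def B_def by (intro exI[of _ r] exI[of _ t]) simp
qed

text \<open>Parametric representations are continuous on a compact interval, so the real suprema in
  \<open>M1_dist\<close> are over bounded sets and bound every single value.\<close>

lemma M1_dist_less:
  assumes "M1_dist a b y x < ennreal e"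
  obtains u r v q where "parametric_rep a b y u r" "parametric_rep a b x v q"
    "\<And>s. s \<in> {0..1} \<Longrightarrow> \<bar>u s - v s\<bar> < e" "\<And>s. s \<in> {0..1} \<Longrightarrow> \<bar>r s - q s\<bar> < e"
proof -
  obtain u r v q where p: "parametric_rep a b y u r" "parametric_rep a b x v q"
    and lt: "ennreal (max (SUP s\<in>{0..1}. \<bar>u s - v s\<bar>) (SUP s\<in>{0..1}. \<bar>r s - q s\<bar>)) < ennreal e"
    using assms unfolding M1_dist_def Inf_less_iff by auto
  have bdd: "bdd_above ((\<lambda>s. \<bar>f s - g s\<bar>) ` {0..1})" if "continuous_on {0..1} f" "continuous_on {0..1} g"
    for f g :: "real \<Rightarrow> real"
  proof -
    have "compact ((\<lambda>s. \<bar>f s - g s\<bar>) ` {0..1})"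
      using that by (intro compact_continuous_image continuous_intros) auto
    then show ?thesis by (intro bounded_imp_bdd_above compact_imp_bounded)
  qed
  have c: "continuous_on {0..1} u" "continuous_on {0..1} v" "continuous_on {0..1} r" "continuous_on {0..1} q"
    using p by (auto simp: parametric_rep_def)
  have e: "e > 0" using lt by (cases "e > 0") (auto simp: ennreal_neg not_less)
  have "max (SUP s\<in>{0..1}. \<bar>u s - v s\<bar>) (SUP s\<in>{0..1}. \<bar>r s - q s\<bar>) < e"
    using lt ennreal_leI[of e "max (SUP s\<in>{0..1}. \<bar>u s - v s\<bar>) (SUP s\<in>{0..1}. \<bar>r s - q s\<bar>)"]
    by (simp only: not_le[symmetric]) blast
  then have lt': "(SUP s\<in>{0..1}. \<bar>u s - v s\<bar>) < e" "(SUP s\<in>{0..1}. \<bar>r s - q s\<bar>) < e" by auto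
  show ?thesis
  proof (rule that[OF p])
    fix s :: real assume s: "s \<in> {0..1}"
    show "\<bar>u s - v s\<bar> < e" using cSUP_upper[OF s bdd[OF c(1,2)]] lt'(1) by linarith
    show "\<bar>r s - q s\<bar> < e" using cSUP_upper[OF s bdd[OF c(3,4)]] lt'(2) by linarith
  qed
qed

text \<open>
  Suprema over open intervals are lower semicontinuous for the \<open>M\<^sub>1\<close> topology, while evaluation at a
  point is not continuous.
\<close>

lemma M1_exceeds:
  assumes y: "y \<in> caglad_space a b" and x: "x \<in> caglad_space a b"
    and ab: "a \<le> a'" "a' < s0" "s0 < b'" "b' \<le> b" and c: "x s0 > c"
    and d: "M1_dist a b y x < ennreal (min (x s0 - c) (min (s0 - a') (b' - s0)))"
  shows "\<exists>s. a' < s \<and> s < b' \<and> y s > c"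
proof -
  let ?e = "min (x s0 - c) (min (s0 - a') (b' - s0))"
  obtain u r v q where p: "parametric_rep a b y u r" "parametric_rep a b x v q"
    and close: "\<And>s. s \<in> {0..1} \<Longrightarrow> \<bar>u s - v s\<bar> < ?e" "\<And>s. s \<in> {0..1} \<Longrightarrow> \<bar>r s - q s\<bar> < ?e"
    using M1_dist_less[OF d] by blast
  \<comment> \<open>The parameter at which the representation of \<open>x\<close> passes through
    this point gives a point of the completed graph of \<open>y\<close> whose height exceeds
    \<open>c\<close> and whose time lies between \<open>a'\<close> and \<open>b'\<close>.\<close>
  have "(x s0, s0) \<in> completed_graph a b x" using ab by (simp add: completed_graph_def)
  then have "(x s0, s0) \<in> (\<lambda>s. (v s, q s)) ` {0..1}" using p(2) by (simp add: parametric_rep_def)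
  then obtain s where s: "s \<in> {0..1}" "v s = x s0" "q s = s0" by auto
  define t where "t = r s"
  have t: "a' < t" "t < b'" using close(2)[OF s(1)] s(3) by (auto simp: t_def)
  have us: "u s > c" using close(1)[OF s(1)] s(2) by auto
  \<comment> \<open>This point may lie inside the vertical segment of a jump of \<open>y\<close>.
    Then one end of the segment exceeds \<open>c\<close>: either the value \<open>y t\<close>, or
    the right limit, and in that case \<open>y\<close> exceeds \<open>c\<close> shortly after
    \<open>t\<close>.\<close>
  have "(u s, t) \<in> completed_graph a b y" using p(1) s(1) unfolding parametric_rep_def t_def by blast
  then have seg: "u s \<in> closed_segment (y t) (Lim (at_right t) y)"
    using t ab by (simp add: completed_graph_def)
  show ?thesis
  proof (cases "y t > c")
    case True
    then show ?thesis using t by blast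
  next
    case False
    then have lim: "Lim (at_right t) y > c"
      using seg us by (auto simp: closed_segment_eq_real_ivl split: if_splits)
    have "a \<le> t \<and> t < b" using t ab by linarith
    then obtain l where l: "(y \<longlongrightarrow> l) (at_right t)" using y unfolding caglad_space_def by blast
    then have "Lim (at_right t) y = l" by (intro tendsto_Lim) simp_all
    then have "\<forall>\<^sub>F s in at_right t. y s > c" using l lim by (auto intro: order_tendstoD)
    moreover have "\<forall>\<^sub>F s in at_right t. t < s \<and> s < b'"
      using eventually_at_right_real[OF t(2)] by eventually_elim simp
    ultimately have "\<forall>\<^sub>F s in at_right t. a' < s \<and> s < b' \<and> y s > c"
      by eventually_elim (use t in auto)
    from eventually_happens[OF this] show ?thesis by simp
  qed
qed

text \<open>If a trace failed to be open at \<open>x\<close>, points outside \<open>U\<close> at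
  distance below \<open>1 / Suc j\<close> would form a sequence converging to \<open>x\<close>.
  Since a single member in \<open>U\<close> is a contradiction, arguments along subsequences are
  enough.\<close>

lemma openin_traj_topI:
  assumes U: "U \<subseteq> traj_set k \<phi> \<psi>"
    and seq: "\<And>L x y. 1 \<le> L \<Longrightarrow> x \<in> U \<Longrightarrow> x \<in> traj_level k \<phi> \<psi> L \<Longrightarrow> (\<And>j. y j \<in> traj_level k \<phi> \<psi> L) \<Longrightarrow>
      (\<lambda>j::nat. traj_dist \<phi> \<psi> dM x (y j)) \<longlonglongrightarrow> 0 \<Longrightarrow> \<exists>j. y j \<in> U"
    and nonneg: "\<And>L x y. x \<in> traj_level k \<phi> \<psi> L \<Longrightarrow> y \<in> traj_level k \<phi> \<psi> L \<Longrightarrow> 0 \<le> traj_dist \<phi> \<psi> dM x y"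
  shows "openin (traj_top k \<phi> \<psi> dM) U"
  unfolding openin_traj_top
proof (intro conjI U allI impI)
  fix L :: nat assume L: "1 \<le> L"
  show "openin (metric_topology (traj_level k \<phi> \<psi> L) (traj_dist \<phi> \<psi> dM)) (U \<inter> traj_level k \<phi> \<psi> L)"
    unfolding openin_metric_topology
  proof (intro conjI ballI)
    fix x assume x: "x \<in> U \<inter> traj_level k \<phi> \<psi> L"
    show "\<exists>r>0. \<forall>y\<in>traj_level k \<phi> \<psi> L. traj_dist \<phi> \<psi> dM x y < r \<longrightarrow> y \<in> U \<inter> traj_level k \<phi> \<psi> L"
    proof (rule ccontr)
      assume "\<not> ?thesis"
      then have "\<forall>j::nat. \<exists>y. y \<in> traj_level k \<phi> \<psi> L \<and> traj_dist \<phi> \<psi> dM x y < 1 / Suc j \<and> y \<notin> U"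
        by (meson IntI of_nat_0_less_iff zero_less_Suc zero_less_divide_1_iff)
      then obtain y where y: "\<And>j. y j \<in> traj_level k \<phi> \<psi> L" "\<And>j. traj_dist \<phi> \<psi> dM x (y j) < 1 / Suc j" "\<And>j. y j \<notin> U"
        by metis
      have lim: "(\<lambda>j. traj_dist \<phi> \<psi> dM x (y j)) \<longlonglongrightarrow> 0"
      proof (rule tendsto_sandwich[OF _ _ tendsto_const LIMSEQ_Suc[OF lim_const_over_n[of 1]]])
        show "\<forall>\<^sub>F j in sequentially. 0 \<le> traj_dist \<phi> \<psi> dM x (y j)" by (intro always_eventually allI nonneg[where L = L]) (use x y(1) in auto)
        show "\<forall>\<^sub>F j in sequentially. traj_dist \<phi> \<psi> dM x (y j) \<le> 1 / real (Suc j)"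
          using y(2) by (intro always_eventually allI less_imp_le) auto
      qed
      have "\<exists>j. y j \<in> U" by (rule seq[OF L _ _ y(1) lim]) (use x in auto)
      then show False using y(3) by blast
    qed
  qed simp
qed

section \<open>Measurability of the canonical process\<close>

text \<open>By \<open>dual_norm_le\<close> the l2 ball of squared radius \<open>r\<^sup>2\<close>
  around the coordinates of \<open>l\<close> lies in the norm ball of radius
  \<open>r\<close>.\<close>

lemma (in semi_inner_space) dual_topology_coordinates:
  assumes b: "orthonormal_basis W ip \<phi>" and U: "openin (dual_topology W ip) U" and l: "l \<in> U"
  shows "\<exists>r>0. \<forall>l'\<in>dual_space W ip. (\<Sum>n. (l (\<phi> n) - l' (\<phi> n))\<^sup>2) < r \<longrightarrow> l' \<in> U"
proof -
  have lW: "l \<in> dual_space W ip"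
    and "\<exists>r>0. \<forall>l'\<in>dual_space W ip. dual_norm W ip (\<lambda>f. l f - l' f) < r \<longrightarrow> l' \<in> U"
    using U l unfolding dual_topology_def openin_metric_topology by auto
  then obtain r where r: "r > 0" "\<And>l'. l' \<in> dual_space W ip \<Longrightarrow> dual_norm W ip (\<lambda>f. l f - l' f) < r \<Longrightarrow> l' \<in> U"
    by blast
  show ?thesis
  proof (intro exI[of _ "r\<^sup>2"] conjI ballI impI)
    fix l' assume l': "l' \<in> dual_space W ip" and lt: "(\<Sum>n. (l (\<phi> n) - l' (\<phi> n))\<^sup>2) < r\<^sup>2"
    have "dual_norm W ip (\<lambda>f. l f - l' f) \<le> sqrt (\<Sum>n. (l (\<phi> n) - l' (\<phi> n))\<^sup>2)"
      by (rule dual_norm_le[OF dual_space_diff[OF lW l'] b])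
    also have "\<dots> < r" using lt r(1) by (simp add: real_less_lsqrt)
    finally show "l' \<in> U" by (rule r(2)[OF l'])
  qed (use r in simp)
qed

text \<open>The three coordinates of index \<open>n\<close> form one vector in a three-dimensional
  Euclidean space, so that a state is a single sequence in l2 and the criterion
  \<open>l2_open_vimage_measurable\<close> applies once.\<close>

definition state_coord :: "(nat \<Rightarrow> sfield) \<Rightarrow> (nat \<Rightarrow> vfield) \<Rightarrow> state \<Rightarrow> nat \<Rightarrow> real \<times> real \<times> real" where
  "state_coord \<phi> \<psi> z n = (fst z (\<phi> n), fst (snd z) (\<phi> n), snd (snd z) (\<psi> n))"

lemma norm_triple: "(norm (a, b, c))\<^sup>2 = a\<^sup>2 + b\<^sup>2 + (c::real)\<^sup>2" for a b :: real
  by (simp add: norm_prod_def)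

lemma topspace_state_space: "topspace (state_space k) = Wneg k \<times> Wneg k \<times> Wnegv k"
  by (simp add: state_space_def topspace_prod_topology Wneg_top_def Wnegv_top_def dual_topology_def
    topspace_metric_topology Wneg_def Wnegv_def)

text \<open>The l2 criterion is applied to open sets of the product topology themselves. A product
  of neighbourhoods of the three components contains a ball in the joint coordinates, since the sum
  of squares splits into three nonnegative sums.\<close>

lemma state_measurable:
  assumes \<phi>: "orthonormal_basis (W20 k) (W2_inner k) \<phi>" and \<psi>: "orthonormal_basis (W20v k) (W2v_inner k) \<psi>"
    and X: "\<And>\<omega>. \<omega> \<in> space M \<Longrightarrow> X \<omega> \<in> topspace (state_space k)"
    and meas: "\<And>n. (\<lambda>\<omega>. fst (X \<omega>) (\<phi> n)) \<in> borel_measurable M"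
      "\<And>n. (\<lambda>\<omega>. fst (snd (X \<omega>)) (\<phi> n)) \<in> borel_measurable M"
      "\<And>n. (\<lambda>\<omega>. snd (snd (X \<omega>)) (\<psi> n)) \<in> borel_measurable M"
  shows "X \<in> M \<rightarrow>\<^sub>M borel_on (state_space k)"
proof (rule measurable_borel_onI[OF X])
  interpret S: semi_inner_space "W20 k" "W2_inner k" by (rule W20_semi_inner_space)
  interpret Sv: semi_inner_space "W20v k" "W2v_inner k" by (rule W20v_semi_inner_space)
  have on: "\<And>n. \<phi> n \<in> W20 k" "\<And>m n. W2_inner k (\<phi> m) (\<phi> n) = (if m = n then 1 else 0)"
    "\<And>n. \<psi> n \<in> W20v k" "\<And>m n. W2v_inner k (\<psi> m) (\<psi> n) = (if m = n then 1 else 0)"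
    using \<phi> \<psi> by (auto simp: orthonormal_basis_def)
  have sm: "summable (\<lambda>n. (l (\<phi> n))\<^sup>2)" if "l \<in> Wneg k" for l
    using S.dual_coordinates_summable[of l \<phi>] that on by (simp add: Wneg_def)
  have smv: "summable (\<lambda>n. (l (\<psi> n))\<^sup>2)" if "l \<in> Wnegv k" for l
    using Sv.dual_coordinates_summable[of l \<psi>] that on by (simp add: Wnegv_def)
  have diff: "l \<in> Wneg k \<Longrightarrow> l' \<in> Wneg k \<Longrightarrow> (\<lambda>f. l f - l' f) \<in> Wneg k" for l l'
    unfolding Wneg_def by (rule S.dual_space_diff)
  have diffv: "l \<in> Wnegv k \<Longrightarrow> l' \<in> Wnegv k \<Longrightarrow> (\<lambda>f. l f - l' f) \<in> Wnegv k" for l l'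
    unfolding Wnegv_def by (rule Sv.dual_space_diff)
  fix U assume U: "openin (state_space k) U"
  show "X -` U \<inter> space M \<in> sets M"
  proof (rule l2_open_vimage_measurable[where H = "topspace (state_space k)" and c = "state_coord \<phi> \<psi>"])
    fix z assume z: "z \<in> topspace (state_space k)"
    then show "summable (\<lambda>n. (norm (state_coord \<phi> \<psi> z n))\<^sup>2)"
      unfolding state_coord_def norm_triple topspace_state_space
      by (intro summable_add sm smv) auto
  next
    show "U \<subseteq> topspace (state_space k)" by (rule openin_subset[OF U])
    fix z assume zU: "z \<in> U"
    obtain a b c where z: "z = (a, b, c)" by (cases z)
    have zH: "a \<in> Wneg k" "b \<in> Wneg k" "c \<in> Wnegv k"
      using openin_subset[OF U] zU by (auto simp: z topspace_state_space)
    obtain A B C where ABC: "openin (Wneg_top k) A" "openin (Wneg_top k) B" "openin (Wnegv_top k) C"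
      "a \<in> A" "b \<in> B" "c \<in> C" and sub: "A \<times> B \<times> C \<subseteq> U"
    proof -
      obtain A D where AD: "openin (Wneg_top k) A" "openin (prod_topology (Wneg_top k) (Wnegv_top k)) D"
        "a \<in> A" "(b, c) \<in> D" "A \<times> D \<subseteq> U"
        using U zU unfolding state_space_def openin_prod_topology_alt[of _ _ U] z by meson
      obtain B C where "openin (Wneg_top k) B" "openin (Wnegv_top k) C" "b \<in> B" "c \<in> C" "B \<times> C \<subseteq> D"
        using AD(2,4) unfolding openin_prod_topology_alt[of _ _ D] by meson
      with AD show ?thesis by (intro that[of A B C]) auto
    qed
    obtain ra where ra: "ra > 0" "\<And>l'. l' \<in> Wneg k \<Longrightarrow> (\<Sum>n. (a (\<phi> n) - l' (\<phi> n))\<^sup>2) < ra \<Longrightarrow> l' \<in> A"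
      using S.dual_topology_coordinates[OF \<phi> ABC(1)[unfolded Wneg_top_def] ABC(4)] unfolding Wneg_def by blast
    obtain rb where rb: "rb > 0" "\<And>l'. l' \<in> Wneg k \<Longrightarrow> (\<Sum>n. (b (\<phi> n) - l' (\<phi> n))\<^sup>2) < rb \<Longrightarrow> l' \<in> B"
      using S.dual_topology_coordinates[OF \<phi> ABC(2)[unfolded Wneg_top_def] ABC(5)] unfolding Wneg_def by blast
    obtain rc where rc: "rc > 0" "\<And>l'. l' \<in> Wnegv k \<Longrightarrow> (\<Sum>n. (c (\<psi> n) - l' (\<psi> n))\<^sup>2) < rc \<Longrightarrow> l' \<in> C"
      using Sv.dual_topology_coordinates[OF \<psi> ABC(3)[unfolded Wnegv_top_def] ABC(6)] unfolding Wnegv_def by blast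
    show "\<exists>r>0. \<forall>y\<in>topspace (state_space k). (\<Sum>n. (norm (state_coord \<phi> \<psi> z n - state_coord \<phi> \<psi> y n))\<^sup>2) < r \<longrightarrow> y \<in> U"
    proof (intro exI[of _ "min ra (min rb rc)"] conjI ballI impI)
      fix y assume "y \<in> topspace (state_space k)"
        and lt: "(\<Sum>n. (norm (state_coord \<phi> \<psi> z n - state_coord \<phi> \<psi> y n))\<^sup>2) < min ra (min rb rc)"
      then obtain a' b' c' where y: "y = (a', b', c')" "a' \<in> Wneg k" "b' \<in> Wneg k" "c' \<in> Wnegv k"
        by (auto simp: topspace_state_space)
      let ?a = "\<lambda>n. (a (\<phi> n) - a' (\<phi> n))\<^sup>2" and ?b = "\<lambda>n. (b (\<phi> n) - b' (\<phi> n))\<^sup>2" and ?c = "\<lambda>n. (c (\<psi> n) - c' (\<psi> n))\<^sup>2"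
      have s: "summable ?a" "summable ?b" "summable ?c"
        using sm[OF diff] smv[OF diffv] zH y by auto
      have "(\<Sum>n. (norm (state_coord \<phi> \<psi> z n - state_coord \<phi> \<psi> y n))\<^sup>2) = (\<Sum>n. ?a n + ?b n + ?c n)"
        unfolding state_coord_def z y by (simp add: norm_triple)
      also have "\<dots> = (\<Sum>n. ?a n) + (\<Sum>n. ?b n) + (\<Sum>n. ?c n)"
        using s by (simp add: suminf_add[symmetric] summable_add)
      finally have sum: "(\<Sum>n. ?a n) + (\<Sum>n. ?b n) + (\<Sum>n. ?c n) < min ra (min rb rc)" using lt by simp
      moreover have "0 \<le> (\<Sum>n. ?a n)" "0 \<le> (\<Sum>n. ?b n)" "0 \<le> (\<Sum>n. ?c n)"
        by (intro suminf_nonneg s zero_le_power2)+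
      ultimately have "(\<Sum>n. ?a n) < ra" "(\<Sum>n. ?b n) < rb" "(\<Sum>n. ?c n) < rc" by linarith+
      then have "y \<in> A \<times> B \<times> C" using ra(2) rb(2) rc(2) y by auto
      then show "y \<in> U" using sub by blast
    qed (use ra rb rc in auto)
  next
    show "(\<lambda>\<omega>. state_coord \<phi> \<psi> (X \<omega>) n) \<in> borel_measurable M" for n
      unfolding state_coord_def borel_prod[symmetric] by (intro measurable_Pair meas)
  qed (rule X)
qed


text \<open>Left continuity recovers the value at \<open>t\<close> from exceedances just before
  \<open>t\<close>: it is at least \<open>c\<close> iff every interval ending at \<open>t\<close>
  contains a time at which every level below \<open>c\<close> is surpassed. Shrinking intervals and
  levels run through countable families.\<close>

lemma left_continuous_measurable:
  fixes X :: "'a \<Rightarrow> real \<Rightarrow> real"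
  assumes lc: "\<And>\<omega>. \<omega> \<in> space M \<Longrightarrow> (X \<omega> \<longlongrightarrow> X \<omega> t) (at_left t)"
    and ex: "\<And>a b c. {\<omega> \<in> space M. \<exists>s. a < s \<and> s < b \<and> X \<omega> s > c} \<in> sets M"
  shows "(\<lambda>\<omega>. X \<omega> t) \<in> borel_measurable M"
proof (subst borel_measurable_iff_ge, intro allI)
  fix c :: real
  define E where "E i j = {\<omega> \<in> space M. \<exists>s. t - 1 / Suc i < s \<and> s < t \<and> X \<omega> s > c - 1 / Suc j}" for i j :: nat
  have "{\<omega> \<in> space M. c \<le> X \<omega> t} = (\<Inter>i. \<Inter>j. E i j)"
  proof (intro equalityI subsetI)
    fix \<omega> assume \<omega>: "\<omega> \<in> {\<omega> \<in> space M. c \<le> X \<omega> t}"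
    have "\<omega> \<in> E i j" for i j
    proof -
      have "c \<le> X \<omega> t" "0 < 1 / real (Suc j)" using \<omega> by simp_all
      then have "c - 1 / Suc j < X \<omega> t" by linarith
      then have "\<forall>\<^sub>F s in at_left t. c - 1 / Suc j < X \<omega> s"
        using lc[of \<omega>] \<omega> by (auto intro: order_tendstoD)
      moreover have "\<forall>\<^sub>F s in at_left t. t - 1 / Suc i < s \<and> s < t"
        using eventually_at_left_real[of "t - 1 / Suc i" t] by (simp add: eventually_mono)
      ultimately have "\<forall>\<^sub>F s in at_left t. t - 1 / Suc i < s \<and> s < t \<and> X \<omega> s > c - 1 / Suc j"
        by eventually_elim blast
      from eventually_happens[OF this] show ?thesis using \<omega> by (simp add: E_def)
    qed
    then show "\<omega> \<in> (\<Inter>i. \<Inter>j. E i j)" by blast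
  next
    fix \<omega> assume \<omega>: "\<omega> \<in> (\<Inter>i. \<Inter>j. E i j)"
    then have sp: "\<omega> \<in> space M" by (auto simp: E_def)
    have "c \<le> X \<omega> t"
    proof (rule ccontr)
      assume "\<not> c \<le> X \<omega> t"
      then obtain j :: nat where "inverse (real (Suc j)) < c - X \<omega> t" using reals_Archimedean[of "c - X \<omega> t"] by auto
      then have j: "X \<omega> t < c - 1 / Suc j" by (simp only: inverse_eq_divide)
      have "\<forall>\<^sub>F s in at_left t. X \<omega> s < c - 1 / Suc j"
        using lc[OF sp] j by (rule order_tendstoD(2))
      then obtain d where d: "d < t" "\<And>s. d < s \<Longrightarrow> s < t \<Longrightarrow> X \<omega> s < c - 1 / Suc j"
        unfolding eventually_at_left_field by blast
      obtain i :: nat where "inverse (real (Suc i)) < t - d" using reals_Archimedean[of "t - d"] d(1) by auto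
      then have i: "d < t - 1 / Suc i" by (simp only: inverse_eq_divide)
      have "\<omega> \<in> E i j" using \<omega> by blast
      then obtain s where "t - 1 / Suc i < s" "s < t" "X \<omega> s > c - 1 / Suc j" by (auto simp: E_def)
      then show False using d(2)[of s] i by linarith
    qed
    then show "\<omega> \<in> {\<omega> \<in> space M. c \<le> X \<omega> t}" using sp by simp
  qed
  moreover have "(\<Inter>i. \<Inter>j. E i j) \<in> sets M"
    using ex unfolding E_def by (intro sets.countable_INT) auto
  ultimately show "{\<omega> \<in> space M. c \<le> X \<omega> t} \<in> sets M" by simp
qed

text \<open>Time is replaced by a grid point strictly before it. For each mesh the process is then
  composed with a measurable index from a countable set, and left continuity yields the limit as the
  mesh tends to 0.\<close>

lemma left_continuous_joint_measurable:
  fixes X :: "'a \<Rightarrow> real \<Rightarrow> real"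
  assumes lc: "\<And>\<omega> t. \<omega> \<in> space M \<Longrightarrow> (X \<omega> \<longlongrightarrow> X \<omega> t) (at_left t)"
    and meas: "\<And>t. (\<lambda>\<omega>. X \<omega> t) \<in> borel_measurable M"
  shows "(\<lambda>z. X (fst z) (snd z)) \<in> borel_measurable (M \<Otimes>\<^sub>M lborel)"
proof (rule borel_measurable_LIMSEQ_real)
  \<comment> \<open>The last grid point strictly below \<open>t\<close>. The ceiling minus 1, unlike
    the floor, stays below \<open>t\<close> when \<open>t\<close> is itself a grid point, as
    convergence along \<open>at_left t\<close> requires.\<close>
  define g :: "nat \<Rightarrow> real \<Rightarrow> real" where "g j t = (of_int \<lceil>real (Suc j) * t\<rceil> - 1) / real (Suc j)" for j t
  show "(\<lambda>z. X (fst z) (g j (snd z))) \<in> borel_measurable (M \<Otimes>\<^sub>M lborel)" for j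
    unfolding g_def
  proof (rule measurable_compose_countable[where f = "\<lambda>i z. X (fst z) ((of_int i - 1) / real (Suc j))"])
    show "(\<lambda>z. X (fst z) ((of_int i - 1) / real (Suc j))) \<in> borel_measurable (M \<Otimes>\<^sub>M lborel)" for i :: int
      by (rule measurable_compose[OF measurable_fst meas])
    show "(\<lambda>z. \<lceil>real (Suc j) * snd z\<rceil>) \<in> M \<Otimes>\<^sub>M lborel \<rightarrow>\<^sub>M count_space UNIV"
      by measurable
  qed
  fix z :: "'a \<times> real" assume z: "z \<in> space (M \<Otimes>\<^sub>M lborel)"
  define t where "t = snd z"
  have g: "t - 1 / real (Suc j) \<le> g j t" "g j t < t" for j
  proof -
    have c: "of_int \<lceil>real (Suc j) * t\<rceil> - 1 < real (Suc j) * t" "real (Suc j) * t \<le> of_int \<lceil>real (Suc j) * t\<rceil>"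
      by linarith+
    have "(of_int \<lceil>real (Suc j) * t\<rceil> - 1) / real (Suc j) < real (Suc j) * t / real (Suc j)"
      by (rule divide_strict_right_mono[OF c(1)]) simp
    then show "g j t < t" by (simp add: g_def)
    have "(real (Suc j) * t - 1) / real (Suc j) \<le> (of_int \<lceil>real (Suc j) * t\<rceil> - 1) / real (Suc j)"
      by (rule divide_right_mono) (use c(2) in simp_all)
    moreover have "(real (Suc j) * t - 1) / real (Suc j) = t - 1 / real (Suc j)"
      by (simp add: diff_divide_distrib)
    ultimately show "t - 1 / real (Suc j) \<le> g j t" by (simp add: g_def)
  qed
  have "(\<lambda>j. g j t) \<longlonglongrightarrow> t"
  proof (rule tendsto_sandwich)
    have "(\<lambda>j. t - 1 / real (Suc j)) \<longlonglongrightarrow> t - 0"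
      by (intro tendsto_diff tendsto_const LIMSEQ_Suc[OF lim_const_over_n])
    then show "(\<lambda>j. t - 1 / real (Suc j)) \<longlonglongrightarrow> t" by simp
  qed (use g in \<open>auto intro!: always_eventually less_imp_le\<close>)
  moreover have "\<forall>\<^sub>F j in sequentially. g j t \<in> {..<t} \<and> g j t \<noteq> t"
    using g(2) by (auto intro!: always_eventually simp: less_imp_neq)
  ultimately have "filterlim (\<lambda>j. g j t) (at_left t) sequentially"
    unfolding filterlim_at by blast
  moreover have "fst z \<in> space M" using z by (auto simp: space_pair_measure)
  ultimately have "(\<lambda>j. X (fst z) (g j t)) \<longlonglongrightarrow> X (fst z) t"
    using filterlim_compose[OF lc] by blast
  then show "(\<lambda>j. X (fst z) (g j (snd z))) \<longlonglongrightarrow> X (fst z) (snd z)" by (simp add: t_def)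
qed

lemma left_continuous_process_measurable:
  fixes X :: "'a \<Rightarrow> real \<Rightarrow> real"
  assumes lc: "\<And>\<omega> t. \<omega> \<in> space M \<Longrightarrow> (X \<omega> \<longlongrightarrow> X \<omega> t) (at_left t)"
    and ex: "\<And>a b c. {\<omega> \<in> space M. \<exists>s. a < s \<and> s < b \<and> X \<omega> s > c} \<in> sets M"
  shows "(\<lambda>z. X (fst z) (snd z)) \<in> borel_measurable (M \<Otimes>\<^sub>M lborel)"
  by (rule left_continuous_joint_measurable[OF lc left_continuous_measurable[OF lc ex]])

section \<open>Exceedance events are open in the trajectory space\<close>

lemma traj_dist_nonneg:
  assumes "M1_complete_metrics dM" "x \<in> traj_level k \<phi> \<psi> L" "y \<in> traj_level k \<phi> \<psi> L"
  shows "0 \<le> traj_dist \<phi> \<psi> dM x y"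
proof -
  obtain \<rho>1 S1 m1 \<rho>2 S2 m2 where xy: "x = (\<rho>1, S1, m1)" "y = (\<rho>2, S2, m2)" by (cases x, cases y) auto
  note H = traj_dist_ge[OF assms(1) assms(2)[unfolded xy] assms(3)[unfolded xy], of 0]
  have "0 \<le> 1 / 2 ^ Suc 0 * (LINT t|lborel. exp (- t\<^sup>2) *
        (Phi (C_dist \<bar>t\<bar> (\<lambda>s. \<rho>1 s (\<phi> 0)) (\<lambda>s. \<rho>2 s (\<phi> 0))) +
         Phi (C_dist \<bar>t\<bar> (\<lambda>s. m1 s (\<psi> 0)) (\<lambda>s. m2 s (\<psi> 0))) +
         Phi (dM \<bar>t\<bar> (window t (\<lambda>s. S1 s (\<phi> 0))) (window t (\<lambda>s. S2 s (\<phi> 0))))))"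
    by (intro mult_nonneg_nonneg integral_nonneg_AE H(2)) simp
  also note H(3)
  finally show ?thesis by (simp add: xy)
qed

lemma continuous_C_dist_exceeds:
  assumes x: "continuous_on UNIV x" and y: "\<And>j. continuous_on UNIV (y j)"
    and lim: "(\<lambda>j. C_dist t x (y j)) \<longlonglongrightarrow> 0" and s: "\<bar>s\<bar> \<le> t" "x s > c"
  shows "\<exists>j::nat. y j s > c"
proof -
  have "\<forall>\<^sub>F j in sequentially. C_dist t x (y j) < x s - c"
    using lim s(2) by (intro order_tendstoD(2)) auto
  from eventually_happens[OF this] obtain j where "C_dist t x (y j) < x s - c" by auto
  then have "\<bar>x s - y j s\<bar> < x s - c" using C_dist_upper[OF x y s(1), of j] by linarith
  then show ?thesis by (intro exI[of _ j]) linarith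
qed

text \<open>For density and momentum the convergence is uniform on a window, so the same time
  \<open>s\<close> works for the approximating trajectories. For the entropy the time of exceedance
  may have to move a little, which an open interval tolerates.\<close>

lemma exceeds_open:
  assumes dM: "M1_complete_metrics dM"
  shows "openin (traj_top k \<phi> \<psi> dM) {\<omega> \<in> traj_set k \<phi> \<psi>. \<exists>s. a < s \<and> s < b \<and> fst \<omega> s (\<phi> n) > c}" (is "openin _ ?U1")
    and "openin (traj_top k \<phi> \<psi> dM) {\<omega> \<in> traj_set k \<phi> \<psi>. \<exists>s. a < s \<and> s < b \<and> fst (snd \<omega>) s (\<phi> n) > c}" (is "openin _ ?U2")
    and "openin (traj_top k \<phi> \<psi> dM) {\<omega> \<in> traj_set k \<phi> \<psi>. \<exists>s. a < s \<and> s < b \<and> snd (snd \<omega>) s (\<psi> n) > c}" (is "openin _ ?U3")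
proof -
  have sub: "\<exists>r t. strict_mono (r :: nat \<Rightarrow> nat) \<and> R < t \<and>
     (\<lambda>j. C_dist t (\<lambda>s. fst x s (\<phi> n)) (\<lambda>s. fst (y (r j)) s (\<phi> n))) \<longlonglongrightarrow> 0 \<and>
     (\<lambda>j. C_dist t (\<lambda>s. snd (snd x) s (\<psi> n)) (\<lambda>s. snd (snd (y (r j))) s (\<psi> n))) \<longlonglongrightarrow> 0 \<and>
     (\<lambda>j. M1_dist (- t) t (window t (\<lambda>s. fst (snd (y (r j))) s (\<phi> n))) (window t (\<lambda>s. fst (snd x) s (\<phi> n)))) \<longlonglongrightarrow> 0"
    if "x \<in> traj_level k \<phi> \<psi> L" "\<And>j. y j \<in> traj_level k \<phi> \<psi> L"
      "(\<lambda>j::nat. traj_dist \<phi> \<psi> dM x (y j)) \<longlonglongrightarrow> 0" for R x y L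
    using traj_dist_tendsto_subseq[OF dM, of "fst x" "fst (snd x)" "snd (snd x)" k \<phi> \<psi> L
      "\<lambda>j. fst (y j)" "\<lambda>j. fst (snd (y j))" "\<lambda>j. snd (snd (y j))" R n] that by simp
  have lev: "continuous_on UNIV (\<lambda>t. fst x t (\<phi> n))" "continuous_on UNIV (\<lambda>t. snd (snd x) t (\<psi> n))"
      "caglad (\<lambda>t. fst (snd x) t (\<phi> n))" if "x \<in> traj_level k \<phi> \<psi> L" for x L
    using traj_levelD[of "fst x" "fst (snd x)" "snd (snd x)" k \<phi> \<psi> L] that by auto
  note nn = traj_dist_nonneg[OF dM]
  show "openin (traj_top k \<phi> \<psi> dM) ?U1"
  proof (rule openin_traj_topI[OF _ _ nn])
    fix L x y assume L: "1 \<le> L" and xU: "x \<in> ?U1" and x: "x \<in> traj_level k \<phi> \<psi> L"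
      and y: "\<And>j. y j \<in> traj_level k \<phi> \<psi> L" and lim: "(\<lambda>j::nat. traj_dist \<phi> \<psi> dM x (y j)) \<longlonglongrightarrow> 0"
    obtain s where s: "a < s" "s < b" "fst x s (\<phi> n) > c" using xU by blast
    obtain r t where "\<bar>s\<bar> < t" and l: "(\<lambda>j. C_dist t (\<lambda>s. fst x s (\<phi> n)) (\<lambda>s. fst (y (r j)) s (\<phi> n))) \<longlonglongrightarrow> 0"
      using sub[OF x y lim, of "\<bar>s\<bar>"] by blast
    then obtain j where "fst (y (r j)) s (\<phi> n) > c"
      using continuous_C_dist_exceeds[OF lev(1)[OF x] lev(1)[OF y] l, of s c] s by auto
    then show "\<exists>j. y j \<in> ?U1" using s y[of "r j"] traj_level_subset[OF L] by (intro exI[of _ "r j"]) blast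
  qed auto
  show "openin (traj_top k \<phi> \<psi> dM) ?U3"
  proof (rule openin_traj_topI[OF _ _ nn])
    fix L x y assume L: "1 \<le> L" and xU: "x \<in> ?U3" and x: "x \<in> traj_level k \<phi> \<psi> L"
      and y: "\<And>j. y j \<in> traj_level k \<phi> \<psi> L" and lim: "(\<lambda>j::nat. traj_dist \<phi> \<psi> dM x (y j)) \<longlonglongrightarrow> 0"
    obtain s where s: "a < s" "s < b" "snd (snd x) s (\<psi> n) > c" using xU by blast
    obtain r t where "\<bar>s\<bar> < t" and l: "(\<lambda>j. C_dist t (\<lambda>s. snd (snd x) s (\<psi> n)) (\<lambda>s. snd (snd (y (r j))) s (\<psi> n))) \<longlonglongrightarrow> 0"
      using sub[OF x y lim, of "\<bar>s\<bar>"] by blast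
    then obtain j where "snd (snd (y (r j))) s (\<psi> n) > c"
      using continuous_C_dist_exceeds[OF lev(2)[OF x] lev(2)[OF y] l, of s c] s by auto
    then show "\<exists>j. y j \<in> ?U3" using s y[of "r j"] traj_level_subset[OF L] by (intro exI[of _ "r j"]) blast
  qed auto
  show "openin (traj_top k \<phi> \<psi> dM) ?U2"
  proof (rule openin_traj_topI[OF _ _ nn])
    fix L x y assume L: "1 \<le> L" and xU: "x \<in> ?U2" and x: "x \<in> traj_level k \<phi> \<psi> L"
      and y: "\<And>j. y j \<in> traj_level k \<phi> \<psi> L" and lim: "(\<lambda>j::nat. traj_dist \<phi> \<psi> dM x (y j)) \<longlonglongrightarrow> 0"
    obtain s where s: "a < s" "s < b" "fst (snd x) s (\<phi> n) > c" using xU by blast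
    \<comment> \<open>This size makes the window contain both \<open>a\<close> and \<open>b\<close>
      in its interior.\<close>
    obtain r t where t: "\<bar>a\<bar> + \<bar>b\<bar> < t" and l: "(\<lambda>j. M1_dist (- t) t (window t (\<lambda>s. fst (snd (y (r j))) s (\<phi> n))) (window t (\<lambda>s. fst (snd x) s (\<phi> n)))) \<longlonglongrightarrow> 0"
      using sub[OF x y lim, of "\<bar>a\<bar> + \<bar>b\<bar>"] by blast
    have t0: "t > 0" "- t < a" "b < t" using t by linarith+
    let ?x = "window t (\<lambda>s. fst (snd x) s (\<phi> n))"
    have wx: "?x s' = fst (snd x) s' (\<phi> n)" if "a < s'" "s' < b" for s'
      using that t0 by (simp add: window_def)
    have "0 < ennreal (min (?x s - c) (min (s - a) (b - s)))" using s by (simp add: wx)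
    then have "\<forall>\<^sub>F j in sequentially. M1_dist (- t) t (window t (\<lambda>s. fst (snd (y (r j))) s (\<phi> n))) ?x < ennreal (min (?x s - c) (min (s - a) (b - s)))"
      by (rule order_tendstoD(2)[OF l])
    from eventually_happens[OF this] obtain j where
      j: "M1_dist (- t) t (window t (\<lambda>s. fst (snd (y (r j))) s (\<phi> n))) ?x < ennreal (min (?x s - c) (min (s - a) (b - s)))" by auto
    have "\<exists>s. a < s \<and> s < b \<and> window t (\<lambda>s. fst (snd (y (r j))) s (\<phi> n)) s > c"
      by (rule M1_exceeds[OF window_caglad[OF lev(3)[OF y] t0(1)] window_caglad[OF lev(3)[OF x] t0(1)] _ _ _ _ _ j])
        (use s t0 wx in auto)
    then obtain s' where s': "a < s'" "s' < b" "window t (\<lambda>s. fst (snd (y (r j))) s (\<phi> n)) s' > c" by blast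
    then have "fst (snd (y (r j))) s' (\<phi> n) > c" using t0 by (simp add: window_def)
    then show "\<exists>j. y j \<in> ?U2" using s' y[of "r j"] traj_level_subset[OF L] by (intro exI[of _ "r j"]) blast
  qed auto
qed

lemma traj_setD:
  assumes "\<omega> \<in> traj_set k \<phi> \<psi>"
  shows "at_time \<omega> t \<in> topspace (state_space k)"
    "((\<lambda>t. fst (at_time \<omega> t) (\<phi> n)) \<longlongrightarrow> fst (at_time \<omega> t) (\<phi> n)) (at_left t)"
    "((\<lambda>t. fst (snd (at_time \<omega> t)) (\<phi> n)) \<longlongrightarrow> fst (snd (at_time \<omega> t)) (\<phi> n)) (at_left t)"
    "((\<lambda>t. snd (snd (at_time \<omega> t)) (\<psi> n)) \<longlongrightarrow> snd (snd (at_time \<omega> t)) (\<psi> n)) (at_left t)"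
proof -
  obtain \<rho> S m where \<omega>: "\<omega> = (\<rho>, S, m)" by (cases \<omega>)
  then obtain L where "(\<rho>, S, m) \<in> traj_level k \<phi> \<psi> L" using assms by (auto simp: traj_set_def)
  note D = traj_levelD[OF this]
  have c: "(x \<longlongrightarrow> x t) (at_left t)" if "continuous_on UNIV x" for x :: "real \<Rightarrow> real"
    using that continuous_on_eq_continuous_at[OF open_UNIV] by (auto simp: isCont_def intro: tendsto_within_subset)
  show "at_time \<omega> t \<in> topspace (state_space k)"
    "((\<lambda>t. fst (at_time \<omega> t) (\<phi> n)) \<longlongrightarrow> fst (at_time \<omega> t) (\<phi> n)) (at_left t)"
    "((\<lambda>t. fst (snd (at_time \<omega> t)) (\<phi> n)) \<longlongrightarrow> fst (snd (at_time \<omega> t)) (\<phi> n)) (at_left t)"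
    "((\<lambda>t. snd (snd (at_time \<omega> t)) (\<psi> n)) \<longlongrightarrow> snd (snd (at_time \<omega> t)) (\<psi> n)) (at_left t)"
    using D c[OF D(1)] c[OF D(2)] by (auto simp: \<omega> at_time_def topspace_state_space caglad_def)
qed

lemma at_time_measurable:
  assumes dM: "M1_complete_metrics dM"
    and \<phi>: "orthonormal_basis (W20 k) (W2_inner k) \<phi>" and \<psi>: "orthonormal_basis (W20v k) (W2v_inner k) \<psi>"
    and V: "sets V = sets (borel_on (traj_top k \<phi> \<psi> dM))"
  shows "(\<lambda>z. at_time (fst z) (snd z)) \<in> V \<Otimes>\<^sub>M lborel \<rightarrow>\<^sub>M borel_on (state_space k)"
proof -
  have sp: "space V = traj_set k \<phi> \<psi>" using sets_eq_imp_space_eq[OF V] by (simp add: topspace_traj_top)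
  have at: "at_time \<omega> t = (fst \<omega> t, fst (snd \<omega>) t, snd (snd \<omega>) t)" for \<omega> t
    by (simp add: at_time_def case_prod_beta)
  note op = openin_sets_borel_on[OF exceeds_open(1)[OF dM]] openin_sets_borel_on[OF exceeds_open(2)[OF dM]]
    openin_sets_borel_on[OF exceeds_open(3)[OF dM]]
  show ?thesis
  proof (rule state_measurable[OF \<phi> \<psi>])
    fix z :: "trajectory \<times> real" assume "z \<in> space (V \<Otimes>\<^sub>M lborel)"
    then show "at_time (fst z) (snd z) \<in> topspace (state_space k)"
      by (intro traj_setD(1)[where \<phi>=\<phi> and \<psi>=\<psi>]) (auto simp: space_pair_measure sp)
  next
    fix n
    show "(\<lambda>z. fst (at_time (fst z) (snd z)) (\<phi> n)) \<in> borel_measurable (V \<Otimes>\<^sub>M lborel)"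
    proof (rule left_continuous_process_measurable)
      show "((\<lambda>t. fst (at_time \<omega> t) (\<phi> n)) \<longlongrightarrow> fst (at_time \<omega> t) (\<phi> n)) (at_left t)" if "\<omega> \<in> space V" for \<omega> t
        using traj_setD(2) that by (simp add: sp)
      show "{\<omega> \<in> space V. \<exists>s. a < s \<and> s < b \<and> c < fst (at_time \<omega> s) (\<phi> n)} \<in> sets V" for a b c
        using op(1) by (simp add: sp V at)
    qed
    show "(\<lambda>z. fst (snd (at_time (fst z) (snd z))) (\<phi> n)) \<in> borel_measurable (V \<Otimes>\<^sub>M lborel)"
    proof (rule left_continuous_process_measurable)
      show "((\<lambda>t. fst (snd (at_time \<omega> t)) (\<phi> n)) \<longlongrightarrow> fst (snd (at_time \<omega> t)) (\<phi> n)) (at_left t)" if "\<omega> \<in> space V" for \<omega> t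
        using traj_setD(3) that by (simp add: sp)
      show "{\<omega> \<in> space V. \<exists>s. a < s \<and> s < b \<and> c < fst (snd (at_time \<omega> s)) (\<phi> n)} \<in> sets V" for a b c
        using op(2) by (simp add: sp V at)
    qed
    show "(\<lambda>z. snd (snd (at_time (fst z) (snd z))) (\<psi> n)) \<in> borel_measurable (V \<Otimes>\<^sub>M lborel)"
    proof (rule left_continuous_process_measurable)
      show "((\<lambda>t. snd (snd (at_time \<omega> t)) (\<psi> n)) \<longlongrightarrow> snd (snd (at_time \<omega> t)) (\<psi> n)) (at_left t)" if "\<omega> \<in> space V" for \<omega> t
        using traj_setD(4) that by (simp add: sp)
      show "{\<omega> \<in> space V. \<exists>s. a < s \<and> s < b \<and> c < snd (snd (at_time \<omega> s)) (\<psi> n)} \<in> sets V" for a b c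
        using op(3) by (simp add: sp V at)
    qed
  qed
qed

section \<open>Stationary processes\<close>

lemma caglad_shift:
  assumes "caglad x"
  shows "caglad (\<lambda>t. x (t + T))"
proof -
  have L: "filterlim (\<lambda>s. s + T) (at_left (t + T)) (at_left t)" for t
    by (auto simp: filterlim_at eventually_at_filter intro!: tendsto_intros)
  have R: "filterlim (\<lambda>s. s + T) (at_right (t + T)) (at_right t)" for t
    by (auto simp: filterlim_at eventually_at_filter intro!: tendsto_intros)
  show ?thesis
    unfolding caglad_def
  proof (intro allI conjI)
    fix t
    show "((\<lambda>t. x (t + T)) \<longlongrightarrow> x (t + T)) (at_left t)"
      by (rule filterlim_compose[OF _ L]) (use assms in \<open>simp add: caglad_def\<close>)
    obtain l where "(x \<longlongrightarrow> l) (at_right (t + T))" using assms by (auto simp: caglad_def)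
    from filterlim_compose[OF this R] show "\<exists>l. ((\<lambda>t. x (t + T)) \<longlongrightarrow> l) (at_right t)" by blast
  qed
qed

text \<open>Trajectories are measurable in time for the completed measure, so a translation has to
  respect null sets; it does because it preserves Lebesgue measure.\<close>

lemma lebesgue_translation_measurable: "(\<lambda>t. t + T) \<in> lebesgue \<rightarrow>\<^sub>M (lebesgue :: real measure)"
proof (rule completion.measurable_completion2)
  show m: "(\<lambda>t. t + T) \<in> lebesgue \<rightarrow>\<^sub>M lborel" by (intro measurable_completion) simp
  have "distr lborel borel ((+) T) = lborel" by (rule lborel_distr_plus)
  then have "distr lebesgue lborel (\<lambda>t. t + T) = lborel"
    by (subst distr_completion) (auto simp: add.commute cong: distr_cong)
  then show "null_sets lborel \<subseteq> null_sets (distr lebesgue lborel (\<lambda>t. t + T))" by simp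
qed

lemma shift_traj_level:
  assumes "\<omega> \<in> traj_level k \<phi> \<psi> L"
  shows "shift T \<omega> \<in> traj_level k \<phi> \<psi> L"
proof -
  obtain \<rho> S m where \<omega>: "\<omega> = (\<rho>, S, m)" by (cases \<omega>)
  have c: "continuous_on UNIV (\<lambda>t. x (t + T))" if "continuous_on UNIV x" for x :: "real \<Rightarrow> real"
    by (rule continuous_on_compose2[OF that]) (auto intro!: continuous_intros)
  show ?thesis
    using assms unfolding traj_level_def \<omega> shift_def
    by (auto intro: c caglad_shift measurable_compose[OF lebesgue_translation_measurable])
qed

lemma shift_traj_set: "\<omega> \<in> traj_set k \<phi> \<psi> \<Longrightarrow> shift T \<omega> \<in> traj_set k \<phi> \<psi>"
  by (auto simp: traj_set_def intro: shift_traj_level)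

lemma shift_shift: "shift T (shift T' \<omega>) = shift (T + T') \<omega>"
  by (simp add: shift_def case_prod_beta add.assoc)

lemma shift_0: "shift 0 \<omega> = \<omega>"
  by (simp add: shift_def case_prod_beta)

lemma at_time_shift: "at_time (shift T \<omega>) t = at_time \<omega> (t + T)"
  by (simp add: shift_def at_time_def case_prod_beta)

text \<open>Invariance is recorded for images, as in the definition of a stationary statistical
  solution; that the shifts are measurable maps is a consequence drawn below.\<close>

locale stationary_process = prob_space V for V :: "trajectory measure" +
  fixes k \<phi> \<psi> dM
  assumes sets_V: "sets V = sets (borel_on (traj_top k \<phi> \<psi> dM))"
    and shift_image: "\<And>B T. B \<in> sets V \<Longrightarrow> emeasure V (shift T ` B) = emeasure V B"
    and dM: "M1_complete_metrics dM"
    and basis: "orthonormal_basis (W20 k) (W2_inner k) \<phi>"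
    and basis_v: "orthonormal_basis (W20v k) (W2v_inner k) \<psi>"
begin

lemma space_V: "space V = traj_set k \<phi> \<psi>"
  using sets_eq_imp_space_eq[OF sets_V] by (simp add: topspace_traj_top)

lemma shift_vimage: "shift T -` B \<inter> space V = shift (- T) ` B" if "B \<subseteq> space V"
proof (intro equalityI subsetI)
  fix \<omega> assume "\<omega> \<in> shift T -` B \<inter> space V"
  then have "\<omega> = shift (- T) (shift T \<omega>)" "shift T \<omega> \<in> B" by (auto simp: shift_shift shift_0)
  then show "\<omega> \<in> shift (- T) ` B" by blast
next
  fix \<omega> assume "\<omega> \<in> shift (- T) ` B"
  then obtain \<omega>' where w: "\<omega>' \<in> B" "\<omega> = shift (- T) \<omega>'" by blast
  then have "shift T \<omega> = \<omega>'" by (simp add: shift_shift shift_0)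
  moreover have "\<omega>' \<in> traj_set k \<phi> \<psi>" using w(1) that by (auto simp: space_V)
  then have "\<omega> \<in> space V" unfolding w(2) space_V by (rule shift_traj_set)
  ultimately show "\<omega> \<in> shift T -` B \<inter> space V" using w by simp
qed

text \<open>
  A set of nonzero measure is measurable, so preservation of the measure of images forces the image of
  \<open>B\<close> or that of its complement to be measurable.
\<close>

lemma shift_image_measurable:
  assumes B: "B \<in> sets V"
  shows "shift T ` B \<in> sets V"
proof (cases "emeasure V B = 0")
  case False
  then have "emeasure V (shift T ` B) \<noteq> 0" using shift_image[OF B] by simp
  then show ?thesis using emeasure_notin_sets by blast
next
  case True
  have "space V - B \<in> sets V" using B by auto
  moreover have "emeasure V (space V - B) = 1"
    using True emeasure_compl[OF B] emeasure_space_1 by simp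
  ultimately have "emeasure V (shift T ` (space V - B)) \<noteq> 0" using shift_image by simp
  then have "shift T ` (space V - B) \<in> sets V" using emeasure_notin_sets by blast
  then have "space V - shift T ` (space V - B) \<in> sets V" by auto
  moreover have "space V - shift T ` (space V - B) = shift T ` B"
  proof -
    have Bs: "B \<subseteq> space V" by (rule sets.sets_into_space[OF B])
    have "shift T ` (space V - B) = shift (- T) -` (space V - B) \<inter> space V" "shift T ` B = shift (- T) -` B \<inter> space V"
      using shift_vimage[of "space V - B" "- T"] shift_vimage[OF Bs, of "- T"] by auto
    then show ?thesis using shift_traj_set[of _ k \<phi> \<psi> "- T"] by (auto simp: space_V)
  qed
  ultimately show ?thesis by simp
qed

lemma shift_measurable: "shift T \<in> V \<rightarrow>\<^sub>M V"
proof (rule measurableI)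
  show "\<omega> \<in> space V \<Longrightarrow> shift T \<omega> \<in> space V" for \<omega> by (simp add: space_V shift_traj_set)
  show "B \<in> sets V \<Longrightarrow> shift T -` B \<inter> space V \<in> sets V" for B
    using shift_vimage[OF sets.sets_into_space] shift_image_measurable by simp
qed

lemma distr_shift: "distr V V (shift T) = V"
proof (rule measure_eqI)
  fix B assume "B \<in> sets (distr V V (shift T))"
  then have B: "B \<in> sets V" by simp
  then show "emeasure (distr V V (shift T)) B = emeasure V B"
    using shift_vimage[OF sets.sets_into_space[OF B]] shift_image[OF B]
    by (simp add: emeasure_distr shift_measurable)
qed simp

sublocale flow: measure_preserving_map V "shift 1"
  by unfold_locales (rule shift_measurable, rule distr_shift)

text \<open>Invariance under every real shift, and not only the unit one, enters here: all one-time
  distributions of the process coincide.\<close>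

lemma nn_integral_at_time:
  assumes [measurable]: "h \<in> borel_measurable (borel_on (state_space k))"
  shows "(\<integral>\<^sup>+\<omega>. h (at_time \<omega> t) \<partial>V) = (\<integral>\<^sup>+\<omega>. h (at_time \<omega> 0) \<partial>V)"
proof -
  have at0: "(\<lambda>\<omega>. at_time \<omega> 0) \<in> V \<rightarrow>\<^sub>M borel_on (state_space k)"
    using measurable_compose[OF measurable_Pair2'[of 0 lborel V] at_time_measurable[OF dM basis basis_v sets_V]] by simp
  have "(\<integral>\<^sup>+\<omega>. h (at_time \<omega> 0) \<partial>V) = (\<integral>\<^sup>+\<omega>. h (at_time \<omega> 0) \<partial>distr V V (shift t))"
    by (simp only: distr_shift)
  also have "\<dots> = (\<integral>\<^sup>+\<omega>. h (at_time (shift t \<omega>) 0) \<partial>V)"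
    using measurable_compose[OF at0 assms] by (intro nn_integral_distr[OF shift_measurable]) simp
  finally show ?thesis by (simp add: at_time_shift)
qed

lemma ergodic_theorem:
  fixes F :: "state \<Rightarrow> real"
  assumes F: "F \<in> borel_measurable (borel_on (state_space k))"
    and fin: "(\<integral>\<^sup>+\<omega>. ennreal \<bar>F (at_time \<omega> 0)\<bar> \<partial>V) < \<infinity>"
  shows "(AE \<omega> in V. \<forall>T>0. set_integrable lborel {0..T} (\<lambda>t. F (at_time \<omega> t))) \<and>
    (\<exists>Fbar \<in> borel_measurable V.
       (AE \<omega> in V. ((\<lambda>T. time_average F T \<omega>) \<longlongrightarrow> Fbar \<omega>) at_top) \<and>
       integrable V Fbar \<and> (\<forall>T>0. integrable V (time_average F T)) \<and>
       ((\<lambda>T. \<integral>\<omega>. \<bar>time_average F T \<omega> - Fbar \<omega>\<bar> \<partial>V) \<longlongrightarrow> 0) at_top)"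
proof -
  \<comment> \<open>The signs \<open>s = 1\<close> and \<open>s = -1\<close> give the positive and
    the negative part of \<open>F\<close> along the process.\<close>
  define G where "G s \<omega> t = max 0 (s * F (at_time \<omega> t))" for s \<omega> t
  define A where "A s T \<omega> = 1 / T * (LINT t:{0..T}|lborel. G s \<omega> t)" for s T \<omega>
  have FV: "(\<lambda>z. F (at_time (fst z) (snd z))) \<in> borel_measurable (V \<Otimes>\<^sub>M lborel)"
    by (rule measurable_compose[OF at_time_measurable[OF dM basis basis_v sets_V] F])
  have G_meas: "(\<lambda>(\<omega>, t). G s \<omega> t) \<in> borel_measurable (V \<Otimes>\<^sub>M lborel)" for s
    unfolding G_def case_prod_beta
    by (intro borel_measurable_max borel_measurable_times FV) auto
  have G0: "0 \<le> G s \<omega> t" for s \<omega> t by (simp add: G_def)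
  have G1: "G s \<omega> (t + 1) = G s (shift 1 \<omega>) t" for s \<omega> t by (simp add: G_def at_time_shift)
  have G_stat: "(\<integral>\<^sup>+\<omega>. ennreal (G s \<omega> t) \<partial>V) = (\<integral>\<^sup>+\<omega>. ennreal (G s \<omega> 0) \<partial>V)" for s t
    unfolding G_def
    by (rule nn_integral_at_time[of "\<lambda>z. ennreal (max 0 (s * F z))"])
      (intro measurable_compose[OF _ measurable_ennreal] borel_measurable_max borel_measurable_times F; simp)
  have G_fin: "(\<integral>\<^sup>+\<omega>. ennreal (G s \<omega> 0) \<partial>V) < \<infinity>" if "\<bar>s\<bar> = 1" for s
  proof -
    have "G s \<omega> 0 \<le> \<bar>F (at_time \<omega> 0)\<bar>" for \<omega>
    proof -
      have "s * F (at_time \<omega> 0) \<le> \<bar>s * F (at_time \<omega> 0)\<bar>" by (rule abs_ge_self)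
      then show ?thesis using that by (simp add: G_def abs_mult)
    qed
    then have "(\<integral>\<^sup>+\<omega>. ennreal (G s \<omega> 0) \<partial>V) \<le> (\<integral>\<^sup>+\<omega>. ennreal \<bar>F (at_time \<omega> 0)\<bar> \<partial>V)"
      by (intro nn_integral_mono ennreal_leI)
    then show ?thesis using fin by (rule le_less_trans)
  qed
  note flow = flow.ergodic_flow_nonneg[OF G_meas G0 G1 G_stat G_fin]
  have int: "AE \<omega> in V. \<forall>T>0. set_integrable lborel {0..T} (G s \<omega>)" if "\<bar>s\<bar> = 1" for s
    using flow(1)[OF that] .
  have ex: "\<exists>g\<in>borel_measurable V. (AE \<omega> in V. ((\<lambda>T. A s T \<omega>) \<longlongrightarrow> g \<omega>) at_top) \<and> integrable V g \<and>
       (\<forall>T>0. integrable V (A s T)) \<and> ((\<lambda>T. \<integral>\<omega>. \<bar>A s T \<omega> - g \<omega>\<bar> \<partial>V) \<longlongrightarrow> 0) at_top" if "\<bar>s\<bar> = 1" for s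
    using flow(2)[OF that] unfolding A_def[abs_def] .
  obtain p where p: "p \<in> borel_measurable V" "AE \<omega> in V. ((\<lambda>T. A 1 T \<omega>) \<longlongrightarrow> p \<omega>) at_top" "integrable V p"
       "\<And>T. T > 0 \<Longrightarrow> integrable V (A 1 T)" "((\<lambda>T. \<integral>\<omega>. \<bar>A 1 T \<omega> - p \<omega>\<bar> \<partial>V) \<longlongrightarrow> 0) at_top"
    using ex[of 1] by auto
  obtain q where q: "q \<in> borel_measurable V" "AE \<omega> in V. ((\<lambda>T. A (-1) T \<omega>) \<longlongrightarrow> q \<omega>) at_top" "integrable V q"
       "\<And>T. T > 0 \<Longrightarrow> integrable V (A (-1) T)" "((\<lambda>T. \<integral>\<omega>. \<bar>A (-1) T \<omega> - q \<omega>\<bar> \<partial>V) \<longlongrightarrow> 0) at_top"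
    using ex[of "-1"] by auto
  have FG: "F (at_time \<omega> t) = G 1 \<omega> t - G (-1) \<omega> t" for \<omega> t by (simp add: G_def max_def)
  have ae: "AE \<omega> in V. \<forall>T>0. set_integrable lborel {0..T} (\<lambda>t. F (at_time \<omega> t)) \<and>
      time_average F T \<omega> = A 1 T \<omega> - A (-1) T \<omega>"
    using int[of 1, OF abs_one] int[of "-1", simplified]
  proof eventually_elim
    case (elim \<omega>)
    show ?case
    proof (intro allI impI conjI)
      fix T :: real assume "T > 0"
      then have i: "set_integrable lborel {0..T} (G 1 \<omega>)" "set_integrable lborel {0..T} (G (-1) \<omega>)"
        using elim by auto
      show "set_integrable lborel {0..T} (\<lambda>t. F (at_time \<omega> t))"
        unfolding FG by (rule set_integral_diff(1)[OF i])
      show "time_average F T \<omega> = A 1 T \<omega> - A (-1) T \<omega>"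
        unfolding time_average_def A_def FG set_integral_diff(2)[OF i] by (rule right_diff_distrib)
    qed
  qed
  \<comment> \<open>The splitting into two averages holds only almost everywhere, so measurability
    of the average as it is defined at every trajectory has to be shown on its own.\<close>
  have ta_meas: "time_average F T \<in> borel_measurable V" for T
  proof -
    have "(\<lambda>(\<omega>, t). indicator {0..T} t *\<^sub>R F (at_time \<omega> t)) \<in> borel_measurable (V \<Otimes>\<^sub>M lborel)"
      unfolding case_prod_beta by (intro borel_measurable_scaleR FV) measurable
    then have "(\<lambda>\<omega>. \<integral>t. indicator {0..T} t *\<^sub>R F (at_time \<omega> t) \<partial>lborel) \<in> borel_measurable V"
      by (rule lborel.borel_measurable_lebesgue_integral)
    then show ?thesis unfolding time_average_def[abs_def] set_lebesgue_integral_def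
      by (intro borel_measurable_times) auto
  qed
  have ta_int: "integrable V (time_average F T)" if T: "T > 0" for T
  proof (rule integrable_cong_AE_imp)
    show "integrable V (\<lambda>\<omega>. A 1 T \<omega> - A (-1) T \<omega>)" using p(4)[OF T] q(4)[OF T] by simp
    show "AE \<omega> in V. A 1 T \<omega> - A (-1) T \<omega> = time_average F T \<omega>"
      using ae by eventually_elim (use T in simp)
  qed (rule ta_meas)
  have lim: "AE \<omega> in V. ((\<lambda>T. time_average F T \<omega>) \<longlongrightarrow> p \<omega> - q \<omega>) at_top"
    using ae p(2) q(2)
  proof eventually_elim
    case (elim \<omega>)
    have "((\<lambda>T. A 1 T \<omega> - A (-1) T \<omega>) \<longlongrightarrow> p \<omega> - q \<omega>) at_top" using elim(2,3) by (rule tendsto_diff)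
    moreover have "\<forall>\<^sub>F T in at_top. A 1 T \<omega> - A (-1) T \<omega> = time_average F T \<omega>"
      using eventually_gt_at_top[of 0] by eventually_elim (use elim(1) in simp)
    ultimately show ?case by (rule Lim_transform_eventually)
  qed
  have L1: "((\<lambda>T. \<integral>\<omega>. \<bar>time_average F T \<omega> - (p \<omega> - q \<omega>)\<bar> \<partial>V) \<longlongrightarrow> 0) at_top"
  proof (rule tendsto_sandwich)
    show "\<forall>\<^sub>F T in at_top. 0 \<le> (\<integral>\<omega>. \<bar>time_average F T \<omega> - (p \<omega> - q \<omega>)\<bar> \<partial>V)" by simp
    show "\<forall>\<^sub>F T in at_top. (\<integral>\<omega>. \<bar>time_average F T \<omega> - (p \<omega> - q \<omega>)\<bar> \<partial>V) \<le>
        (\<integral>\<omega>. \<bar>A 1 T \<omega> - p \<omega>\<bar> \<partial>V) + (\<integral>\<omega>. \<bar>A (-1) T \<omega> - q \<omega>\<bar> \<partial>V)"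
      using eventually_gt_at_top[of 0]
    proof eventually_elim
      case (elim T)
      have i: "integrable V (\<lambda>\<omega>. \<bar>A 1 T \<omega> - p \<omega>\<bar>)" "integrable V (\<lambda>\<omega>. \<bar>A (-1) T \<omega> - q \<omega>\<bar>)"
        using p(3) p(4)[OF elim] q(3) q(4)[OF elim] by auto
      have "(\<integral>\<omega>. \<bar>time_average F T \<omega> - (p \<omega> - q \<omega>)\<bar> \<partial>V) \<le> (\<integral>\<omega>. \<bar>A 1 T \<omega> - p \<omega>\<bar> + \<bar>A (-1) T \<omega> - q \<omega>\<bar> \<partial>V)"
      proof (rule integral_mono_AE)
        show "integrable V (\<lambda>\<omega>. \<bar>time_average F T \<omega> - (p \<omega> - q \<omega>)\<bar>)"
          using ta_int[OF elim] p(3) q(3) by simp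
        show "integrable V (\<lambda>\<omega>. \<bar>A 1 T \<omega> - p \<omega>\<bar> + \<bar>A (-1) T \<omega> - q \<omega>\<bar>)" using i by simp
        show "AE \<omega> in V. \<bar>time_average F T \<omega> - (p \<omega> - q \<omega>)\<bar> \<le> \<bar>A 1 T \<omega> - p \<omega>\<bar> + \<bar>A (-1) T \<omega> - q \<omega>\<bar>"
          using ae
        proof eventually_elim
          case (elim \<omega>)
          then have "time_average F T \<omega> = A 1 T \<omega> - A (-1) T \<omega>" using \<open>0 < T\<close> by simp
          then show ?case by linarith
        qed
      qed
      also have "\<dots> = (\<integral>\<omega>. \<bar>A 1 T \<omega> - p \<omega>\<bar> \<partial>V) + (\<integral>\<omega>. \<bar>A (-1) T \<omega> - q \<omega>\<bar> \<partial>V)"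
        using i by simp
      finally show ?case .
    qed
    show "((\<lambda>T. (\<integral>\<omega>. \<bar>A 1 T \<omega> - p \<omega>\<bar> \<partial>V) + (\<integral>\<omega>. \<bar>A (-1) T \<omega> - q \<omega>\<bar> \<partial>V)) \<longlongrightarrow> 0) at_top"
      using tendsto_add[OF p(5) q(5)] by simp
  qed simp
  show ?thesis
  proof (intro conjI bexI[of _ "\<lambda>\<omega>. p \<omega> - q \<omega>"] allI impI lim L1 ta_int)
    show "AE \<omega> in V. \<forall>T>0. set_integrable lborel {0..T} (\<lambda>t. F (at_time \<omega> t))"
      using ae by eventually_elim simp
    show "integrable V (\<lambda>\<omega>. p \<omega> - q \<omega>)" using p(3) q(3) by simp
    show "(\<lambda>\<omega>. p \<omega> - q \<omega>) \<in> borel_measurable V" using p(1) q(1) by simp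
  qed
qed

end

lemma stationary_statistical_solution_process:
  assumes V: "stationary_statistical_solution D M k \<phi> \<psi> dM V"
    and "M1_complete_metrics dM"
    and "orthonormal_basis (W20 k) (W2_inner k) \<phi>" "orthonormal_basis (W20v k) (W2v_inner k) \<psi>"
  shows "stationary_process V k \<phi> \<psi> dM"
proof -
  let ?X = "traj_top k \<phi> \<psi> dM" and ?A = "entire_solution_set D M k"
  obtain V0 where V0: "prob_space V0" "sets V0 = sets (borel_on (subtopology ?X ?A))"
    "V = distr V0 (borel_on ?X) (\<lambda>\<omega>. \<omega>)"
    and inv: "\<And>B T. B \<in> sets (borel_on ?X) \<Longrightarrow> emeasure V (shift T ` B) = emeasure V B"
    using V unfolding stationary_statistical_solution_def by blast
  have sp: "space V0 = topspace ?X \<inter> ?A"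
    using sets_eq_imp_space_eq[OF V0(2)] by simp
  have "(\<lambda>\<omega>. \<omega>) \<in> V0 \<rightarrow>\<^sub>M borel_on ?X"
  proof (rule measurable_borel_onI)
    fix U assume U: "openin ?X U"
    \<comment> \<open>Traces of open sets are open in the subspace, so the inclusion is measurable
      and its image measure is again a probability measure.\<close>
    have "openin (subtopology ?X ?A) (U \<inter> ?A)" using U by (rule openin_subtopology_Int)
    moreover have "(\<lambda>\<omega>. \<omega>) -` U \<inter> space V0 = U \<inter> ?A" using openin_subset[OF U] by (auto simp: sp)
    ultimately show "(\<lambda>\<omega>. \<omega>) -` U \<inter> space V0 \<in> sets V0" by (simp add: V0(2) openin_sets_borel_on)
  qed (simp add: sp)
  then have "prob_space V" unfolding V0(3) by (rule prob_space.prob_space_distr[OF V0(1)])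
  moreover have "sets V = sets (borel_on ?X)" by (simp add: V0(3))
  ultimately show ?thesis
    using inv assms(2-4) by (simp add: stationary_process_def stationary_process_axioms_def)
qed

theorem theorem5p4:
  fixes D :: nsf and \<beta> M k :: real
    and \<phi> :: "nat \<Rightarrow> sfield" and \<psi> :: "nat \<Rightarrow> vfield"
    and dM :: "real \<Rightarrow> (real \<Rightarrow> real) \<Rightarrow> (real \<Rightarrow> real) \<Rightarrow> real"
    and V :: "trajectory measure" and F :: "state \<Rightarrow> real"
  assumes "Theta_B D > 0" and "Theta_U D > 0"
    and "constitutive D" and "transport D \<beta>" and "\<beta> > 6" and "M > 0"
    and "k > 3/2"
    and "orthonormal_basis (W20 k) (W2_inner k) \<phi>" and "\<forall>n. smooth_field (\<phi> n)"
    and "orthonormal_basis (W20v k) (W2v_inner k) \<psi>" and "\<forall>n i. smooth_field (\<lambda>x. \<psi> n x $ i)"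
    and "M1_complete_metrics dM"
    and "stationary_statistical_solution D M k \<phi> \<psi> dM V"
    and "F \<in> borel_measurable (borel_on (state_space k))"
    and "(\<integral>\<^sup>+\<omega>. ennreal \<bar>F (at_time \<omega> 0)\<bar> \<partial>V) < \<infinity>"
  shows "(AE \<omega> in V. \<forall>T>0. set_integrable lborel {0..T} (\<lambda>t. F (at_time \<omega> t))) \<and>
    (\<exists>Fbar \<in> borel_measurable V.
       (AE \<omega> in V. ((\<lambda>T. time_average F T \<omega>) \<longlongrightarrow> Fbar \<omega>) at_top) \<and>
       integrable V Fbar \<and> (\<forall>T>0. integrable V (time_average F T)) \<and>
       ((\<lambda>T. \<integral>\<omega>. \<bar>time_average F T \<omega> - Fbar \<omega>\<bar> \<partial>V) \<longlongrightarrow> 0) at_top)"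
proof -
  interpret stationary_process V k \<phi> \<psi> dM
    using assms(8,10,12,13) by (intro stationary_statistical_solution_process)
  show ?thesis using assms(14,15) by (rule ergodic_theorem)
qed

end
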